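(* The cocycle twist of ${\mathcal U}_q^{\widehat c_m}$ by the bicharacter $\gamma$ is isomorphic to $\mathcal O_q(M_{2,m})$, the algebra of $2\times m$ quantum matrices.
   Context: $k$ algebraically closed of characteristic $0$, $q\in k^\times$ transcendental over $\mathbb Q$, $\hat q=q-q^{-1}$, $m>1$, $[u,v]=uv-q^{-1}vu$. $Q(A_m)$: lattice of $(a_1,\dots,a_{m+1})\in\mathbb Z^{m+1}$ with $\sum a_i=0$, standard inner product; $Q(\widehat A_m)=Q(A_m)\oplus\mathbb Z\delta$ with $\delta$ orthogonal to everything; simple roots $\alpha_i=e_i-e_{i+1}$ ($1\le i\le m$), $\alpha_0=e_{m+1}-e_1+\delta$; reflections $s_i(\mu)=\mu-\langle\mu,\alpha_i\rangle\alpha_i$. ${\mathcal U}_q(\widehat{\mathfrak{sl}}_{m+1})$ is generated by $E_i,F_i$ ($0\le i\le m$), $K_\mu$ ($\mu\in Q(\widehat A_m)$) with relations $K_0=1$, $K_\mu K_\lambda=K_{\mu+\lambda}$, $K_\mu E_i=q^{\langle\mu,\alpha_i\rangle}E_iK_\mu$, $K_\mu F_i=q^{-\langle\mu,\alpha_i\rangle}F_iK_\mu$, $E_iE_j=E_jE_i$, $F_iF_j=F_jF_i$ if $\langle\alpha_i,\alpha_j\rangle\in\{0,2\}$, $E_i[E_i,E_j]=q[E_i,E_j]E_i$, $F_i[F_i,F_j]=q[F_i,F_j]F_i$ if $\langle\alpha_i,\alpha_j\rangle=-1$, $E_iF_j-F_jE_i=\delta_{ij}(K_{\alpha_i}-K_{-\alpha_i})/\hat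 q$; Lusztig automorphisms $T_iK_\mu=K_{s_i\mu}$, $T_iE_i=-F_iK_{\alpha_i}$, $T_iF_i=-K_{-\alpha_i}E_i$, and for $j\ne i$: $T_iE_j=E_j$ if $\langle\alpha_i,\alpha_j\rangle=0$, $T_iE_j=E_iE_j-q^{-1}E_jE_i$ if $\langle\alpha_i,\alpha_j\rangle=-1$. For the reduced word $\widehat c_m=(s_1\cdots s_m)(s_0s_1\cdots s_{m-1})=s_{i_1}\cdots s_{i_{2m}}$, the root vectors $T_{i_1}\cdots T_{i_{\ell-1}}E_{i_\ell}$ have degree $s_{i_1}\cdots s_{i_{\ell-1}}\alpha_{i_\ell}\in Q(\widehat A_m)$; the De Concini–Kac–Procesi algebra ${\mathcal U}_q^{\widehat c_m}$ is the subalgebra they generate, graded by $Q(\widehat A_m)$ via these degrees. Cocycle twist: for an algebra $\Lambda$ graded by an abelian group $M$ and a 2-cocycle $c:M\times M\to k^\times$, $\Lambda'$ is $\Lambda$ as a graded vector space ($x\leftrightarrow x'$) with product $x'y'=c(\deg x,\deg y)(xy)'$ for homogeneous $x,y$. $\gamma:Q(\widehat A_m)\times Q(\widehat A_m)\to k^\times$ is the bicharacter with $\gamma(\alpha_0,\alpha_1)=q$ and $\gamma(\alpha_i,\alpha_j)=1$ for all other pairs. $\mathcal O_q(M_{2,m})$ is the $k$-algebra generated by $X_{ij}$ ($i\in\{1,2\}$, $1\le j\le m$) with relations $X_{ij}X_{il}=qX_{il}X_{ij}$ ($j<l$), $X_{1j}X_{2j}=qX_{2j}X_{1j}$, $X_{1l}X_{2j}=X_{2j}X_{1l}$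 ($j<l$), $X_{1j}X_{2l}-X_{2l}X_{1j}=\hat qX_{1l}X_{2j}$ ($j<l$). *)

theory Defs
  imports "HOL-Library.Poly_Mapping" "HOL-Computational_Algebra.Polynomial"
begin

text \<open>Words in an alphabet 'g form a (non-commutative) monoid under concatenation.
  The free associative k-algebra on 'g is the monoid algebra the finitely supported functions from words to k.\<close>

datatype 'g word = Wd "'g list"

fun letters :: "'g word \<Rightarrow> 'g list" where "letters (Wd xs) = xs"

instantiation word :: (type) monoid_add
begin
definition zero_word_def: "0 = Wd []"
definition plus_word_def: "u + v = Wd (letters u @ letters v)"
instance
proof
  fix a b c :: "'a word"
  show "a + b + c = a + (b + c)" by (cases a; cases b; cases c) (simp add: plus_word_def)
  show "0 + a = a" by (cases a) (simp add: plus_word_def zero_word_def)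
  show "a + 0 = a" by (cases a) (simp add: plus_word_def zero_word_def)
qed
end

type_synonym ('g, 'k) freealg = "'g word \<Rightarrow>\<^sub>0 'k"

definition sc :: "'k::ring_1 \<Rightarrow> ('g, 'k) freealg" where
  "sc c = Poly_Mapping.single 0 c"

definition gen :: "'g \<Rightarrow> ('g, 'k::ring_1) freealg" where
  "gen g = Poly_Mapping.single (Wd [g]) 1"

definition free_on :: "'g set \<Rightarrow> ('g, 'k::ring_1) freealg \<Rightarrow> bool" where
  "free_on G p \<longleftrightarrow> (\<forall>w \<in> Poly_Mapping.keys p. set (letters w) \<subseteq> G)"

definition ext_free :: "('g \<Rightarrow> ('h, 'k::ring_1) freealg) \<Rightarrow> ('g, 'k) freealg \<Rightarrow> ('h, 'k) freealg" where
  "ext_free \<phi> p = (\<Sum>w \<in> Poly_Mapping.keys p. sc (Poly_Mapping.lookup p w) * prod_list (map \<phi> (letters w)))"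

inductive_set ideal_gen :: "('g, 'k::ring_1) freealg set \<Rightarrow> ('g, 'k) freealg set"
  for S where
  zero: "0 \<in> ideal_gen S"
| base: "s \<in> S \<Longrightarrow> s \<in> ideal_gen S"
| add: "a \<in> ideal_gen S \<Longrightarrow> b \<in> ideal_gen S \<Longrightarrow> a + b \<in> ideal_gen S"
| mult: "a \<in> ideal_gen S \<Longrightarrow> x * a * y \<in> ideal_gen S"

definition alg_closed :: "'k::field itself \<Rightarrow> bool" where
  "alg_closed _ \<longleftrightarrow> (\<forall>p :: 'k poly. degree p \<ge> 1 \<longrightarrow> (\<exists>x. poly p x = 0))"

definition transcendental_over_Q :: "'k::field_char_0 \<Rightarrow> bool" where
  "transcendental_over_Q q \<longleftrightarrow> (\<forall>p :: rat poly. p \<noteq> 0 \<longrightarrow> poly (map_poly of_rat p) q \<noteq> 0)"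

definition qhat :: "'k::field \<Rightarrow> 'k" where "qhat q = q - inverse q"

text \<open>An element of Q(A_m) + Z delta is encoded as a function mu :: nat => int, where
  mu 0 is the coefficient of delta and mu 1, ..., mu (m+1) are the coordinates
  (a_1,...,a_(m+1)) with sum 0; all other values are 0.\<close>

type_synonym lat = "nat \<Rightarrow> int"

definition qlat :: "nat \<Rightarrow> lat \<Rightarrow> bool" where
  "qlat m \<mu> \<longleftrightarrow> (\<forall>i > m + 1. \<mu> i = 0) \<and> (\<Sum>i=1..m+1. \<mu> i) = 0"

definition ip :: "nat \<Rightarrow> lat \<Rightarrow> lat \<Rightarrow> int" where
  "ip m \<mu> \<nu> = (\<Sum>i=1..m+1. \<mu> i * \<nu> i)"

definition lzero :: lat where "lzero = (\<lambda>_. 0)"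
definition ladd :: "lat \<Rightarrow> lat \<Rightarrow> lat" where "ladd \<mu> \<nu> = (\<lambda>i. \<mu> i + \<nu> i)"
definition lneg :: "lat \<Rightarrow> lat" where "lneg \<mu> = (\<lambda>i. - \<mu> i)"
definition lsmul :: "int \<Rightarrow> lat \<Rightarrow> lat" where "lsmul c \<mu> = (\<lambda>i. c * \<mu> i)"

definition sroot :: "nat \<Rightarrow> nat \<Rightarrow> lat" where
  "sroot m i = (if i = 0
     then (\<lambda>j. if j = 0 then 1 else if j = m + 1 then 1 else if j = 1 then -1 else 0)
     else (\<lambda>j. if j = i then 1 else if j = i + 1 then -1 else 0))"

definition srefl :: "nat \<Rightarrow> nat \<Rightarrow> lat \<Rightarrow> lat" where
  "srefl m i \<mu> = ladd \<mu> (lsmul (- ip m \<mu> (sroot m i)) (sroot m i))"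

text \<open>Coefficient of alpha_j in mu = sum_i c_i alpha_i (0 <= j <= m).\<close>
definition acoeff :: "lat \<Rightarrow> nat \<Rightarrow> int" where
  "acoeff \<mu> j = \<mu> 0 + (\<Sum>i=1..j. \<mu> i)"

definition gamma :: "nat \<Rightarrow> 'k::field \<Rightarrow> lat \<Rightarrow> lat \<Rightarrow> 'k" where
  "gamma m q \<mu> \<nu> = (\<Prod>i\<in>{0..m}. \<Prod>j\<in>{0..m}.
      (if i = 0 \<and> j = 1 then q else 1) powi (acoeff \<mu> i * acoeff \<nu> j))"

datatype ugen = E nat | F nat | K lat

definition ugens :: "nat \<Rightarrow> ugen set" where
  "ugens m = {E i | i. i \<le> m} \<union> {F i | i. i \<le> m} \<union> {K \<mu> | \<mu>. qlat m \<mu>}"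

definition qcomm :: "'k::field \<Rightarrow> ('g, 'k) freealg \<Rightarrow> ('g, 'k) freealg \<Rightarrow> ('g, 'k) freealg" where
  "qcomm q u v = u * v - sc (inverse q) * v * u"

definition U_rels :: "nat \<Rightarrow> 'k::field \<Rightarrow> (ugen, 'k) freealg set" where
  "U_rels m q =
     {gen (K lzero) - 1}
   \<union> {gen (K \<mu>) * gen (K \<nu>) - gen (K (ladd \<mu> \<nu>)) | \<mu> \<nu>. qlat m \<mu> \<and> qlat m \<nu>}
   \<union> {gen (K \<mu>) * gen (E i) - sc (q powi ip m \<mu> (sroot m i)) * gen (E i) * gen (K \<mu>)
        | \<mu> i. qlat m \<mu> \<and> i \<le> m}
   \<union> {gen (K \<mu>) * gen (F i) - sc (q powi (- ip m \<mu> (sroot m i))) * gen (F i) * gen (K \<mu>)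
        | \<mu> i. qlat m \<mu> \<and> i \<le> m}
   \<union> {gen (E i) * gen (E j) - gen (E j) * gen (E i)
        | i j. i \<le> m \<and> j \<le> m \<and> ip m (sroot m i) (sroot m j) \<in> {0, 2}}
   \<union> {gen (F i) * gen (F j) - gen (F j) * gen (F i)
        | i j. i \<le> m \<and> j \<le> m \<and> ip m (sroot m i) (sroot m j) \<in> {0, 2}}
   \<union> {gen (E i) * qcomm q (gen (E i)) (gen (E j)) - sc q * qcomm q (gen (E i)) (gen (E j)) * gen (E i)
        | i j. i \<le> m \<and> j \<le> m \<and> ip m (sroot m i) (sroot m j) = -1}
   \<union> {gen (F i) * qcomm q (gen (F i)) (gen (F j)) - sc q * qcomm q (gen (F i)) (gen (F j)) * gen (F i)
        | i j. i \<le> m \<and> j \<le> m \<and> ip m (sroot m i) (sroot m j) = -1}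
   \<union> {gen (E i) * gen (F j) - gen (F j) * gen (E i)
        - (if i = j then sc (inverse (qhat q)) * (gen (K (sroot m i)) - gen (K (lneg (sroot m i)))) else 0)
        | i j. i \<le> m \<and> j \<le> m}"

definition U_ideal :: "nat \<Rightarrow> 'k::field \<Rightarrow> (ugen, 'k) freealg set" where
  "U_ideal m q = ideal_gen (U_rels m q)"

text \<open>Lusztig automorphism T_i (Lusztig's T''_(i,1)), on generators.  The images of F_j for
  j \<noteq> i are not listed in the paper's context; we use Lusztig's standard formula.\<close>
definition T_gen :: "nat \<Rightarrow> 'k::field \<Rightarrow> nat \<Rightarrow> ugen \<Rightarrow> (ugen, 'k) freealg" where
  "T_gen m q i g = (case g of
       K \<mu> \<Rightarrow> gen (K (srefl m i \<mu>))
     | E j \<Rightarrow> (if j = i then - (gen (F i) * gen (K (sroot m i)))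
              else if ip m (sroot m i) (sroot m j) = -1
                then gen (E i) * gen (E j) - sc (inverse q) * gen (E j) * gen (E i)
              else gen (E j))
     | F j \<Rightarrow> (if j = i then - (gen (K (lneg (sroot m i))) * gen (E i))
              else if ip m (sroot m i) (sroot m j) = -1
                then gen (F j) * gen (F i) - sc q * gen (F i) * gen (F j)
              else gen (F j)))"

definition T :: "nat \<Rightarrow> 'k::field \<Rightarrow> nat \<Rightarrow> (ugen, 'k) freealg \<Rightarrow> (ugen, 'k) freealg" where
  "T m q i = ext_free (T_gen m q i)"

text \<open>The reduced word c^_m = (s_1 ... s_m)(s_0 s_1 ... s_(m-1)) as the list i_1, ..., i_(2m).\<close>
definition cword :: "nat \<Rightarrow> nat list" where
  "cword m = [1..<m+1] @ [0..<m]"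

definition root_vec :: "nat \<Rightarrow> 'k::field \<Rightarrow> nat \<Rightarrow> (ugen, 'k) freealg" where
  "root_vec m q l = foldr (T m q) (take (l - 1) (cword m)) (gen (E (cword m ! (l - 1))))"

text \<open>The De Concini--Kac--Procesi algebra (representatives in the free algebra): the
  subalgebra generated by the root vectors.\<close>
inductive_set DCKP :: "nat \<Rightarrow> 'k::field \<Rightarrow> (ugen, 'k) freealg set" for m q where
  scalar: "sc c \<in> DCKP m q"
| root: "1 \<le> l \<Longrightarrow> l \<le> 2 * m \<Longrightarrow> root_vec m q l \<in> DCKP m q"
| add: "a \<in> DCKP m q \<Longrightarrow> b \<in> DCKP m q \<Longrightarrow> a + b \<in> DCKP m q"
| mult: "a \<in> DCKP m q \<Longrightarrow> b \<in> DCKP m q \<Longrightarrow> a * b \<in> DCKP m q"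

fun ugdeg :: "nat \<Rightarrow> ugen \<Rightarrow> lat" where
  "ugdeg m (E i) = sroot m i"
| "ugdeg m (F i) = lneg (sroot m i)"
| "ugdeg m (K \<mu>) = lzero"

definition wdeg :: "nat \<Rightarrow> ugen word \<Rightarrow> lat" where
  "wdeg m w = foldr ladd (map (ugdeg m) (letters w)) lzero"

text \<open>Cocycle-twisted product: x' y' = gamma(deg x, deg y) (x y)' for homogeneous x, y,
  extended bilinearly (computed on monomials of the free algebra, whose grading
  descends to U since all relations are homogeneous).\<close>
definition twprod :: "nat \<Rightarrow> 'k::field \<Rightarrow> (ugen, 'k) freealg \<Rightarrow> (ugen, 'k) freealg \<Rightarrow> (ugen, 'k) freealg" where
  "twprod m q x y = (\<Sum>w \<in> Poly_Mapping.keys x. \<Sum>v \<in> Poly_Mapping.keys y.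
      Poly_Mapping.single (w + v) (gamma m q (wdeg m w) (wdeg m v) * Poly_Mapping.lookup x w * Poly_Mapping.lookup y v))"

datatype ogen = X nat nat

definition ogens :: "nat \<Rightarrow> ogen set" where
  "ogens m = {X i j | i j. i \<in> {1, 2} \<and> 1 \<le> j \<and> j \<le> m}"

definition O_rels :: "nat \<Rightarrow> 'k::field \<Rightarrow> (ogen, 'k) freealg set" where
  "O_rels m q =
     {gen (X i j) * gen (X i l) - sc q * gen (X i l) * gen (X i j)
        | i j l. i \<in> {1, 2} \<and> 1 \<le> j \<and> j < l \<and> l \<le> m}
   \<union> {gen (X 1 j) * gen (X 2 j) - sc q * gen (X 2 j) * gen (X 1 j) | j. 1 \<le> j \<and> j \<le> m}
   \<union> {gen (X 1 l) * gen (X 2 j) - gen (X 2 j) * gen (X 1 l) | j l. 1 \<le> j \<and> j < l \<and> l \<le> m}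
   \<union> {gen (X 1 j) * gen (X 2 l) - gen (X 2 l) * gen (X 1 j) - sc (qhat q) * gen (X 1 l) * gen (X 2 j)
        | j l. 1 \<le> j \<and> j < l \<and> l \<le> m}"

definition O_ideal :: "nat \<Rightarrow> 'k::field \<Rightarrow> (ogen, 'k) freealg set" where
  "O_ideal m q = ideal_gen (O_rels m q)"

text \<open>Phi, given on representatives, induces a well-defined k-algebra isomorphism from
  O_q(M_(2,m)) = k<X_ij>/O_ideal onto the cocycle twist of the DCKP subalgebra of
  U = k<ugens>/U_ideal.\<close>
definition iso_Oq_twisted_DCKP ::
  "nat \<Rightarrow> 'k::field \<Rightarrow> ((ogen, 'k) freealg \<Rightarrow> (ugen, 'k) freealg) \<Rightarrow> bool" where
  "iso_Oq_twisted_DCKP m q \<Phi> \<longleftrightarrow>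
     (let inO = free_on (ogens m); IO = O_ideal m q; IU = U_ideal m q in
      (\<forall>a b. inO a \<longrightarrow> inO b \<longrightarrow> a - b \<in> IO \<longrightarrow> \<Phi> a - \<Phi> b \<in> IU)
    \<and> (\<forall>c a b. inO a \<longrightarrow> inO b \<longrightarrow> \<Phi> (sc c * a + b) - (sc c * \<Phi> a + \<Phi> b) \<in> IU)
    \<and> (\<forall>a b. inO a \<longrightarrow> inO b \<longrightarrow> \<Phi> (a * b) - twprod m q (\<Phi> a) (\<Phi> b) \<in> IU)
    \<and> \<Phi> 1 - 1 \<in> IU
    \<and> (\<forall>a. inO a \<longrightarrow> (\<exists>d \<in> DCKP m q. \<Phi> a - d \<in> IU))
    \<and> (\<forall>d \<in> DCKP m q. \<exists>a. inO a \<and> \<Phi> a - d \<in> IU)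
    \<and> (\<forall>a b. inO a \<longrightarrow> inO b \<longrightarrow> \<Phi> a - \<Phi> b \<in> IU \<longrightarrow> a - b \<in> IO))"

end

theory Submission
  imports Defs "HOL-Library.Function_Algebras" "HOL-Library.Product_Plus" "HOL-Library.Multiset"
begin

text \<open>Write \<open>[u, v] = u v - q\<^sup>-\<^sup>1 v u\<close>. In the quantum affine algebra the root vectors are
  \<open>x\<^sub>1 = E\<^sub>1\<close>, \<open>x\<^sub>j\<^sub>+\<^sub>1 = [x\<^sub>j, E\<^sub>j\<^sub>+\<^sub>1]\<close>, \<open>y\<^sub>1 = [x\<^sub>m, [E\<^sub>1, E\<^sub>0]]\<close>, \<open>y\<^sub>j\<^sub>+\<^sub>1 = [y\<^sub>j, E\<^sub>j\<^sub>+\<^sub>1]\<close>, and the isomorphism sends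
  \<open>X\<^sub>1\<^sub>j\<close> to \<open>x\<^sub>j\<close> and \<open>X\<^sub>2\<^sub>j\<close> to \<open>y\<^sub>j\<close>. The quadratic relations among them follow from the Serre relations because
  the \<open>q\<close>-adjoint action of an element \<open>e\<close> is a twisted derivation: applying it often enough to a relation between
  lowest weight vectors gives the same relation between highest weight vectors. Injectivity: normal words span
  the algebra of quantum matrices, and their images are linearly independent because in a tensor product of two
  \<open>q\<close>-oscillator representations, filtered suitably, \<open>x\<^sub>j\<close> has a leading term acting as a weighted shift in the second factor
  and \<open>y\<^sub>j\<close> one acting as a weighted shift in the first.\<close>

section \<open>Algebras with an action of q and quantum Serre relations\<close>

text \<open>Which sums of brackets survive is decided in two rings, the quotient of the free algebra
  and a ring of operators. The bracket calculus therefore lives in a ring without unit, with q and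
  q^-1 given as additive maps. The Lusztig maps act on representatives: each root vector is expanded
  into brackets in the free algebra and only then read modulo the relations. The one expansion that
  uses relations is T_1 ... T_m E_j = E_(j+1) for 1 <= j < m, and it is the origin of the recursion
  for y_(j+1). Before the twist x_j y_j = q^2 y_j x_j, and x_l y_j = q y_j x_l for j < l. Since
  gamma (deg y, deg x) = q, the twist removes exactly one factor q from each. One oscillator would
  not separate monomials: x_1 y_2 and x_2 y_1 shift by the same degree. With x leading in one tensor
  factor and y in the other, the pair of shifts determines the monomial. The obstacle is a
  filtration for which the first factor is negligible in every x_j and dominant in every y_j,
  although y_1 is itself a bracket with x_m.\<close>

definition scalar_op :: "('a::ring \<Rightarrow> 'a) \<Rightarrow> bool" where
  "scalar_op f \<longleftrightarrow> (\<forall>x y. f (x + y) = f x + f y) \<and> (\<forall>x y. f x * y = f (x * y))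
     \<and> (\<forall>x y. x * f y = f (x * y))"

lemma scalar_op_simps:
  assumes "scalar_op f"
  shows "f (x + y) = f x + f y" "f 0 = 0" "f (- x) = - f x" "f (x - y) = f x - f y"
    "f x * y = f (x * y)" "x * f y = f (x * y)"
proof -
  have a: "f (x + y) = f x + f y" for x y using assms by (simp add: scalar_op_def)
  show "f (x + y) = f x + f y" by (rule a)
  show z: "f 0 = 0" using a[of 0 0] by simp
  show n: "f (- x) = - f x" using a[of x "-x"] z by (simp add: eq_neg_iff_add_eq_0 add.commute)
  show "f (x - y) = f x - f y" using a[of "x - y" y] by (simp add: algebra_simps)
  show "f x * y = f (x * y)" "x * f y = f (x * y)" using assms by (simp_all add: scalar_op_def)
qed

text \<open>The cancellation assumptions say that q + q^-1, q^2 + 1 + q^-2 and q - q^-1 can be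
  divided out. The first two are the quantum integers [2] and [3], the multiplicities that appear
  when a q-adjoint action is iterated; the third is the denominator of the commutator of E_i and
  F_i.\<close>

locale laurent_alg =
  fixes qm qi :: "'a::ring \<Rightarrow> 'a"
  assumes qm: "scalar_op qm" and qi: "scalar_op qi"
    and qm_qi [simp]: "qm (qi x) = x" and qi_qm [simp]: "qi (qm x) = x"
    and two_cancel: "qm x + qi x = 0 \<Longrightarrow> x = 0"
    and three_cancel: "qm (qm x) + x + qi (qi x) = 0 \<Longrightarrow> x = 0"
    and diff_cancel: "qm x - qi x = 0 \<Longrightarrow> x = 0"
begin

lemmas q_simps [simp] = scalar_op_simps[OF qm] scalar_op_simps[OF qi]

lemma two_cancel_eq: "qm x + qi x = qm y + qi y \<Longrightarrow> x = y"
  using two_cancel[of "x - y"] by (simp add: algebra_simps)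

lemma three_cancel_eq: "qm (qm x) + x + qi (qi x) = qm (qm y) + y + qi (qi y) \<Longrightarrow> x = y"
  using three_cancel[of "x - y"] by (simp add: algebra_simps)

lemma diff_cancel_eq: "qm x - qi x = qm y - qi y \<Longrightarrow> x = y"
  using diff_cancel[of "x - y"] by (simp add: algebra_simps)

section \<open>The q-commutator and the quantum Serre relation\<close>

definition br :: "'a \<Rightarrow> 'a \<Rightarrow> 'a" where "br u v = u * v - qi (v * u)"

definition serre :: "'a \<Rightarrow> 'a \<Rightarrow> bool" where
  "serre u v \<longleftrightarrow> u * (u * v) + v * (u * u) = qm (u * (v * u)) + qi (u * (v * u))"

lemma serre_iff_left: "serre u v \<longleftrightarrow> u * br u v = qm (br u v * u)"
  unfolding serre_def br_def by (auto simp: algebra_simps)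

lemma serre_iff_right: "serre u v \<longleftrightarrow> br v u * u = qm (u * br v u)"
  unfolding serre_def br_def by (auto simp: algebra_simps)

text \<open>Under the q-adjoint action of \<open>e\<close> the pairs u, u' and v, v' are
  two-dimensional modules. The first application gives u' v + q^-1 u v' on one side, the second [2]
  times u' v', and [2] is cancelled. \<open>C\<close> stands for a scalar; it is used for the
  identity and for q.\<close>

lemma transfer_11:
  assumes u: "e * u = u' + qi (u * e)" "e * u' = qm (u' * e)"
    and v: "e * v = v' + qi (v * e)" "e * v' = qm (v' * e)"
    and C: "scalar_op C" "\<And>x. C (qm x) = qm (C x)" "\<And>x. C (qi x) = qi (C x)"
    and uv: "u * v = C (v * u)"
  shows "u' * v' = C (v' * u')"
proof -
  note [simp] = scalar_op_simps[OF C(1)] C(2,3)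
  have tail: "e * (u * w) = u' * w + qi (u * (e * w))" "e * (u' * w) = qm (u' * (e * w))"
    "e * (v * w) = v' * w + qi (v * (e * w))" "e * (v' * w) = qm (v' * (e * w))" for w
    using arg_cong[OF u(1), of "\<lambda>t. t * w"] arg_cong[OF u(2), of "\<lambda>t. t * w"]
      arg_cong[OF v(1), of "\<lambda>t. t * w"] arg_cong[OF v(2), of "\<lambda>t. t * w"]
    by (simp_all add: algebra_simps)
  have "u' * v + qi (u * v') = e * (u * v) - qi (qi ((u * v) * e))"
    by (simp add: tail u v algebra_simps)
  also have "\<dots> = e * C (v * u) - qi (qi (C (v * u) * e))" by (simp only: uv)
  also have "\<dots> = C (v' * u + qi (v * u'))" by (simp add: tail u v algebra_simps)
  finally have e1: "u' * v + qi (u * v') = C (v' * u + qi (v * u'))" .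
  have "qm (u' * v') + qi (u' * v') = e * (u' * v + qi (u * v')) - (u' * v + qi (u * v')) * e"
    by (simp add: tail u v algebra_simps)
  also have "\<dots> = e * C (v' * u + qi (v * u')) - C (v' * u + qi (v * u')) * e" by (simp only: e1)
  also have "\<dots> = qm (C (v' * u')) + qi (C (v' * u'))" by (simp add: tail u v algebra_simps)
  finally show ?thesis by (rule two_cancel_eq)
qed

text \<open>Here z, z1, z2 form a three-dimensional module. The second application produces [2]
  times the first conclusion, the third [3] times the second one. The intermediate relation is kept
  because \<open>affine_A2\<close> uses it too.\<close>

lemma transfer_12:
  assumes u: "e * u = u' + qi (u * e)" "e * u' = qm (u' * e)"
    and z: "e * z = z1 + qi (qi (z * e))" "e * z1 = qm z2 + qi z2 + z1 * e"
      "e * z2 = qm (qm (z2 * e))"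
    and C: "scalar_op C" "\<And>x. C (qm x) = qm (C x)" "\<And>x. C (qi x) = qi (C x)"
    and uz: "u * z = C (z * u)"
  shows "u' * z1 + qi (qi (u * z2)) = C (z2 * u + qi (z1 * u'))"
    and "u' * z2 = C (z2 * u')"
proof -
  note [simp] = scalar_op_simps[OF C(1)] C(2,3)
  have tail: "e * (u * w) = u' * w + qi (u * (e * w))" "e * (u' * w) = qm (u' * (e * w))"
    "e * (z * w) = z1 * w + qi (qi (z * (e * w)))"
    "e * (z1 * w) = qm (z2 * w) + qi (z2 * w) + z1 * (e * w)"
    "e * (z2 * w) = qm (qm (z2 * (e * w)))" for w
    using arg_cong[OF u(1), of "\<lambda>t. t * w"] arg_cong[OF u(2), of "\<lambda>t. t * w"]
      arg_cong[OF z(1), of "\<lambda>t. t * w"] arg_cong[OF z(2), of "\<lambda>t. t * w"]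
      arg_cong[OF z(3), of "\<lambda>t. t * w"]
    by (simp_all add: algebra_simps)
  let ?l1 = "u' * z + qi (u * z1)" and ?r1 = "C (z1 * u + qi (qi (z * u')))"
  let ?l2 = "u' * z1 + qi (qi (u * z2))" and ?r2 = "C (z2 * u + qi (z1 * u'))"
  have "?l1 = e * (u * z) - qi (qi (qi ((u * z) * e)))" by (simp add: tail u z algebra_simps)
  also have "\<dots> = e * C (z * u) - qi (qi (qi (C (z * u) * e)))" by (simp only: uz)
  also have "\<dots> = ?r1" by (simp add: tail u z algebra_simps)
  finally have e1: "?l1 = ?r1" .
  have "qm ?l2 + qi ?l2 = e * ?l1 - qi (?l1 * e)" by (simp add: tail u z algebra_simps)
  also have "\<dots> = e * ?r1 - qi (?r1 * e)" by (simp only: e1)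
  also have "\<dots> = qm ?r2 + qi ?r2" by (simp add: tail u z algebra_simps)
  finally show e2: "?l2 = ?r2" by (rule two_cancel_eq)
  have "qm (qm (u' * z2)) + u' * z2 + qi (qi (u' * z2)) = e * ?l2 - qm (?l2 * e)"
    by (simp add: tail u z algebra_simps)
  also have "\<dots> = e * ?r2 - qm (?r2 * e)" by (simp only: e2)
  also have "\<dots> = qm (qm (C (z2 * u'))) + C (z2 * u') + qi (qi (C (z2 * u')))"
    by (simp add: tail u z algebra_simps)
  finally show "u' * z2 = C (z2 * u')" by (rule three_cancel_eq)
qed

text \<open>Exchanging q and q^-1 exchanges left and right q-adjoint actions, so the right-handed
  transfer lemmas need no separate calculation.\<close>

lemma dual: "laurent_alg qi qm"
proof
  show "x = 0" if "qi x + qm x = 0" for x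
    using two_cancel[of x] that by (metis add.commute)
  show "x = 0" if "qi (qi x) + x + qm (qm x) = 0" for x
    using three_cancel[of x] that by (metis add.commute add.assoc)
  show "x = 0" if "qi x - qm x = 0" for x
    using diff_cancel[of x] that by (metis eq_iff_diff_eq_0)
qed (simp_all add: qm qi)

lemma transfer_11_right:
  assumes u: "u * e = u' + qi (e * u)" "u' * e = qm (e * u')"
    and v: "v * e = v' + qi (e * v)" "v' * e = qm (e * v')"
    and C: "scalar_op C" "\<And>x. C (qm x) = qm (C x)" "\<And>x. C (qi x) = qi (C x)"
    and uv: "u * v = C (v * u)"
  shows "u' * v' = C (v' * u')"
proof -
  note [simp] = scalar_op_simps[OF C(1)] C(2,3)
  \<comment> \<open>Solving u e = u' + q^-1 e u for e u gives e u = - q u' + q u e, so - q u' is the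
    highest weight vector for the dual left action.\<close>
  have "(- qm u') * (- qm v') = C ((- qm v') * (- qm u'))"
    by (rule laurent_alg.transfer_11[OF dual, of e u _ v]) (use assms in auto)
  then have "qi (qi (qm (qm (u' * v')))) = qi (qi (qm (qm (C (v' * u')))))" by simp
  then show ?thesis by simp
qed

lemma transfer_12_right:
  assumes u: "u * e = u' + qi (e * u)" "u' * e = qm (e * u')"
    and z: "z * e = z1 + qi (qi (e * z))" "z1 * e = qm z2 + qi z2 + e * z1"
      "z2 * e = qm (qm (e * z2))"
    and C: "scalar_op C" "\<And>x. C (qm x) = qm (C x)" "\<And>x. C (qi x) = qi (C x)"
    and uz: "u * z = C (z * u)"
  shows "u' * z2 = C (z2 * u')"
proof -
  note [simp] = scalar_op_simps[OF C(1)] C(2,3)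
  have "(- qm u') * qm (qm z2) = C (qm (qm z2) * (- qm u'))"
    by (rule laurent_alg.transfer_12(2)[OF dual, of e u _ z "- qm (qm z1)"])
      (use assms in \<open>auto simp: algebra_simps\<close>)
  then have "qi (qi (qi (qm (qm (qm (u' * z2)))))) = qi (qi (qi (qm (qm (qm (C (z2 * u')))))))"
    by simp
  then show ?thesis by simp
qed

lemma qm_scalar: "scalar_op qm" "qm (qm x) = qm (qm x)" "qm (qi x) = qi (qm x)"
  using qm by auto

lemma id_scalar: "scalar_op (\<lambda>x. x)" "(\<lambda>x. x) (qm x) = qm ((\<lambda>x. x) x)" "(\<lambda>x. x) (qi x) = qi ((\<lambda>x. x) x)"
  by (auto simp: scalar_op_def)

lemma mult_tail: "x * y = r \<Longrightarrow> x * (y * w) = r * w" for x y r w :: 'a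
  by (simp add: mult.assoc[symmetric])

lemma br_exchange: "u * v = br u v + qi (v * u)"
  by (simp add: br_def)

section \<open>Brackets that preserve the Serre relation\<close>

lemma serre_br_left:
  assumes "serre d u" "d * w = w * d" shows "serre d (br u w)"
proof -
  have 1: "br u d * d = qm (d * br u d)" using assms(1) serre_iff_right by simp
  have "br (br u w) d = br (br u d) w"
    unfolding br_def by (simp add: algebra_simps assms(2) mult_tail[OF assms(2)])
  moreover have "br (br u d) w * d = qm (d * br (br u d) w)"
    unfolding br_def[of _ w]
    by (simp add: algebra_simps 1 mult_tail[OF 1] assms(2)[symmetric] mult_tail[OF assms(2)[symmetric]])
  ultimately show ?thesis unfolding serre_iff_right by simp
qed

lemma serre_br_right:
  assumes "serre d u" "d * w = w * d" shows "serre d (br w u)"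
proof -
  have 1: "d * br d u = qm (br d u * d)" using assms(1) serre_iff_left by simp
  have "br d (br w u) = br w (br d u)"
    unfolding br_def by (simp add: algebra_simps assms(2) mult_tail[OF assms(2)])
  moreover have "d * br w (br d u) = qm (br w (br d u) * d)"
    unfolding br_def[of w]
    by (simp add: algebra_simps 1 mult_tail[OF 1] assms(2) mult_tail[OF assms(2)])
  ultimately show ?thesis unfolding serre_iff_left by simp
qed

text \<open>The relation \<open>serre u d\<close> says that [d, u] and u q-commute. As d commutes
  with e, both are lowest weight vectors for the action of e, with highest weight vectors [d,
  [e, u]] and [e, u]; the transfer lemma with the scalar q applies.\<close>

lemma serre_transfer_left:
  assumes "serre e u" "serre u d" and de: "d * e = e * d" shows "serre (br e u) d"
proof -
  let ?g = "br e u"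
  have eu: "e * u = ?g + qi (u * e)" "e * ?g = qm (?g * e)"
    by (rule br_exchange, rule serre_iff_left[THEN iffD1, OF assms(1)])
  note t = eu[THEN mult_tail]
  have "br d ?g * ?g = qm (?g * br d ?g)"
  proof (rule transfer_11[of e "br d u" _ u _ qm])
    show "e * br d u = br d ?g + qi (br d u * e)"
      unfolding br_def[of d] by (simp add: algebra_simps de[symmetric] eu t mult_tail[OF de[symmetric]])
    show "e * br d ?g = qm (br d ?g * e)"
      unfolding br_def[of d] by (simp add: algebra_simps de[symmetric] eu t mult_tail[OF de[symmetric]])
  qed (rule eu qm_scalar serre_iff_right[THEN iffD1, OF assms(2)])+
  then show ?thesis unfolding serre_iff_right .
qed

lemma serre_transfer_right:
  assumes "serre e u" "serre u d" and de: "d * e = e * d" shows "serre (br u e) d"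
proof -
  let ?g = "br u e"
  have eu: "u * e = ?g + qi (e * u)" "?g * e = qm (e * ?g)"
    by (rule br_exchange, rule serre_iff_right[THEN iffD1, OF assms(1)])
  note t = eu[THEN mult_tail] mult_tail[OF de]
  have "br d ?g * ?g = qm (?g * br d ?g)"
  proof (rule transfer_11_right[of "br d u" e _ u _ qm])
    show "br d u * e = br d ?g + qi (e * br d u)"
      unfolding br_def[of d] by (simp add: algebra_simps de eu t)
    show "br d ?g * e = qm (e * br d ?g)"
      unfolding br_def[of d] by (simp add: algebra_simps de eu t)
  qed (rule eu qm_scalar serre_iff_right[THEN iffD1, OF assms(2)])+
  then show ?thesis unfolding serre_iff_right .
qed

lemma br_assoc:
  assumes "a * c = c * a" shows "br (br a b) c = br a (br b c)"
  unfolding br_def by (simp add: algebra_simps assms mult_tail[OF assms])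

lemma br_swap:
  assumes "a * b = b * a" shows "br a (br b c) = br b (br a c)"
  unfolding br_def by (simp add: algebra_simps assms mult_tail[OF assms])

lemma commute_br:
  assumes "d * u = u * d" "d * v = v * d" shows "d * br u v = br u v * d"
  unfolding br_def by (simp add: algebra_simps assms assms[THEN mult_tail])

text \<open>The elements a, b, c satisfy the relations of an affine triangle. Three
  three-dimensional modules give the result: v, v1, y1 under the left action of a; w, w1, W2 under
  the right action of b; c, c1, y2 under the left action of x2. Each time the relation to be
  transferred is a Serre relation.\<close>

lemma affine_A2:
  assumes s: "serre a b" "serre b a" "serre a c" "serre c a" "serre b c" "serre c b"
    and x2: "x2 = br a b" and w: "w = br a c" and y1: "y1 = br x2 w" and y2: "y2 = br y1 b"
  shows "a * y1 = qm (qm (y1 * a))" "x2 * y1 = qm (y1 * x2)" "y2 * b = qm (b * y2)"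
    "y1 * y2 = qm (y2 * y1)"
    and "\<And>d. d * a = a * d \<Longrightarrow> d * br b c = br b c * d \<Longrightarrow> d * y1 = y1 * d"
proof -
  have ab: "a * b = x2 + qi (b * a)" and ax: "a * x2 = qm (x2 * a)"
    and ac: "a * c = w + qi (c * a)" and aw: "a * w = qm (w * a)"
    and xw: "x2 * w = y1 + qi (w * x2)"
    unfolding y1 x2 w using s[THEN serre_iff_left[THEN iffD1]] by (blast intro: br_exchange)+
  note at = ab ax ac aw ab[THEN mult_tail] ax[THEN mult_tail] ac[THEN mult_tail] aw[THEN mult_tail]
  show ay1: "a * y1 = qm (qm (y1 * a))" unfolding y1 br_def by (simp add: algebra_simps at)
  define v where "v = br b c"
  \<comment> \<open>The middle vector a v - q^-2 v a, expanded by the exchange rules so that it can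
    be compared with \<open>c1\<close> below.\<close>
  define v1 where "v1 = x2 * c + qi (b * w) - qi (w * b) - qi (qi (c * x2))"
  have bv: "b * v = qm (v * b)" unfolding v_def using s(5) serre_iff_left by blast
  have av: "a * v = v1 + qi (qi (v * a))"
    unfolding v_def v1_def br_def by (simp add: algebra_simps at)
  have av1: "a * v1 = qm y1 + qi y1 + v1 * a"
    unfolding v1_def y1 br_def by (simp add: algebra_simps at)
  have xv1: "x2 * v1 + qi (qi (b * y1)) = qm (y1 * b + qi (v1 * x2))"
    by (rule transfer_12(1)[OF ab ax av av1 ay1 qm_scalar bv])
  show xy1: "x2 * y1 = qm (y1 * x2)"
    by (rule transfer_12(2)[OF ab ax av av1 ay1 qm_scalar bv])
  define c2 where "c2 = br c b"
  have xb: "x2 * b = qm (b * x2)" and cb: "c * b = c2 + qi (b * c)" and c2b: "c2 * b = qm (b * c2)"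
    and ab': "a * b = x2 + qi (b * a)"
    unfolding x2 c2_def using s[THEN serre_iff_right[THEN iffD1]] by (blast intro: br_exchange)+
  note bt = xb cb c2b ab' xb[THEN mult_tail] cb[THEN mult_tail] c2b[THEN mult_tail] ab'[THEN mult_tail]
  define w1 where "w1 = w * b - qi (qi (b * w))"
  define W2 where "W2 = br x2 c2"
  have wb: "w * b = w1 + qi (qi (b * w))" by (simp add: w1_def)
  have w1b: "w1 * b = qm W2 + qi W2 + b * w1"
    unfolding w1_def W2_def w br_def by (simp add: algebra_simps bt)
  have W2b: "W2 * b = qm (qm (b * W2))"
    unfolding W2_def br_def by (simp add: algebra_simps bt)
  have xW: "x2 * W2 = qm (W2 * x2)"
    by (rule transfer_12_right[OF ab' xb wb w1b W2b qm_scalar aw])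
  note coord_weight = wb w1b wb[THEN mult_tail] w1b[THEN mult_tail] xW
  have y2': "y2 = x2 * w1 - w1 * x2"
    unfolding y2 y1 br_def by (simp add: algebra_simps xb xb[THEN mult_tail] coord_weight)
  show "y2 * b = qm (b * y2)"
    unfolding y2' by (simp add: algebra_simps xb xb[THEN mult_tail] coord_weight)
  define c1 where "c1 = x2 * c - qi (qi (c * x2))"
  have xc: "x2 * c = c1 + qi (qi (c * x2))" by (simp add: c1_def)
  \<comment> \<open>The middle vectors for a acting on v and for x2 acting on c differ only by a
    commutator of w and b. This lets the intermediate relation \<open>xv1\<close> determine the
    action of x2 on \<open>c1\<close>.\<close>
  have c1': "c1 = v1 + qi (w * b) - qi (b * w)" unfolding c1_def v1_def by simp
  have xv1': "x2 * v1 = qm (y1 * b) + v1 * x2 - qi (qi (b * y1))"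
    using xv1 by (simp add: algebra_simps)
  have xc1: "x2 * c1 = qm y2 + qi y2 + c1 * x2"
    unfolding c1' y2 br_def[of y1]
    by (simp add: algebra_simps xv1' xb xb[THEN mult_tail] xw xw[THEN mult_tail])
  have xy2: "x2 * y2 = qm (qm (y2 * x2))"
    unfolding y2 br_def[of y1]
    by (simp add: algebra_simps xb xb[THEN mult_tail] xy1 xy1[THEN mult_tail])
  have wc: "w * c = qm (c * w)" unfolding w using s(4) serre_iff_right by blast
  show "y1 * y2 = qm (y2 * y1)"
    by (rule transfer_12(2)[OF xw xy1 xc xc1 xy2 qm_scalar wc])
  fix d assume da: "d * a = a * d" and dv: "d * br b c = br b c * d"
  have dv1: "d * v1 = v1 * d"
  proof -
    have "v1 = a * v - qi (qi (v * a))" using av by simp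
    then show ?thesis
      by (simp only:) (simp add: algebra_simps da dv[folded v_def] mult_tail[OF da]
        mult_tail[OF dv[folded v_def]])
  qed
  \<comment> \<open>Anything that commutes with a and v1 commutes with [2] y1, and [2] can be
    cancelled.\<close>
  have e: "qm y1 + qi y1 = a * v1 - v1 * a" using av1 by simp
  have "d * (qm y1 + qi y1) = (qm y1 + qi y1) * d"
    unfolding e by (simp add: algebra_simps da dv1 mult_tail[OF da] mult_tail[OF dv1])
  then have "qm (d * y1) + qi (d * y1) = qm (y1 * d) + qi (y1 * d)" by (simp add: algebra_simps)
  then show "d * y1 = y1 * d" by (rule two_cancel_eq)
qed

section \<open>Opposite root vectors\<close>

lemma br_EF_commutators:
  fixes x f f' E F K K' L L' :: 'a
  assumes xf: "qm (x * f - f * x) - qi (x * f - f * x) = K - K'"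
    and EF: "qm (E * F - F * E) - qi (E * F - F * E) = L - L'"
    and xF: "x * F = F * x" and Ef: "E * f = f * E"
    and KE: "K * E = qi (E * K)" "K' * E = qm (E * K')"
    and Lx: "L * x = qi (x * L)" "L' * x = qm (x * L')"
  shows "br x E * F - F * br x E = qi (x * L)" "br x E * f - f * br x E = - (E * K')"
proof -
  let ?D = "x * f - f * x" and ?G = "E * F - F * E"
  have "br x E * F - F * br x E = x * ?G - qi (?G * x)"
    unfolding br_def by (simp add: algebra_simps xF xF[THEN mult_tail])
  also have "qm \<dots> - qi \<dots> = x * (qm ?G - qi ?G) - qi ((qm ?G - qi ?G) * x)"
    by (simp add: algebra_simps)
  also have "\<dots> = qm (qi (x * L)) - qi (qi (x * L))"
    unfolding EF by (simp add: algebra_simps Lx)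
  finally show "br x E * F - F * br x E = qi (x * L)" by (rule diff_cancel_eq)
  have "br x E * f - f * br x E = ?D * E - qi (E * ?D)"
    unfolding br_def by (simp add: algebra_simps Ef Ef[THEN mult_tail])
  also have "qm \<dots> - qi \<dots> = (qm ?D - qi ?D) * E - qi (E * (qm ?D - qi ?D))"
    by (simp add: algebra_simps)
  also have "\<dots> = qm (- (E * K')) - qi (- (E * K'))"
    unfolding xf by (simp add: algebra_simps KE)
  finally show "br x E * f - f * br x E = - (E * K')" by (rule diff_cancel_eq)
qed

text \<open>The pair x, f behaves like E and F with group-like element K and inverse K'. Bracketing
  with an adjacent Chevalley pair gives such a pair again, now with group-like element K L; this is
  the induction step along a root of type A.\<close>

lemma br_EF_step:
  fixes x f f' E F K K' L L' :: 'a
  assumes A: "qm (x * f - f * x) - qi (x * f - f * x) = K - K'"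
     "qm (E * F - F * E) - qi (E * F - F * E) = L - L'"
     "x * F = F * x" "E * f = f * E"
     "K * E = qi (E * K)" "K' * E = qm (E * K')"
     "L * x = qi (x * L)" "L' * x = qm (x * L')"
    and Lf: "L * f = qm (f * L)" and KF: "K' * F = qi (F * K')" and LK: "L * K' = K' * L" "L' * K' = K' * L'"
    and f': "f' = F * f - qm (f * F)"
  shows "qm (br x E * f' - f' * br x E) - qi (br x E * f' - f' * br x E) = K * L - K' * L'"
proof -
  let ?X = "br x E" and ?D = "x * f - f * x" and ?G = "E * F - F * E"
  note c = br_EF_commutators[OF A]
  have c1: "?X * F = F * ?X + qi (x * L)" using c(1) by (simp add: algebra_simps)
  have c2: "?X * f = f * ?X - E * K'" using c(2) by (simp add: algebra_simps)
  have "?X * f' - f' * ?X = ?D * L + ?G * K'"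
    unfolding f' by (simp add: algebra_simps c1 c1[THEN mult_tail] c2 c2[THEN mult_tail] Lf KF)
  also have "qm \<dots> - qi \<dots> = (qm ?D - qi ?D) * L + (qm ?G - qi ?G) * K'"
    by (simp add: algebra_simps)
  also have "\<dots> = (K - K') * L + (L - L') * K'" by (simp only: A)
  also have "\<dots> = K * L - K' * L'" by (simp add: algebra_simps LK)
  finally show ?thesis .
qed

text \<open>Later x is x_j, E is E_(j+1), and - f K is T_1 ... T_j E_j. The group-like K passes the
  inner bracket with a factor q that cancels the q^-1 of the outer one, so that only the commutator
  term E K' K is left.\<close>

lemma br_EF_final:
  fixes x f f' E F K K' L L' :: 'a
  assumes A: "qm (x * f - f * x) - qi (x * f - f * x) = K - K'"
     "qm (E * F - F * E) - qi (E * F - F * E) = L - L'"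
     "x * F = F * x" "E * f = f * E"
     "K * E = qi (E * K)" "K' * E = qm (E * K')"
     "L * x = qi (x * L)" "L' * x = qm (x * L')"
    and Kx: "K * x = qm (qm (x * K))" and KK: "E * (K' * K) = E"
  shows "br (br x E) (- (f * K)) = E"
proof -
  let ?X = "br x E"
  have c2: "?X * f = f * ?X - E * K'" using br_EF_commutators(2)[OF A] by (simp add: algebra_simps)
  have KX: "K * ?X = qm (?X * K)"
    unfolding br_def by (simp add: algebra_simps A(5) A(5)[THEN mult_tail] Kx Kx[THEN mult_tail])
  show ?thesis unfolding br_def[of ?X]
    by (simp add: algebra_simps KX KX[THEN mult_tail] c2 c2[THEN mult_tail] KK)
qed

text \<open>The hypotheses are those satisfied by \<open>A = E \<otimes> 1\<close> and \<open>B = K \<otimes> E\<close>,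
  the two summands of a coproduct.\<close>
lemma serre_coproduct:
  assumes "serre A A'" "serre B B'"
    and BA: "B * A = qm (qm (A * B))" "B * A' = qi (A' * B)" "B' * A = qi (A * B')"
  shows "serre (A + B) (A' + B')"
  using assms(1,2) unfolding serre_def
  by (simp add: algebra_simps BA BA[THEN mult_tail])

end

section \<open>Chains of nested q-commutators\<close>

text \<open>The elements e_2, ..., e_n are Chevalley generators of a chain, and z_1 is attached to
  e_2 alone. The instances are the x_j, the y_j, and the brackets along the nodes 2, ..., m + 1. The
  assumption \<open>z2_near\<close> is the Serre relation of e_2 with z_1 in the form in which
  \<open>affine_A2\<close> delivers it for y_1.\<close>

locale bracket_chain = laurent_alg qm qi for qm qi :: "'a::ring \<Rightarrow> 'a" +
  fixes n :: nat and e z :: "nat \<Rightarrow> 'a"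
  assumes z_Suc: "1 \<le> j \<Longrightarrow> j < n \<Longrightarrow> z (Suc j) = br (z j) (e (Suc j))"
    and e_far: "2 \<le> i \<Longrightarrow> Suc i < k \<Longrightarrow> k \<le> n \<Longrightarrow> e i * e k = e k * e i"
    and e_near: "2 \<le> i \<Longrightarrow> i < n \<Longrightarrow> serre (e i) (e (Suc i)) \<and> serre (e (Suc i)) (e i)"
    and z1_far: "3 \<le> k \<Longrightarrow> k \<le> n \<Longrightarrow> z 1 * e k = e k * z 1"
    and z2_near: "2 \<le> n \<Longrightarrow> z 2 * e 2 = qm (e 2 * z 2)"
begin

lemma z_far: "1 \<le> j \<Longrightarrow> Suc j < k \<Longrightarrow> k \<le> n \<Longrightarrow> z j * e k = e k * z j"
proof (induction j rule: nat_induct_at_least[of 1])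
  case base
  then show ?case using z1_far by simp
next
  case (Suc j)
  have "e k * br (z j) (e (Suc j)) = br (z j) (e (Suc j)) * e k"
    by (rule commute_br) (use Suc e_far[of "Suc j" k] in auto)
  then show ?case using z_Suc[of j] Suc by simp
qed

lemma z_near:
  assumes "2 \<le> j" "j \<le> n" shows "z j * e j = qm (e j * z j)"
proof (cases "j = 2")
  case True
  then show ?thesis using z2_near assms by simp
next
  case False
  then obtain i where j: "j = Suc (Suc i)" and i: "1 \<le> i" using assms
    by (metis One_nat_def Suc_1 Suc_le_D Suc_leI Suc_le_mono le_neq_implies_less)
  have c: "e j * z i = z i * e j" using z_far[of i j] i assms j by simp
  have z: "z (Suc i) = br (z i) (e (Suc i))" "z j = br (z (Suc i)) (e j)"
    using z_Suc[of i] z_Suc[of "Suc i"] i j assms by auto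
  have "serre (e j) (e (Suc i))" using e_near[of "Suc i"] i j assms by simp
  then have "serre (e j) (z (Suc i))" unfolding z(1) using c by (rule serre_br_right)
  then show ?thesis unfolding serre_iff_right z(2) .
qed

text \<open>If j > k + 1, then e_k commutes with both entries of the last bracket. If j = k + 1,
  then z_(k-1) and e_(k+1) commute; transferring this along the right action of e_k shows that z_k
  commutes with [e_(k+1), e_k], and with it the terms of z_(k+1) e_k recombine.\<close>

lemma z_inner: "2 \<le> k \<Longrightarrow> k < j \<Longrightarrow> j \<le> n \<Longrightarrow> e k * z j = z j * e k"
proof (induction j rule: less_induct)
  case (less j)
  show ?case
  proof (cases "j = Suc k")
    case False
    then obtain i where j: "j = Suc i" "k < i" using less.prems by (cases j) auto
    have "e k * br (z i) (e j) = br (z i) (e j) * e k"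
      by (rule commute_br) (use less.IH[of i] less.prems j e_far[of k j] False in auto)
    then show ?thesis using z_Suc[of i] less.prems j by simp
  next
    case True
    obtain i where k: "k = Suc i" and i: "1 \<le> i" using less.prems by (cases k) auto
    let ?a = "z i" and ?b = "e k" and ?c = "e j"
    define c' where "c' = br ?c ?b"
    have zk: "z k = br ?a ?b" and zj: "z j = br (z k) ?c"
      using z_Suc[of i] z_Suc[of k] i k True less.prems by auto
    have ac: "?a * ?c = ?c * ?a" using z_far[of i j] i k True less.prems by simp
    have ab: "?a * ?b = z k + qi (?b * ?a)" unfolding zk by (rule br_exchange)
    have zkb: "z k * ?b = qm (?b * z k)" using z_near[of k] k less.prems by simp
    have cb: "?c * ?b = c' + qi (?b * ?c)" unfolding c'_def by (rule br_exchange)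
    have c'b: "c' * ?b = qm (?b * c')" unfolding c'_def
      using e_near[of k] True less.prems serre_iff_right by auto
    have "z k * c' = c' * z k"
      by (rule transfer_11_right[OF ab zkb cb c'b id_scalar ac])
    then have "z j * ?b = ?b * z j"
      unfolding zj br_def[of "z k"]
      by (simp add: algebra_simps zkb zkb[THEN mult_tail] cb cb[THEN mult_tail])
    then show ?thesis by simp
  qed
qed

text \<open>Bracketing one side with a generator that commutes with the other side keeps a
  q-commutation, so all pairs descend from z_1 and z_2.\<close>

lemma z_quad:
  assumes "2 \<le> n \<Longrightarrow> z 1 * z 2 = qm (z 2 * z 1)"
  shows "1 \<le> i \<Longrightarrow> i < j \<Longrightarrow> j \<le> n \<Longrightarrow> z i * z j = qm (z j * z i)"
proof (induction i rule: nat_induct_at_least[of 1])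
  case base
  then have "2 \<le> j" by simp
  then show ?case using base
  proof (induction j rule: nat_induct_at_least[of 2])
    case base
    then show ?case using assms by simp
  next
    case (Suc j)
    then have zj: "z (Suc j) = br (z j) (e (Suc j))" and c: "z 1 * e (Suc j) = e (Suc j) * z 1"
      using z_Suc[of j] z1_far[of "Suc j"] by auto
    have IH: "z 1 * z j = qm (z j * z 1)" using Suc by auto
    show ?case unfolding zj br_def
      by (simp add: algebra_simps IH IH[THEN mult_tail] c c[THEN mult_tail]
        del: One_nat_def)
  qed
next
  case (Suc i)
  then have zi: "z (Suc i) = br (z i) (e (Suc i))" and c: "e (Suc i) * z j = z j * e (Suc i)"
    using z_Suc[of i] z_inner[of "Suc i" j] by auto
  have IH: "z i * z j = qm (z j * z i)" using Suc by auto
  show ?case unfolding zi br_def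
    by (simp add: algebra_simps IH IH[THEN mult_tail] c c[THEN mult_tail])
qed

end

text \<open>The relations obtained here are those of quantum matrices before the twist: every
  product y_l x_j carries one more factor q than in the target algebra.\<close>

locale bracket_chain_pair =
  x: bracket_chain qm qi n e x + y: bracket_chain qm qi n e y
  for qm qi :: "'a::ring \<Rightarrow> 'a" and n e x y +
  assumes xy1: "x 1 * y 1 = qm (qm (y 1 * x 1))"
    and x2y1: "2 \<le> n \<Longrightarrow> x 2 * y 1 = qm (y 1 * x 2)"
begin

lemma lower: "1 \<le> j \<Longrightarrow> j < l \<Longrightarrow> l \<le> n \<Longrightarrow> x l * y j = qm (y j * x l)"
proof (induction j rule: nat_induct_at_least[of 1])
  case base
  then have "2 \<le> l" by simp
  then show ?case using base
  proof (induction l rule: nat_induct_at_least[of 2])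
    case base
    then show ?case using x2y1 by simp
  next
    case (Suc j)
    then have xj: "x (Suc j) = x.br (x j) (e (Suc j))" and c: "e (Suc j) * y 1 = y 1 * e (Suc j)"
      using x.z_Suc[of j] y.z1_far[of "Suc j"] by auto
    have IH: "x j * y 1 = qm (y 1 * x j)" using Suc by auto
    show ?case unfolding xj x.br_def
      by (simp add: algebra_simps IH IH[THEN x.mult_tail] c c[THEN x.mult_tail]
        del: One_nat_def)
  qed
next
  case (Suc j)
  then have yj: "y (Suc j) = x.br (y j) (e (Suc j))" and c: "x l * e (Suc j) = e (Suc j) * x l"
    using y.z_Suc[of j] x.z_inner[of "Suc j" l] by auto
  have IH: "x l * y j = qm (y j * x l)" using Suc by auto
  show ?case unfolding yj x.br_def
    by (simp add: algebra_simps IH IH[THEN x.mult_tail] c c[THEN x.mult_tail])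
qed

lemma diag:
  assumes "1 \<le> j" "j \<le> n" shows "x j * y j = qm (qm (y j * x j))"
proof (cases "j = 1")
  case True
  then show ?thesis using xy1 by simp
next
  case False
  then obtain i where j: "j = Suc i" "1 \<le> i" using assms by (cases j) auto
  have yj: "y j = x.br (y i) (e j)" using y.z_Suc[of i] j assms by simp
  have c: "x j * e j = qm (e j * x j)" using x.z_near[of j] j assms by simp
  have l: "x j * y i = qm (y i * x j)" using lower[of i j] j assms by simp
  show ?thesis unfolding yj x.br_def
    by (simp add: algebra_simps l l[THEN x.mult_tail] c c[THEN x.mult_tail])
qed

text \<open>The term with q - q^-1 arises at l = j + 1, where the new generator does not commute
  with x_j. For larger l the new generator commutes with x_j and y_j, and the relation for l is
  simply bracketed with it.\<close>

lemma upper: "Suc j \<le> l \<Longrightarrow> 1 \<le> j \<Longrightarrow> l \<le> n \<Longrightarrow>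
  x j * y l - qm (y l * x j) = qm (x l * y j) - qi (x l * y j)"
proof (induction l rule: nat_induct_at_least[of "Suc j"])
  case base
  let ?e = "e (Suc j)"
  have xS: "x (Suc j) = x.br (x j) ?e" and yS: "y (Suc j) = x.br (y j) ?e"
    using x.z_Suc[of j] y.z_Suc[of j] base by auto
  have d: "x j * y j = qm (qm (y j * x j))" using diag[of j] base by simp
  have xe: "x j * ?e = x (Suc j) + qi (?e * x j)" unfolding xS by (rule x.br_exchange)
  have l: "x (Suc j) * y j = qm (y j * x (Suc j))" using lower[of j "Suc j"] base by simp
  show ?case unfolding yS x.br_def
    by (simp add: algebra_simps l l[THEN x.mult_tail] xe xe[THEN x.mult_tail] d d[THEN x.mult_tail])
next
  case (Suc l)
  let ?e = "e (Suc l)"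
  have xS: "x (Suc l) = x.br (x l) ?e" and yS: "y (Suc l) = x.br (y l) ?e"
    using x.z_Suc[of l] y.z_Suc[of l] Suc by auto
  have cx: "x j * ?e = ?e * x j" and cy: "y j * ?e = ?e * y j"
    using x.z_far[of j "Suc l"] y.z_far[of j "Suc l"] Suc by auto
  have IH: "x j * y l = qm (y l * x j) + qm (x l * y j) - qi (x l * y j)"
    using Suc by (simp add: algebra_simps)
  show ?case unfolding yS xS x.br_def
    by (simp add: algebra_simps IH IH[THEN x.mult_tail] cx cx[THEN x.mult_tail] cy cy[THEN x.mult_tail])
qed

end

text \<open>The affine Dynkin cycle with node 0 renamed m + 1, so that it becomes a linear chain
  closed by one wrap-around edge. For m = 2 it is a triangle and \<open>far\<close> covers no
  pair.\<close>

locale affine_cycle = laurent_alg qm qi for qm qi :: "'a::ring \<Rightarrow> 'a" +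
  fixes m :: nat and \<epsilon> :: "nat \<Rightarrow> 'a"
  assumes m2: "2 \<le> m"
    and far: "1 \<le> i \<Longrightarrow> Suc i < j \<Longrightarrow> j \<le> Suc m \<Longrightarrow> \<not> (i = 1 \<and> j = Suc m) \<Longrightarrow> \<epsilon> i * \<epsilon> j = \<epsilon> j * \<epsilon> i"
    and near: "1 \<le> i \<Longrightarrow> i \<le> m \<Longrightarrow> serre (\<epsilon> i) (\<epsilon> (Suc i)) \<and> serre (\<epsilon> (Suc i)) (\<epsilon> i)"
    and wrap: "serre (\<epsilon> 1) (\<epsilon> (Suc m)) \<and> serre (\<epsilon> (Suc m)) (\<epsilon> 1)"
begin

section \<open>Nested brackets along an arc of the cycle\<close>

fun nest :: "nat \<Rightarrow> nat \<Rightarrow> 'a" where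
  "nest i 0 = \<epsilon> i"
| "nest i (Suc k) = br (nest i k) (\<epsilon> (Suc (i + k)))"

lemma nest_commute: "(\<And>l. i \<le> l \<Longrightarrow> l \<le> i + k \<Longrightarrow> d * \<epsilon> l = \<epsilon> l * d) \<Longrightarrow> d * nest i k = nest i k * d"
  by (induction k) (auto intro!: commute_br)

lemma serre_nest_first:
  "serre d (\<epsilon> i) \<Longrightarrow> (\<And>l. i < l \<Longrightarrow> l \<le> i + k \<Longrightarrow> d * \<epsilon> l = \<epsilon> l * d) \<Longrightarrow> serre d (nest i k)"
  by (induction k) (auto intro!: serre_br_left)

lemma serre_nest_last:
  assumes "serre d (\<epsilon> (i + k))" "\<And>l. i \<le> l \<Longrightarrow> l < i + k \<Longrightarrow> d * \<epsilon> l = \<epsilon> l * d"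
  shows "serre d (nest i k)"
  using assms by (cases k) (auto intro!: serre_br_right nest_commute)

lemma far': "1 \<le> i \<Longrightarrow> Suc i < j \<Longrightarrow> j \<le> Suc m \<Longrightarrow> \<not> (i = 1 \<and> j = Suc m) \<Longrightarrow> \<epsilon> j * \<epsilon> i = \<epsilon> i * \<epsilon> j"
  using far by metis

text \<open>The disjunction, here and in the lemmas that follow, keeps the arc from closing up: a
  node m + 1 joined to an arc starting at 1 would be adjacent to both ends.\<close>

lemma serre_next_nest:
  assumes "1 \<le> i" "i + k \<le> m" "2 \<le> i \<or> i + k < m"
  shows "serre (\<epsilon> (Suc (i + k))) (nest i k)"
  using assms by (intro serre_nest_last) (auto intro: far' simp: near)

lemma serre_nest_left:
  "1 \<le> i \<Longrightarrow> i + k \<le> Suc m \<Longrightarrow> 2 \<le> i \<or> i + k \<le> m \<Longrightarrow> serre (\<epsilon> (i + k)) d \<Longrightarrow>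
   (\<And>l. i \<le> l \<Longrightarrow> l < i + k \<Longrightarrow> d * \<epsilon> l = \<epsilon> l * d) \<Longrightarrow> serre (nest i k) d"
proof (induction k arbitrary: d)
  case (Suc k)
  have "serre (nest i k) (\<epsilon> (Suc (i + k)))"
    by (rule Suc.IH) (use Suc.prems in \<open>auto intro: far' simp: near\<close>)
  then have "serre (br (nest i k) (\<epsilon> (Suc (i + k)))) d"
    by (rule serre_transfer_left) (use Suc.prems in \<open>auto intro: nest_commute\<close>)
  then show ?case by simp
qed auto

lemma serre_nest_right:
  "1 \<le> i \<Longrightarrow> i + k \<le> Suc m \<Longrightarrow> 2 \<le> i \<or> i + k \<le> m \<Longrightarrow> serre (\<epsilon> i) d \<Longrightarrow>
   (\<And>l. i < l \<Longrightarrow> l \<le> i + k \<Longrightarrow> d * \<epsilon> l = \<epsilon> l * d) \<Longrightarrow> serre (nest i k) d"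
proof (induction k)
  case (Suc k)
  have "serre (br (nest i k) (\<epsilon> (Suc (i + k)))) d"
    by (rule serre_transfer_right) (use Suc serre_next_nest[of i k] in auto)
  then show ?case by simp
qed auto

lemma nest_split:
  assumes "1 \<le> i" "Suc i + k \<le> Suc m" "2 \<le> i \<or> Suc i + k \<le> m"
  shows "nest i (Suc k) = br (\<epsilon> i) (nest (Suc i) k)"
  using assms
proof (induction k)
  case (Suc k)
  have "nest i (Suc (Suc k)) = br (br (\<epsilon> i) (nest (Suc i) k)) (\<epsilon> (Suc (Suc (i + k))))"
    using Suc by simp
  also have "\<dots> = br (\<epsilon> i) (br (nest (Suc i) k) (\<epsilon> (Suc (Suc (i + k)))))"
    by (rule br_assoc) (use Suc in \<open>auto intro: far\<close>)
  finally show ?case by simp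
qed simp

definition xx :: "nat \<Rightarrow> 'a" where "xx j = nest 1 (j - 1)"

text \<open>The clause for y_1 is the shape in which T_1 ... T_m E_0 expands: E_0 is adjacent to
  both 1 and m, so one bracket comes from T_m and one from T_1. The value at 0 is a dummy.\<close>

fun yy :: "nat \<Rightarrow> 'a" where
  "yy 0 = 0"
| "yy (Suc 0) = br (xx m) (br (\<epsilon> 1) (\<epsilon> (Suc m)))"
| "yy (Suc (Suc j)) = br (yy (Suc j)) (\<epsilon> (Suc (Suc j)))"

lemma xx_Suc: "1 \<le> j \<Longrightarrow> xx (Suc j) = br (xx j) (\<epsilon> (Suc j))"
  by (cases j) (auto simp: xx_def)

lemma xx_1: "xx (Suc 0) = \<epsilon> (Suc 0)" by (simp add: xx_def)

lemma x_chain: "bracket_chain qm qi m \<epsilon> xx"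
proof
  show "xx 2 * \<epsilon> 2 = qm (\<epsilon> 2 * xx 2)"
    using near[of 1] m2 xx_Suc[of 1] xx_1 unfolding serre_iff_right by (simp add: numeral_2_eq_2)
  show "xx 1 * \<epsilon> k = \<epsilon> k * xx 1" if "3 \<le> k" "k \<le> m" for k
    using far[of 1 k] that xx_1 by simp
  show "\<epsilon> i * \<epsilon> k = \<epsilon> k * \<epsilon> i" if "2 \<le> i" "Suc i < k" "k \<le> m" for i k
    using far[of i k] that by simp
qed (simp_all add: xx_Suc near)

text \<open>This chain provides the commutation of the generators 3, ..., m with the bracket along
  2, ..., m + 1, which \<open>affine_A2\<close> turns into commutation with y_1.\<close>

lemma v_chain: "bracket_chain qm qi m (\<lambda>k. \<epsilon> (Suc k)) (\<lambda>j. nest 2 (j - 1))"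
proof
  show "nest 2 (Suc j - 1) = br (nest 2 (j - 1)) (\<epsilon> (Suc (Suc j)))" if "1 \<le> j" for j
    using that by (cases j) auto
  show "nest 2 (2 - 1) * \<epsilon> (Suc 2) = qm (\<epsilon> (Suc 2) * nest 2 (2 - 1))"
    using near[of 2] m2 unfolding serre_iff_right by (simp add: numeral_2_eq_2 numeral_3_eq_3)
  show "\<epsilon> (Suc i) * \<epsilon> (Suc k) = \<epsilon> (Suc k) * \<epsilon> (Suc i)" if "2 \<le> i" "Suc i < k" "k \<le> m" for i k
    using far[of "Suc i" "Suc k"] that by simp
  show "nest 2 (1 - 1) * \<epsilon> (Suc k) = \<epsilon> (Suc k) * nest 2 (1 - 1)" if "3 \<le> k" "k \<le> m" for k
    using far[of 2 "Suc k"] that by simp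
qed (simp_all add: near)

text \<open>Fusing the nodes 3, ..., m + 1 into one element leaves a triangle with the nodes 1 and
  2, which reduces every m to affine A_2.\<close>

definition cc :: 'a where "cc = nest 3 (m - 2)"

lemma cc_serre:
  "serre (\<epsilon> 1) cc" "serre cc (\<epsilon> 1)" "serre (\<epsilon> 2) cc" "serre cc (\<epsilon> 2)"
proof -
  have m: "3 + (m - 2) = Suc m" using m2 by simp
  show "serre (\<epsilon> 1) cc" "serre cc (\<epsilon> 1)" unfolding cc_def
    by (rule serre_nest_last serre_nest_left; use m wrap far in simp)+
  have "serre (\<epsilon> 2) (\<epsilon> 3) \<and> serre (\<epsilon> 3) (\<epsilon> 2)"
    using near[of 2] m2 by (simp add: numeral_3_eq_3 numeral_2_eq_2)
  then show "serre (\<epsilon> 2) cc" "serre cc (\<epsilon> 2)" unfolding cc_def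
    by - (rule serre_nest_first serre_nest_right; use m far in simp)+
qed

lemma v_eq: "nest 2 (m - 1) = br (\<epsilon> 2) cc"
  using nest_split[of 2 "m - 2"] m2 by (simp add: cc_def numeral_3_eq_3 numeral_2_eq_2 Suc_diff_Suc)

lemma xx_split: "3 \<le> j \<Longrightarrow> j \<le> m \<Longrightarrow> xx j = br (xx 2) (nest 3 (j - 3))"
proof (induction j rule: nat_induct_at_least[of 3])
  case base
  then show ?case using xx_Suc[of 2] by (simp add: numeral_3_eq_3 numeral_2_eq_2)
next
  case (Suc j)
  have "xx (Suc j) = br (br (xx 2) (nest 3 (j - 3))) (\<epsilon> (Suc j))"
    using xx_Suc[of j] Suc by simp
  also have "\<dots> = br (xx 2) (br (nest 3 (j - 3)) (\<epsilon> (Suc j)))"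
    by (rule br_assoc, rule bracket_chain.z_far[OF x_chain]) (use Suc in auto)
  also have "br (nest 3 (j - 3)) (\<epsilon> (Suc j)) = nest 3 (Suc (j - 3))" using Suc by simp
  also have "Suc (j - 3) = Suc j - 3" using Suc by simp
  finally show ?case .
qed

text \<open>For m >= 3 let g be the bracket along 3, ..., m, so that x_m = [x_2, g]. Moving g across
  needs x_2 to commute with [E_1, E_0]; this is the commutation of E_2 with E_0, transferred along
  the action of E_1. For m = 2 nothing has to be regrouped.\<close>

lemma yy_1: "yy 1 = br (xx 2) (br (\<epsilon> 1) cc)"
proof (cases "m = 2")
  case True
  then have e: "m - 2 = 0" "Suc m = 3" by auto
  have "cc = \<epsilon> (Suc m)" unfolding cc_def e by simp
  moreover have "xx m = xx 2" by (simp only: True)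
  ultimately show ?thesis by simp
next
  case False
  then have m3: "3 \<le> m" using m2 by simp
  let ?g = "nest 3 (m - 3)" and ?w = "br (\<epsilon> 1) (\<epsilon> (Suc m))"
  have "cc = br ?g (\<epsilon> (Suc m))"
    using m3 by (simp add: cc_def) (metis Suc_diff_Suc Suc_le_lessD add_diff_inverse_nat
      diff_Suc_eq_diff_pred eval_nat_numeral(3) leD nest.simps(2) numeral_2_eq_2 pred_numeral_simps(3))
  then have "br (\<epsilon> 1) cc = br ?g ?w"
    using br_swap[OF nest_commute[of 3 "m - 3" "\<epsilon> 1"], of "\<epsilon> (Suc m)"] far m3 by simp
  moreover have "xx 2 * ?w = ?w * xx 2"
  proof (rule transfer_11[of "\<epsilon> 1" "\<epsilon> 2" _ "\<epsilon> (Suc m)" _ "\<lambda>x. x"])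
    have x2: "xx 2 = br (\<epsilon> 1) (\<epsilon> 2)" using xx_Suc[of 1] xx_1 by (simp add: numeral_2_eq_2)
    show "\<epsilon> 1 * \<epsilon> 2 = xx 2 + qi (\<epsilon> 2 * \<epsilon> 1)" unfolding x2 by (rule br_exchange)
    show "\<epsilon> 1 * xx 2 = qm (xx 2 * \<epsilon> 1)" unfolding x2
      using near[of 1] m2 serre_iff_left by (simp add: numeral_2_eq_2)
    show "\<epsilon> 1 * ?w = qm (?w * \<epsilon> 1)" using wrap serre_iff_left by simp
    show "\<epsilon> 2 * \<epsilon> (Suc m) = \<epsilon> (Suc m) * \<epsilon> 2" using far[of 2 "Suc m"] m3 by simp
  qed (rule br_exchange id_scalar)+
  then have "br (br (xx 2) ?g) ?w = br (xx 2) (br ?g ?w)" by (rule br_assoc)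
  ultimately show ?thesis using xx_split[of m] m3 by simp
qed

lemma xx_yy_base:
  shows "xx 1 * yy 1 = qm (qm (yy 1 * xx 1))" "xx 2 * yy 1 = qm (yy 1 * xx 2)"
    "yy 2 * \<epsilon> 2 = qm (\<epsilon> 2 * yy 2)" "yy 1 * yy 2 = qm (yy 2 * yy 1)"
    "3 \<le> k \<Longrightarrow> k \<le> m \<Longrightarrow> yy 1 * \<epsilon> k = \<epsilon> k * yy 1"
proof -
  have s12: "serre (\<epsilon> 1) (\<epsilon> 2)" "serre (\<epsilon> 2) (\<epsilon> 1)" using near[of 1] m2 by (auto simp: numeral_2_eq_2)
  have x2: "xx 2 = br (\<epsilon> 1) (\<epsilon> 2)" using xx_Suc[of 1] xx_1 by (simp add: numeral_2_eq_2)
  have y2: "yy 2 = br (yy 1) (\<epsilon> 2)" by (simp add: numeral_2_eq_2)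
  note A = affine_A2[OF s12 cc_serre x2 refl yy_1 y2]
  show "xx 1 * yy 1 = qm (qm (yy 1 * xx 1))" using A(1) xx_1 by simp
  show "xx 2 * yy 1 = qm (yy 1 * xx 2)" "yy 2 * \<epsilon> 2 = qm (\<epsilon> 2 * yy 2)" "yy 1 * yy 2 = qm (yy 2 * yy 1)"
    using A by auto
  assume k: "3 \<le> k" "k \<le> m"
  then obtain k' where k': "k = Suc k'" by (cases k) auto
  have "\<epsilon> k * nest 2 (m - 1) = nest 2 (m - 1) * \<epsilon> k"
    using bracket_chain.z_inner[OF v_chain, of k' m] k k' by simp
  then have "\<epsilon> k * yy 1 = yy 1 * \<epsilon> k"
    using A(5)[of "\<epsilon> k"] far[of 1 k] k unfolding v_eq by simp
  then show "yy 1 * \<epsilon> k = \<epsilon> k * yy 1" by simp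
qed

lemma y_chain: "bracket_chain qm qi m \<epsilon> yy"
proof
  show "yy (Suc j) = br (yy j) (\<epsilon> (Suc j))" if "1 \<le> j" for j
    using that by (cases j) auto
  show "\<epsilon> i * \<epsilon> k = \<epsilon> k * \<epsilon> i" if "2 \<le> i" "Suc i < k" "k \<le> m" for i k
    using far[of i k] that by simp
qed (use xx_yy_base near in auto)

sublocale xy: bracket_chain_pair qm qi m \<epsilon> xx yy
proof (intro bracket_chain_pair.intro x_chain y_chain bracket_chain_pair_axioms.intro)
qed (use xx_yy_base in auto)

lemma xx_quad: "1 \<le> i \<Longrightarrow> i < j \<Longrightarrow> j \<le> m \<Longrightarrow> xx i * xx j = qm (xx j * xx i)"
proof (rule xy.x.z_quad)
  show "xx 1 * xx 2 = qm (xx 2 * xx 1)"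
    using near[of 1] m2 xx_Suc[of 1] xx_1 unfolding serre_iff_left by (simp add: numeral_2_eq_2)
qed

lemma yy_quad: "1 \<le> i \<Longrightarrow> i < j \<Longrightarrow> j \<le> m \<Longrightarrow> yy i * yy j = qm (yy j * yy i)"
  by (rule xy.y.z_quad) (use xx_yy_base in auto)

end

section \<open>Free algebras and their quotients\<close>

lemma freealg_induct [case_names zero single add]:
  fixes p :: "'a \<Rightarrow>\<^sub>0 'b::comm_monoid_add"
  assumes "P 0" "\<And>w c. P (Poly_Mapping.single w c)" "\<And>p r. P p \<Longrightarrow> P r \<Longrightarrow> P (p + r)"
  shows "P p"
proof -
  have "P (\<Sum>w\<in>A. Poly_Mapping.single w (Poly_Mapping.lookup p w))" if "finite A" for A
    using that by (induction A rule: finite_induct) (use assms in auto)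
  moreover have "p = (\<Sum>w\<in>Poly_Mapping.keys p. Poly_Mapping.single w (Poly_Mapping.lookup p w))"
    by (rule poly_mapping_eqI) (simp add: lookup_sum lookup_single when_def in_keys_iff)
  ultimately show ?thesis by (metis finite_keys)
qed

section \<open>Sums over the words of an element\<close>

definition word_sum :: "('a \<Rightarrow> 'b::zero \<Rightarrow> 'c::comm_monoid_add) \<Rightarrow> ('a \<Rightarrow>\<^sub>0 'b) \<Rightarrow> 'c" where
  "word_sum f p = (\<Sum>w\<in>Poly_Mapping.keys p. f w (Poly_Mapping.lookup p w))"

lemma word_sum_zero [simp]: "word_sum f 0 = 0"
  by (simp add: word_sum_def)

lemma word_sum_single: "f w 0 = 0 \<Longrightarrow> word_sum f (Poly_Mapping.single w c) = f w c"
  by (simp add: word_sum_def)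

lemma word_sum_add:
  assumes "\<And>w. f w 0 = 0" "\<And>w a b. f w (a + b) = f w a + f w b"
  shows "word_sum f (p + r) = word_sum f p + word_sum f r"
  unfolding word_sum_def by (rule setsum_keys_plus_distrib) (use assms in auto)

lemma word_sum_cong: "(\<And>w. w \<in> Poly_Mapping.keys p \<Longrightarrow> f w (Poly_Mapping.lookup p w) = g w (Poly_Mapping.lookup p w)) \<Longrightarrow> word_sum f p = word_sum g p"
  by (simp add: word_sum_def)

lemma word_sum_add_fun: "word_sum (\<lambda>w c. f w c + g w c) p = word_sum f p + word_sum g p"
  by (simp add: word_sum_def sum.distrib)

lemma additive_minus:
  fixes f :: "'a::ab_group_add \<Rightarrow> 'b::ab_group_add"
  assumes "\<And>x y. f (x + y) = f x + f y"
  shows "f 0 = 0" "f (- x) = - f x" "f (x - y) = f x - f y"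
proof -
  show z: "f 0 = 0" using assms[of 0 0] by simp
  have n: "f (- x) = - f x" for x using assms[of x "-x"] z by (simp add: eq_neg_iff_add_eq_0 add.commute)
  show "f (- x) = - f x" by (rule n)
  show "f (x - y) = f x - f y" using assms[of x "- y"] n by simp
qed

lemma sc_add: "sc (a + b) = sc a + sc b" by (simp add: sc_def single_add)
lemma sc_mult: "sc (a * b) = sc a * sc b" by (simp add: sc_def mult_single)
lemma sc_1 [simp]: "sc 1 = 1" by (simp add: sc_def)
lemma sc_0 [simp]: "sc 0 = 0" by (simp add: sc_def)

lemma sc_single: "sc c * Poly_Mapping.single w d = Poly_Mapping.single w (c * d)"
  by (simp add: sc_def mult_single)

lemma sc_commute: "x * sc c = sc c * x" for c :: "'k::comm_ring_1"
  by (induction x rule: freealg_induct) (simp_all add: sc_def mult_single distrib_left distrib_right mult.commute)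

lemma sc_left_commute: "x * (sc c * y) = sc c * (x * y)" for c :: "'k::comm_ring_1"
  by (metis mult.assoc sc_commute)

lemma single_word:
  "Poly_Mapping.single w c = sc c * prod_list (map gen (letters w))"
proof -
  have "Poly_Mapping.single (Wd xs) 1 = (prod_list (map gen xs) :: ('a, 'b) freealg)" for xs :: "'a list"
  proof (induction xs)
    case Nil
    then show ?case by (simp add: zero_word_def[symmetric])
  next
    case (Cons x xs)
    have "Wd [x] + Wd xs = Wd (x # xs)" by (simp add: plus_word_def)
    then show ?case using Cons[symmetric] by (simp add: gen_def mult_single)
  qed
  from this[of "letters w"] show ?thesis
    by (cases w) (simp flip: sc_single[of c _ 1, simplified])
qed

text \<open>The target ring is left open so that both the substitutions inside free algebras and the
  representation by operators are instances.\<close>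

definition ev :: "('k::comm_ring_1 \<Rightarrow> 'r::ring_1) \<Rightarrow> ('g \<Rightarrow> 'r) \<Rightarrow> ('g, 'k) freealg \<Rightarrow> 'r" where
  "ev \<sigma> \<phi> = word_sum (\<lambda>w c. \<sigma> c * prod_list (map \<phi> (letters w)))"

locale eval_hom =
  fixes \<sigma> :: "'k::comm_ring_1 \<Rightarrow> 'r::ring_1" and \<phi> :: "'g \<Rightarrow> 'r"
  assumes \<sigma>_add: "\<sigma> (a + b) = \<sigma> a + \<sigma> b" and \<sigma>_mult: "\<sigma> (a * b) = \<sigma> a * \<sigma> b" and \<sigma>_1: "\<sigma> 1 = 1"
    and \<sigma>_comm: "\<phi> g * \<sigma> a = \<sigma> a * \<phi> g"
begin

lemma \<sigma>_0: "\<sigma> 0 = 0" using additive_minus(1)[of \<sigma>] \<sigma>_add by blast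

lemma ev_single: "ev \<sigma> \<phi> (Poly_Mapping.single w c) = \<sigma> c * prod_list (map \<phi> (letters w))"
  by (simp add: ev_def word_sum_single \<sigma>_0)

lemma ev_add: "ev \<sigma> \<phi> (p + r) = ev \<sigma> \<phi> p + ev \<sigma> \<phi> r"
  unfolding ev_def by (rule word_sum_add) (simp_all add: \<sigma>_0 \<sigma>_add distrib_right)

lemmas ev_minus = additive_minus[of "ev \<sigma> \<phi>", OF ev_add]

lemma ev_sc: "ev \<sigma> \<phi> (sc c) = \<sigma> c"
  by (simp add: sc_def ev_single zero_word_def)

lemma ev_1: "ev \<sigma> \<phi> 1 = 1"
  using ev_sc[of 1] \<sigma>_1 by simp

lemma ev_gen: "ev \<sigma> \<phi> (gen g) = \<phi> g"
  by (simp add: gen_def ev_single \<sigma>_1)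

lemma prod_comm: "prod_list (map \<phi> xs) * \<sigma> c = \<sigma> c * prod_list (map \<phi> xs)"
  by (induction xs) (simp_all add: mult.assoc, metis mult.assoc \<sigma>_comm)

lemma ev_mult: "ev \<sigma> \<phi> (p * r) = ev \<sigma> \<phi> p * ev \<sigma> \<phi> r"
proof (induction p rule: freealg_induct)
  case (single w c)
  show ?case
  proof (induction r rule: freealg_induct)
    case (single v d)
    have "\<sigma> c * (\<sigma> d * (prod_list (map \<phi> (letters w)) * x)) = \<sigma> c * (prod_list (map \<phi> (letters w)) * (\<sigma> d * x))" for x
      by (metis mult.assoc prod_comm)
    then show ?case by (simp add: mult_single ev_single plus_word_def \<sigma>_mult mult.assoc)
  qed (simp_all add: ev_minus(1) ev_add distrib_left)
qed (simp_all add: ev_minus(1) ev_add distrib_right)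

lemma ev_ideal:
  assumes "\<And>s. s \<in> S \<Longrightarrow> ev \<sigma> \<phi> s = 0" "a \<in> ideal_gen S"
  shows "ev \<sigma> \<phi> a = 0"
  using assms(2) by induction (simp_all add: assms(1) ev_minus(1) ev_add ev_mult)

end

lemma ext_free_ev: "ext_free \<phi> = ev sc \<phi>"
  by (rule ext) (simp add: ext_free_def ev_def word_sum_def)

lemma eval_hom_sc: "eval_hom sc \<phi>" for \<phi> :: "'g \<Rightarrow> ('h, 'k::comm_ring_1) freealg"
  by unfold_locales (simp_all only: sc_add sc_mult sc_1, rule sc_commute)

lemmas ext_free_simps =
  eval_hom.ev_add[OF eval_hom_sc, folded ext_free_ev]
  eval_hom.ev_minus[OF eval_hom_sc, folded ext_free_ev]
  eval_hom.ev_mult[OF eval_hom_sc, folded ext_free_ev]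
  eval_hom.ev_sc[OF eval_hom_sc, folded ext_free_ev]
  eval_hom.ev_1[OF eval_hom_sc, folded ext_free_ev]
  eval_hom.ev_gen[OF eval_hom_sc, folded ext_free_ev]

section \<open>Two-sided ideals and the quotient ring\<close>

lemma ideal_left: "a \<in> ideal_gen S \<Longrightarrow> x * a \<in> ideal_gen S"
  using ideal_gen.mult[of a S x 1] by simp

lemma ideal_right: "a \<in> ideal_gen S \<Longrightarrow> a * x \<in> ideal_gen S"
  using ideal_gen.mult[of a S 1 x] by simp

lemma ideal_minus: "a \<in> ideal_gen S \<Longrightarrow> - a \<in> ideal_gen S"
  using ideal_left[of a S "-1"] by simp

lemma ideal_diff: "a \<in> ideal_gen S \<Longrightarrow> b \<in> ideal_gen S \<Longrightarrow> a - b \<in> ideal_gen S"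
  using ideal_gen.add[of a S "-b"] ideal_minus[of b] by simp

lemma ideal_hom:
  fixes \<phi> :: "'g \<Rightarrow> ('h, 'k::comm_ring_1) freealg"
  assumes "\<And>s. s \<in> S \<Longrightarrow> ext_free \<phi> s \<in> ideal_gen S'" "a \<in> ideal_gen S"
  shows "ext_free \<phi> a \<in> ideal_gen S'"
  using assms(2) by induction (auto simp: assms(1) ext_free_simps intro: ideal_gen.intros)

lemma mult_diff_ideal:
  assumes "a - a' \<in> ideal_gen S" "b - b' \<in> ideal_gen S" shows "a * b - a' * b' \<in> ideal_gen S"
proof -
  have "a * b - a' * b' = a * (b - b') + (a - a') * b'" by (simp add: algebra_simps)
  then show ?thesis using assms by (auto intro: ideal_gen.add ideal_left ideal_right)
qed

lemma ideal_trans: "a - b \<in> ideal_gen S \<Longrightarrow> b - c \<in> ideal_gen S \<Longrightarrow> a - c \<in> ideal_gen S"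
  using ideal_gen.add[of "a - b" S "b - c"] by simp

lemma ideal_sym: "a - b \<in> ideal_gen S \<Longrightarrow> b - a \<in> ideal_gen S"
  using ideal_minus[of "a - b" S] by simp

text \<open>A type cannot depend on the ideal, so the quotients by all ideals are packed into one
  product ring; \<open>cls S\<close> is the (non-unital) embedding of the factor belonging to \<open>S\<close>.\<close>

quotient_type (overloaded) ('g, 'k) quot = "('g, 'k::field) freealg set \<Rightarrow> ('g, 'k) freealg" /
  "\<lambda>f g. \<forall>S. f S - g S \<in> ideal_gen S"
proof (rule equivpI)
  show "reflp (\<lambda>f g. \<forall>S. f S - g S \<in> ideal_gen S)"
    by (auto simp: reflp_def intro: ideal_gen.zero)
  show "symp (\<lambda>f g. \<forall>S. f S - g S \<in> ideal_gen S)"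
    by (auto simp: symp_def intro: ideal_sym)
  show "transp (\<lambda>f g. \<forall>S. f S - g S \<in> ideal_gen S)"
    by (auto simp: transp_def intro: ideal_trans)
qed

instantiation quot :: (type, field) ring
begin

lift_definition zero_quot :: "('a, 'b) quot" is "\<lambda>S. 0" .
lift_definition plus_quot :: "('a, 'b) quot \<Rightarrow> ('a, 'b) quot \<Rightarrow> ('a, 'b) quot" is "\<lambda>f g S. f S + g S"
  using ideal_gen.add by (fastforce simp: algebra_simps)
lift_definition uminus_quot :: "('a, 'b) quot \<Rightarrow> ('a, 'b) quot" is "\<lambda>f S. - f S"
  using ideal_minus by fastforce
lift_definition minus_quot :: "('a, 'b) quot \<Rightarrow> ('a, 'b) quot \<Rightarrow> ('a, 'b) quot" is "\<lambda>f g S. f S - g S"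
  using ideal_diff by (fastforce simp: algebra_simps)
lift_definition times_quot :: "('a, 'b) quot \<Rightarrow> ('a, 'b) quot \<Rightarrow> ('a, 'b) quot" is "\<lambda>f g S. f S * g S"
  using mult_diff_ideal by blast

instance
  by standard (transfer; simp add: algebra_simps ideal_gen.zero)+

end

lift_definition scq :: "'k::field \<Rightarrow> ('g, 'k) quot \<Rightarrow> ('g, 'k) quot" is "\<lambda>c f S. sc c * f S"
  using mult_diff_ideal[where a = "sc c" and a' = "sc c" for c] by (fastforce intro: ideal_gen.zero)

definition cls :: "('g, 'k::field) freealg set \<Rightarrow> ('g, 'k) freealg \<Rightarrow> ('g, 'k) quot" where
  "cls S a = abs_quot (\<lambda>S'. if S' = S then a else 0)"

lemma scalar_op_scq: "scalar_op (scq c)"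
  unfolding scalar_op_def
  by (intro conjI allI; transfer) (simp_all add: algebra_simps ideal_gen.zero sc_left_commute)

lemma scq_scq: "scq a (scq b x) = scq (a * b) x"
  by transfer (simp add: sc_mult mult.assoc ideal_gen.zero)

lemma scq_1: "scq 1 x = x"
  by transfer (simp add: ideal_gen.zero)

lemma scq_add: "scq (a + b) x = scq a x + scq b x"
  by transfer (simp add: sc_add algebra_simps ideal_gen.zero)

lemma cls_eq_iff: "cls S a = cls S b \<longleftrightarrow> a - b \<in> ideal_gen S"
  by (auto simp: cls_def quot.abs_eq_iff ideal_gen.zero)

lemma cls_0: "cls S 0 = 0"
  by (simp add: cls_def zero_quot_def)
lemma cls_add: "cls S (a + b) = cls S a + cls S b"
  by (auto simp: cls_def plus_quot.abs_eq intro!: arg_cong[of _ _ abs_quot])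
lemma cls_minus: "cls S (- a) = - cls S a"
  by (auto simp: cls_def uminus_quot.abs_eq intro!: arg_cong[of _ _ abs_quot])
lemma cls_diff: "cls S (a - b) = cls S a - cls S b"
  by (auto simp: cls_def minus_quot.abs_eq intro!: arg_cong[of _ _ abs_quot])
lemma cls_mult: "cls S (a * b) = cls S a * cls S b"
  by (auto simp: cls_def times_quot.abs_eq intro!: arg_cong[of _ _ abs_quot])
lemma cls_sc: "cls S (sc c * a) = scq c (cls S a)"
  by (auto simp: cls_def scq.abs_eq intro!: arg_cong[of _ _ abs_quot])

lemma cls_sc_mult: "cls S (sc c) * cls S a = scq c (cls S a)" "cls S (sc c) * (cls S a * y) = scq c (cls S a * y)"
proof -
  show 1: "cls S (sc c) * cls S a = scq c (cls S a)" by (simp flip: cls_mult cls_sc)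
  then show "cls S (sc c) * (cls S a * y) = scq c (cls S a * y)"
    by (simp add: scalar_op_simps(5)[OF scalar_op_scq] flip: mult.assoc)
qed

lemmas cls_simps = cls_0 cls_add cls_minus cls_diff cls_mult cls_sc_mult

lemma cls_rel: "a - b \<in> S \<Longrightarrow> cls S a = cls S b"
  unfolding cls_eq_iff by (rule ideal_gen.base)

section \<open>The quantum affine algebra\<close>

lemma transcendental_power_neq_1:
  assumes "transcendental_over_Q q" "0 < n" shows "q ^ n \<noteq> 1"
proof
  assume *: "q ^ n = 1"
  obtain k where n: "n = Suc k" using assms(2) by (cases n) auto
  define p :: "rat poly" where "p = pCons (-1) (monom 1 k)"
  have "poly (map_poly of_rat p) q = 0"
    using * n by (simp add: p_def map_poly_pCons map_poly_monom poly_monom of_rat_minus)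
  moreover have "p \<noteq> 0" by (simp add: p_def)
  ultimately show False using assms(1) unfolding transcendental_over_Q_def by blast
qed

locale generic_q =
  fixes q :: "'k::field_char_0" and m :: nat
  assumes q0: "q \<noteq> 0" and q_power: "0 < n \<Longrightarrow> q ^ n \<noteq> 1" and m2: "1 < m"
begin

lemma qhat0: "q - inverse q \<noteq> 0"
proof
  assume "q - inverse q = 0"
  then have "q ^ 2 = 1" using q0 by (simp add: field_simps power2_eq_square)
  then show False using q_power[of 2] by simp
qed

lemma q2_0: "q + inverse q \<noteq> 0"
proof
  assume "q + inverse q = 0"
  then have "q ^ 2 = -1" using q0 by (simp add: field_simps power2_eq_square eq_neg_iff_add_eq_0)
  then have "(q ^ 2) ^ 2 = 1" by simp
  then have "q ^ 4 = 1" by (simp flip: power_mult)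
  then show False using q_power[of 4] by simp
qed

lemma q3_0: "q * q + 1 + inverse q * inverse q \<noteq> 0"
proof
  assume *: "q * q + 1 + inverse q * inverse q = 0"
  have "q ^ 6 - 1 = (q * q - 1) * (q * q) * (q * q + 1 + inverse q * inverse q)"
    using q0 by (simp add: field_simps eval_nat_numeral)
  then have "q ^ 6 = 1" using * by simp
  then show False using q_power[of 6] by simp
qed

abbreviation qm :: "('g, 'k) quot \<Rightarrow> ('g, 'k) quot" where "qm \<equiv> scq q"
abbreviation qi :: "('g, 'k) quot \<Rightarrow> ('g, 'k) quot" where "qi \<equiv> scq (inverse q)"

lemma scq_cancel: "c \<noteq> 0 \<Longrightarrow> scq c x = 0 \<Longrightarrow> x = 0"
  by (metis left_inverse scalar_op_scq scalar_op_simps(2) scq_1 scq_scq)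

lemma scq_diff_left: "scq (a - b) x = scq a x - scq b x"
  using scq_add[of "a - b" b x] by simp

lemma laurent_quot: "laurent_alg qm qi"
proof
  show "x = 0" if "qm x + qi x = 0" for x :: "('g, 'k) quot"
    using scq_cancel[OF q2_0, of x] that by (simp add: scq_add)
  show "x = 0" if "qm (qm x) + x + qi (qi x) = 0" for x :: "('g, 'k) quot"
    using scq_cancel[OF q3_0, of x] that by (simp add: scq_add scq_scq scq_1)
  show "x = 0" if "qm x - qi x = 0" for x :: "('g, 'k) quot"
    using scq_cancel[OF qhat0, of x] that by (simp add: scq_diff_left)
qed (simp_all add: scalar_op_scq scq_scq scq_1 q0)

sublocale L: laurent_alg "qm :: ('g, 'k) quot \<Rightarrow> ('g, 'k) quot" qi
  by (rule laurent_quot)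

end

text \<open>In the finite coordinates every simple root, the affine one included, has +1 at
  \<open>head_index m i\<close> and -1 at \<open>Suc i\<close>. This makes the root 0 follow the
  same formulas as the others.\<close>

definition head_index :: "nat \<Rightarrow> nat \<Rightarrow> nat" where "head_index m i = (if i = 0 then Suc m else i)"

lemma sroot_pos: "0 < k \<Longrightarrow> 0 < m \<Longrightarrow> sroot m i k = (if k = head_index m i then 1 else if k = Suc i then -1 else 0)"
  by (auto simp: sroot_def head_index_def)

lemma sroot_0: "sroot m i 0 = (if i = 0 then 1 else 0)"
  by (auto simp: sroot_def)

lemma ip_two_point:
  assumes "1 \<le> a" "a \<le> m + 1" "1 \<le> b" "b \<le> m + 1" "a \<noteq> b"
    "\<And>k. 1 \<le> k \<Longrightarrow> k \<le> m + 1 \<Longrightarrow> \<nu> k = (if k = a then 1 else if k = b then -1 else 0)"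
  shows "ip m \<mu> \<nu> = \<mu> a - \<mu> b"
proof -
  have "ip m \<mu> \<nu> = (\<Sum>k=1..m+1. (if k = a then \<mu> a else 0) - (if k = b then \<mu> b else 0))"
    unfolding ip_def by (rule sum.cong) (use assms in auto)
  also have "\<dots> = \<mu> a - \<mu> b" using assms by (simp add: sum_subtractf)
  finally show ?thesis .
qed

lemma ip_sroot: "i \<le> m \<Longrightarrow> 0 < m \<Longrightarrow> ip m \<mu> (sroot m i) = \<mu> (head_index m i) - \<mu> (Suc i)"
  by (rule ip_two_point) (auto simp: sroot_pos head_index_def)

text \<open>For m > 1 the two adjacency conditions cannot hold together; for m = 1 the off-diagonal
  entry would be -2.\<close>

lemma ip_sroot_sroot:
  assumes "i \<le> m" "j \<le> m" "1 < m"
  shows "ip m (sroot m i) (sroot m j) =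
    (if i = j then 2 else if head_index m i = Suc j \<or> head_index m j = Suc i then -1 else 0)"
  using assms by (auto simp: ip_sroot sroot_pos head_index_def)

lemma sroot_sum: "i \<le> m \<Longrightarrow> 0 < m \<Longrightarrow> (\<Sum>k=1..m+1. sroot m i k) = 0"
  using ip_sroot[of i m "\<lambda>_. 1"] by (simp add: ip_def)

lemma qlat_sroot: "i \<le> m \<Longrightarrow> 0 < m \<Longrightarrow> qlat m (sroot m i)"
  using sroot_sum[of i m] by (auto simp: qlat_def sroot_pos head_index_def)

lemma qlat_lneg: "qlat m \<mu> \<Longrightarrow> qlat m (lneg \<mu>)"
  unfolding qlat_def lneg_def by (simp add: sum_negf del: sum.cl_ivl_Suc)

context generic_q
begin

abbreviation U :: "(ugen, 'k) freealg \<Rightarrow> (ugen, 'k) quot" where "U \<equiv> cls (U_rels m q)"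

section \<open>Generators and relations in the quotient\<close>

definition eE :: "nat \<Rightarrow> (ugen, 'k) quot" where "eE i = U (gen (E i))"
definition eF :: "nat \<Rightarrow> (ugen, 'k) quot" where "eF i = U (gen (F i))"
definition eK :: "lat \<Rightarrow> (ugen, 'k) quot" where "eK \<mu> = U (gen (K \<mu>))"

lemmas cls_op_simps = cls_simps scalar_op_simps(5,6)[OF scalar_op_scq] mult.assoc

lemma U_qcomm: "U (qcomm q a b) = L.br (U a) (U b)"
  by (simp add: qcomm_def L.br_def cls_op_simps)

lemma eK_add: "qlat m \<mu> \<Longrightarrow> qlat m \<nu> \<Longrightarrow> eK \<mu> * eK \<nu> = eK (ladd \<mu> \<nu>)"
  unfolding eK_def cls_mult[symmetric] by (rule cls_rel) (auto simp: U_rels_def)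

lemma eK_E:
  assumes "qlat m \<mu>" "i \<le> m"
  shows "eK \<mu> * eE i = scq (q powi ip m \<mu> (sroot m i)) (eE i * eK \<mu>)"
proof -
  have "U (gen (K \<mu>) * gen (E i)) = U (sc (q powi ip m \<mu> (sroot m i)) * gen (E i) * gen (K \<mu>))"
    by (rule cls_rel) (use assms in \<open>auto simp: U_rels_def\<close>)
  then show ?thesis by (simp add: eK_def eE_def cls_op_simps)
qed

lemma eK_F:
  assumes "qlat m \<mu>" "i \<le> m"
  shows "eK \<mu> * eF i = scq (q powi (- ip m \<mu> (sroot m i))) (eF i * eK \<mu>)"
proof -
  have "U (gen (K \<mu>) * gen (F i)) = U (sc (q powi (- ip m \<mu> (sroot m i))) * gen (F i) * gen (K \<mu>))"
    by (rule cls_rel) (use assms in \<open>auto simp: U_rels_def\<close>)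
  then show ?thesis by (simp add: eK_def eF_def cls_op_simps)
qed

lemma eE_commute:
  assumes "i \<le> m" "j \<le> m" "ip m (sroot m i) (sroot m j) = 0"
  shows "eE i * eE j = eE j * eE i"
proof -
  have "U (gen (E i) * gen (E j)) = U (gen (E j) * gen (E i))"
    by (rule cls_rel) (use assms in \<open>auto simp: U_rels_def\<close>)
  then show ?thesis by (simp add: eE_def cls_mult)
qed

lemma eE_serre:
  assumes "i \<le> m" "j \<le> m" "ip m (sroot m i) (sroot m j) = -1"
  shows "L.serre (eE i) (eE j)"
proof -
  have "U (gen (E i) * qcomm q (gen (E i)) (gen (E j))) = U (sc q * qcomm q (gen (E i)) (gen (E j)) * gen (E i))"
    by (rule cls_rel) (use assms in \<open>auto simp: U_rels_def\<close>)
  then have "U (gen (E i) * qcomm q (gen (E i)) (gen (E j))) = qm (U (qcomm q (gen (E i)) (gen (E j)) * gen (E i)))"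
    by (simp only: mult.assoc cls_sc)
  then show ?thesis
    unfolding L.serre_iff_left by (simp only: eE_def U_qcomm cls_mult)
qed

lemma eE_eF:
  assumes "i \<le> m" "j \<le> m"
  shows "i \<noteq> j \<Longrightarrow> eE i * eF j = eF j * eE i"
    and "qm (eE i * eF i - eF i * eE i) - qi (eE i * eF i - eF i * eE i)
       = eK (sroot m i) - eK (lneg (sroot m i))"
proof -
  have "U (gen (E i) * gen (F j) - gen (F j) * gen (E i)) = U
    (if i = j then sc (inverse (qhat q)) * (gen (K (sroot m i)) - gen (K (lneg (sroot m i)))) else 0)"
    if "j \<le> m" for j
    by (rule cls_rel, unfold U_rels_def, rule UnI2, rule CollectI, intro exI[of _ i] exI[of _ j])
      (use assms that in simp)
  then have *: "eE i * eF j - eF j * eE i =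
    (if i = j then scq (inverse (qhat q)) (eK (sroot m i) - eK (lneg (sroot m i))) else 0)" if "j \<le> m" for j
    using that by (cases "i = j") (simp_all add: eE_def eF_def eK_def cls_0 cls_mult cls_diff cls_sc
      flip: cls_mult cls_diff cls_sc)
  show "i \<noteq> j \<Longrightarrow> eE i * eF j = eF j * eE i" using *[of j] assms by simp
  show "qm (eE i * eF i - eF i * eE i) - qi (eE i * eF i - eF i * eE i)
       = eK (sroot m i) - eK (lneg (sroot m i))"
    using *[of i] assms qhat0 by (simp add: scq_scq scq_1 qhat_def flip: scq_diff_left left_diff_distrib)
qed

lemma eE_eK_inv: "qlat m \<mu> \<Longrightarrow> eE i * (eK (lneg \<mu>) * eK \<mu>) = eE i"
proof -
  assume \<mu>: "qlat m \<mu>"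
  have "ladd (lneg \<mu>) \<mu> = lzero" by (auto simp: ladd_def lneg_def lzero_def)
  then have "eK (lneg \<mu>) * eK \<mu> = eK lzero" using eK_add[OF qlat_lneg[OF \<mu>] \<mu>] by simp
  also have "\<dots> = U 1" unfolding eK_def by (rule cls_rel) (auto simp: U_rels_def)
  finally show ?thesis by (simp add: eE_def flip: cls_mult)
qed

lemma affine: "affine_cycle qm qi m (\<lambda>k. eE (if k = Suc m then 0 else k))"
proof
  show "2 \<le> m" using m2 by simp
qed (use m2 in \<open>auto intro!: eE_commute eE_serre simp: ip_sroot_sroot head_index_def\<close>)

sublocale A: affine_cycle "qm :: (ugen, 'k) quot \<Rightarrow> (ugen, 'k) quot" qi m "\<lambda>k. eE (if k = Suc m then 0 else k)"
  by (rule affine)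

text \<open>\<open>xr\<close> and \<open>yr\<close> lift x_j and y_j to the free algebra, where
  degrees and the twisted product are defined.\<close>

fun xr :: "nat \<Rightarrow> (ugen, 'k) freealg" where
  "xr 0 = 0"
| "xr (Suc 0) = gen (E 1)"
| "xr (Suc (Suc j)) = qcomm q (xr (Suc j)) (gen (E (Suc (Suc j))))"

fun yr :: "nat \<Rightarrow> (ugen, 'k) freealg" where
  "yr 0 = 0"
| "yr (Suc 0) = qcomm q (xr m) (qcomm q (gen (E 1)) (gen (E 0)))"
| "yr (Suc (Suc j)) = qcomm q (yr (Suc j)) (gen (E (Suc (Suc j))))"

lemma U_xr: "1 \<le> j \<Longrightarrow> j \<le> m \<Longrightarrow> U (xr j) = A.xx j"
  by (induction j rule: xr.induct) (simp_all add: A.xx_1 A.xx_Suc U_qcomm flip: eE_def)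

lemma U_yr: "1 \<le> j \<Longrightarrow> j \<le> m \<Longrightarrow> U (yr j) = A.yy j"
  using m2 by (induction j rule: yr.induct) (simp_all add: U_xr U_qcomm flip: eE_def)

end

section \<open>The root vectors\<close>

text \<open>The positive root alpha_i + ... + alpha_j = e_i - e_(j+1); \<open>beta 1 j\<close> is
  the degree of x_j.\<close>

definition beta :: "nat \<Rightarrow> nat \<Rightarrow> lat" where
  "beta i j = (\<lambda>k. if k = i then 1 else if k = Suc j then -1 else 0)"

lemma beta_apply: "beta i j k = (if k = i then 1 else if k = Suc j then -1 else 0)"
  by (simp add: beta_def)

lemma ip_beta: "1 \<le> j \<Longrightarrow> j \<le> m \<Longrightarrow> ip m \<mu> (beta 1 j) = \<mu> 1 - \<mu> (Suc j)"
  by (rule ip_two_point) (auto simp: beta_def)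

lemmas ip_beta' = ip_beta[simplified]

lemma qlat_beta: "1 \<le> j \<Longrightarrow> j \<le> m \<Longrightarrow> qlat m (beta 1 j)"
  using ip_beta[of j m "\<lambda>_. 1"] by (auto simp: qlat_def beta_def ip_def)

lemma beta_self: "1 \<le> j \<Longrightarrow> beta j j = sroot m j"
  by (auto simp: beta_def sroot_def)

lemma beta_add: "1 \<le> j \<Longrightarrow> ladd (beta 1 j) (sroot m (Suc j)) = beta 1 (Suc j)"
  by (auto simp: beta_def sroot_def ladd_def)

lemma srefl_beta:
  assumes "1 \<le> i" "i < j" "j \<le> m"
  shows "srefl m i (beta (Suc i) j) = beta i j"
proof -
  have "ip m (beta (Suc i) j) (sroot m i) = -1"
    using assms by (subst ip_sroot) (auto simp: beta_def head_index_def)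
  then show ?thesis using assms
    by (auto simp: srefl_def ladd_def lsmul_def beta_def sroot_def)
qed

lemma foldr_srefl_beta:
  "1 \<le> i \<Longrightarrow> i \<le> j \<Longrightarrow> j \<le> m \<Longrightarrow> foldr (srefl m) [i..<j] (sroot m j) = beta i j"
proof (induction "j - i" arbitrary: i)
  case 0
  then have "j = i" by simp
  then show ?case using 0 beta_self[of i m] by simp
next
  case (Suc d)
  then have "foldr (srefl m) [Suc i..<j] (sroot m j) = beta (Suc i) j" by simp
  moreover have "[i..<j] = i # [Suc i..<j]" using Suc by (simp add: upt_conv_Cons)
  ultimately show ?case using srefl_beta[of i j m] Suc by simp
qed

context generic_q
begin

lemma T_simps:
  "T m q i (a + b) = T m q i a + T m q i b" "T m q i (a - b) = T m q i a - T m q i b"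
  "T m q i (- a) = - T m q i a" "T m q i (a * b) = T m q i a * T m q i b" "T m q i (sc c) = sc c"
  "T m q i (gen g) = T_gen m q i g"
  by (simp_all add: T_def ext_free_simps)

lemma foldr_T_simps:
  "foldr (T m q) is (a - b) = foldr (T m q) is a - foldr (T m q) is b"
  "foldr (T m q) is (- a) = - foldr (T m q) is a"
  "foldr (T m q) is (a * b) = foldr (T m q) is a * foldr (T m q) is b"
  "foldr (T m q) is (sc c) = sc c"
  by (induction "is") (simp_all add: T_simps)

lemma foldr_T_qcomm: "foldr (T m q) is (qcomm q a b) = qcomm q (foldr (T m q) is a) (foldr (T m q) is b)"
  by (simp add: qcomm_def foldr_T_simps)

lemma T_E_adj:
  assumes "i \<le> m" "j \<le> m" "i \<noteq> j" "head_index m i = Suc j \<or> head_index m j = Suc i"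
  shows "T m q i (gen (E j)) = qcomm q (gen (E i)) (gen (E j))"
  using assms m2 by (simp add: T_simps T_gen_def ip_sroot_sroot qcomm_def)

lemma T_E_far:
  assumes "i \<le> m" "j \<le> m" "i \<noteq> j" "\<not> (head_index m i = Suc j \<or> head_index m j = Suc i)"
  shows "T m q i (gen (E j)) = gen (E j)" "T m q i (gen (F j)) = gen (F j)"
  using assms m2 by (simp_all add: T_simps T_gen_def ip_sroot_sroot)

lemma foldr_T_E_far:
  assumes "\<And>i. i \<in> set is \<Longrightarrow> i \<le> m \<and> i \<noteq> j \<and> \<not> (head_index m i = Suc j \<or> head_index m j = Suc i)" "j \<le> m"
  shows "foldr (T m q) is (gen (E j)) = gen (E j)" "foldr (T m q) is (gen (F j)) = gen (F j)"
  using assms by (induction "is") (simp_all add: T_E_far)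

text \<open>This and the similar expansions below hold in the free algebra: T_l creates the bracket
  and the remaining maps fix \<open>E (Suc l)\<close>.\<close>

lemma foldr_T_E_Suc:
  assumes "1 \<le> i" "i \<le> l" "l < m"
  shows "foldr (T m q) [i..<Suc l] (gen (E (Suc l)))
    = qcomm q (foldr (T m q) [i..<l] (gen (E l))) (gen (E (Suc l)))"
proof -
  have "foldr (T m q) [i..<Suc l] (gen (E (Suc l))) = foldr (T m q) [i..<l] (qcomm q (gen (E l)) (gen (E (Suc l))))"
    using assms by (simp add: T_E_adj head_index_def)
  also have "\<dots> = qcomm q (foldr (T m q) [i..<l] (gen (E l))) (gen (E (Suc l)))"
    using assms by (subst foldr_T_qcomm, subst foldr_T_E_far(1)[of _ "Suc l"]) (auto simp: head_index_def)
  finally show ?thesis .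
qed

lemma foldr_T_xr: "1 \<le> l \<Longrightarrow> l \<le> m \<Longrightarrow> foldr (T m q) [1..<l] (gen (E l)) = xr l"
proof (induction l rule: nat_induct_at_least[of 1])
  case (Suc l)
  then show ?case using foldr_T_E_Suc[of 1 l] by (cases l) auto
qed simp

text \<open>The word starts at 2 because T_1 does not fix E_0; its contribution is the inner bracket
  added in \<open>foldr_T_E0\<close>.\<close>

lemma foldr_T_E0_ge2:
  assumes "2 \<le> i" "i \<le> m"
  shows "foldr (T m q) [i..<Suc m] (gen (E 0)) = qcomm q (foldr (T m q) [i..<m] (gen (E m))) (gen (E 0))"
proof -
  have "foldr (T m q) [i..<Suc m] (gen (E 0)) = foldr (T m q) [i..<m] (qcomm q (gen (E m)) (gen (E 0)))"
    using assms by (simp add: T_E_adj head_index_def)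
  also have "\<dots> = qcomm q (foldr (T m q) [i..<m] (gen (E m))) (gen (E 0))"
    using assms by (subst foldr_T_qcomm, subst foldr_T_E_far(1)[of _ 0]) (auto simp: head_index_def)
  finally show ?thesis .
qed

lemma foldr_T_E0: "foldr (T m q) [1..<Suc m] (gen (E 0)) = yr 1"
proof -
  have "[1..<Suc m] = 1 # [2..<Suc m]" using m2 by (simp add: upt_conv_Cons numeral_2_eq_2)
  moreover have "[1..<m] = 1 # [2..<m]" using m2 by (simp add: upt_conv_Cons numeral_2_eq_2)
  ultimately have "foldr (T m q) [1..<Suc m] (gen (E 0))
      = qcomm q (foldr (T m q) [1..<m] (gen (E m))) (T m q 1 (gen (E 0)))"
    using foldr_T_E0_ge2[of 2] foldr_T_qcomm[of "[1]"] m2 by simp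
  then show ?thesis using m2 foldr_T_xr[of m] by (simp add: T_E_adj head_index_def)
qed

text \<open>The negative root vector T_1 ... T_(j-1) F_j, opposite to x_j.\<close>

fun fr :: "nat \<Rightarrow> (ugen, 'k) freealg" where
  "fr 0 = 0"
| "fr (Suc 0) = gen (F 1)"
| "fr (Suc (Suc j)) = gen (F (Suc (Suc j))) * fr (Suc j) - sc q * fr (Suc j) * gen (F (Suc (Suc j)))"

lemma foldr_T_fr: "1 \<le> l \<Longrightarrow> l \<le> m \<Longrightarrow> foldr (T m q) [1..<l] (gen (F l)) = fr l"
proof (induction l rule: nat_induct_at_least[of 1])
  case (Suc l)
  have "foldr (T m q) [1..<Suc l] (gen (F (Suc l)))
    = foldr (T m q) [1..<l] (gen (F (Suc l)) * gen (F l) - sc q * gen (F l) * gen (F (Suc l)))"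
    using Suc m2 by (simp add: T_simps T_gen_def ip_sroot_sroot head_index_def)
  also have "\<dots> = gen (F (Suc l)) * fr l - sc q * fr l * gen (F (Suc l))"
    unfolding foldr_T_simps using Suc by (subst (1 2) foldr_T_E_far(2)) (auto simp: head_index_def)
  finally show ?case using Suc by (cases l) auto
qed simp

lemma foldr_T_K: "foldr (T m q) is (gen (K \<mu>)) = gen (K (foldr (srefl m) is \<mu>))"
  by (induction "is") (simp_all add: T_simps T_gen_def)

text \<open>T_(j+2), ..., T_m fix E_j and T_(j+1) turns it into [E_(j+1), E_j]. Then T_1 ... T_j
  makes x_(j+1) of the first entry, while T_j sends the second to - F_j K, which the remaining maps
  carry to the root \<open>beta 1 j\<close>.\<close>

lemma foldr_T_E:
  assumes "1 \<le> j" "j < m"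
  shows "foldr (T m q) [1..<Suc m] (gen (E j)) = qcomm q (xr (Suc j)) (- (fr j * gen (K (beta 1 j))))"
proof -
  have "[1..<Suc m] = [1..<Suc (Suc j)] @ [Suc (Suc j)..<Suc m]"
    using assms upt_add_eq_append[of 1 "Suc (Suc j)" "m - Suc j"] by simp
  then have "foldr (T m q) [1..<Suc m] (gen (E j)) = foldr (T m q) [1..<Suc (Suc j)] (gen (E j))"
    using assms by (simp only: foldr_append) (subst foldr_T_E_far(1)[of "[Suc (Suc j)..<Suc m]" j], auto simp: head_index_def)
  also have "\<dots> = foldr (T m q) [1..<Suc j] (qcomm q (gen (E (Suc j))) (gen (E j)))"
    using assms by (simp add: T_E_adj head_index_def)
  also have "\<dots> = qcomm q (xr (Suc j)) (foldr (T m q) [1..<Suc j] (gen (E j)))"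
    using assms foldr_T_xr[of "Suc j"] by (simp only: foldr_T_qcomm)
  also have "foldr (T m q) [1..<Suc j] (gen (E j)) = foldr (T m q) [1..<j] (- (gen (F j) * gen (K (sroot m j))))"
    using assms by (simp add: T_simps T_gen_def)
  also have "\<dots> = - (fr j * gen (K (beta 1 j)))"
    using assms by (simp only: foldr_T_simps foldr_T_fr foldr_T_K foldr_srefl_beta)
  finally show ?thesis .
qed

lemma foldr_T_nest:
  assumes "Suc j < m"
  shows "foldr (T m q) [0..<Suc j] (gen (E (Suc j))) = qcomm q (foldr (T m q) [0..<j] (gen (E j))) (gen (E (Suc j)))"
proof -
  have "foldr (T m q) [0..<Suc j] (gen (E (Suc j))) = foldr (T m q) [0..<j] (qcomm q (gen (E j)) (gen (E (Suc j))))"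
    using assms by (simp add: T_E_adj head_index_def)
  also have "\<dots> = qcomm q (foldr (T m q) [0..<j] (gen (E j))) (gen (E (Suc j)))"
    using assms by (subst foldr_T_qcomm, subst foldr_T_E_far(1)[of _ "Suc j"]) (auto simp: head_index_def)
  finally show ?thesis .
qed

lemma root_vec_low: "1 \<le> l \<Longrightarrow> l \<le> m \<Longrightarrow> root_vec m q l = xr l"
proof -
  assume l: "1 \<le> l" "l \<le> m"
  have "cword m ! (l - 1) = l"
    unfolding cword_def using l by (subst nth_append) (auto simp del: upt_Suc)
  moreover have "take (l - 1) (cword m) = [1..<l]" using l by (simp add: cword_def)
  ultimately show ?thesis using foldr_T_xr[OF l] by (simp add: root_vec_def)
qed

lemma root_vec_high:
  assumes "j < m"
  shows "root_vec m q (Suc (m + j)) = foldr (T m q) [1..<Suc m] (foldr (T m q) [0..<j] (gen (E j)))"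
  using assms by (simp add: root_vec_def cword_def nth_append del: upt_Suc)

section \<open>Images of the Chevalley generators under the first half of the word\<close>

definition ef :: "nat \<Rightarrow> (ugen, 'k) quot" where "ef j = U (fr j)"

lemma ef_1: "ef (Suc 0) = eF 1" by (simp add: ef_def eF_def)

lemma ef_Suc: "1 \<le> j \<Longrightarrow> ef (Suc j) = eF (Suc j) * ef j - qm (ef j * eF (Suc j))"
  by (cases j) (simp_all add: ef_def eF_def cls_op_simps)

lemma xxS: "1 \<le> j \<Longrightarrow> j < m \<Longrightarrow> A.xx (Suc j) = L.br (A.xx j) (eE (Suc j))"
  by (simp add: A.xx_Suc)

lemma xx1: "A.xx 1 = eE 1" using A.xx_1 m2 by simp

lemma ip_beta_Suc: "1 \<le> j \<Longrightarrow> j < m \<Longrightarrow> ip m \<mu> (beta 1 (Suc j)) = ip m \<mu> (beta 1 j) + ip m \<mu> (sroot m (Suc j))"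
  by (simp add: ip_beta' ip_sroot head_index_def)

lemma eK_xx:
  assumes \<mu>: "qlat m \<mu>"
  shows "1 \<le> j \<Longrightarrow> j \<le> m \<Longrightarrow> eK \<mu> * A.xx j = scq (q powi ip m \<mu> (beta 1 j)) (A.xx j * eK \<mu>)"
proof (induction j rule: nat_induct_at_least[of 1])
  case base
  then show ?case using eK_E[OF \<mu>, of 1] xx1 beta_self[of 1 m] by simp
next
  case (Suc j)
  then have 1: "eK \<mu> * A.xx j = scq (q powi ip m \<mu> (beta 1 j)) (A.xx j * eK \<mu>)" by simp
  have 2: "eK \<mu> * eE (Suc j) = scq (q powi ip m \<mu> (sroot m (Suc j))) (eE (Suc j) * eK \<mu>)"
    using eK_E[OF \<mu>, of "Suc j"] Suc by simp
  show ?case using Suc q0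
    by (simp add: xxS L.br_def right_diff_distrib left_diff_distrib mult.assoc 1 1[THEN L.mult_tail] 2 2[THEN L.mult_tail]
      scalar_op_simps[OF scalar_op_scq] scq_scq ip_beta_Suc[simplified] power_int_add mult_ac)
qed

lemma eK_ef:
  assumes \<mu>: "qlat m \<mu>"
  shows "1 \<le> j \<Longrightarrow> j \<le> m \<Longrightarrow> eK \<mu> * ef j = scq (q powi (- ip m \<mu> (beta 1 j))) (ef j * eK \<mu>)"
proof (induction j rule: nat_induct_at_least[of 1])
  case base
  then show ?case using eK_F[OF \<mu>, of 1] ef_1 beta_self[of 1 m] by simp
next
  case (Suc j)
  then have 1: "eK \<mu> * ef j = scq (q powi (- ip m \<mu> (beta 1 j))) (ef j * eK \<mu>)" by simp
  have 2: "eK \<mu> * eF (Suc j) = scq (q powi (- ip m \<mu> (sroot m (Suc j)))) (eF (Suc j) * eK \<mu>)"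
    using eK_F[OF \<mu>, of "Suc j"] Suc by simp
  define a b where "a = - ip m \<mu> (beta 1 j)" and "b = - ip m \<mu> (sroot m (Suc j))"
  have e: "- ip m \<mu> (beta 1 (Suc j)) = a + b"
    using ip_beta_Suc[of j \<mu>] Suc by (simp add: a_def b_def)
  note 1 = 1[folded a_def] and 2 = 2[folded b_def]
  show ?case unfolding e using Suc(1) q0
    by (simp add: ef_Suc right_diff_distrib left_diff_distrib mult.assoc 1 1[THEN L.mult_tail] 2 2[THEN L.mult_tail]
      scalar_op_simps[OF scalar_op_scq] scq_scq power_int_add mult_ac)
qed

lemma xx_F: "1 \<le> j \<Longrightarrow> j < k \<Longrightarrow> k \<le> m \<Longrightarrow> A.xx j * eF k = eF k * A.xx j"
proof (induction j rule: nat_induct_at_least[of 1])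
  case base
  then show ?case using eE_eF(1)[of 1 k] xx1 by simp
next
  case (Suc j)
  then have "eF k * L.br (A.xx j) (eE (Suc j)) = L.br (A.xx j) (eE (Suc j)) * eF k"
    using eE_eF(1)[of "Suc j" k] by (intro L.commute_br) auto
  then show ?case using Suc by (simp add: xxS)
qed

lemma E_ef: "1 \<le> j \<Longrightarrow> j < k \<Longrightarrow> k \<le> m \<Longrightarrow> eE k * ef j = ef j * eE k"
proof (induction j rule: nat_induct_at_least[of 1])
  case base
  then show ?case using eE_eF(1)[of k 1] ef_1 by simp
next
  case (Suc j)
  then have 1: "eE k * ef j = ef j * eE k" and 2: "eE k * eF (Suc j) = eF (Suc j) * eE k"
    using eE_eF(1)[of k "Suc j"] by auto
  show ?case using Suc by (simp add: ef_Suc algebra_simps 1 1[THEN L.mult_tail] 2 2[THEN L.mult_tail])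
qed

lemma eK_commute: "qlat m \<mu> \<Longrightarrow> qlat m \<nu> \<Longrightarrow> eK \<mu> * eK \<nu> = eK \<nu> * eK \<mu>"
  by (simp add: eK_add ladd_def add.commute)

lemma ip_lneg: "ip m (lneg \<mu>) \<nu> = - ip m \<mu> \<nu>"
  by (simp add: ip_def lneg_def sum_negf del: sum.cl_ivl_Suc)

context
  fixes j assumes j: "1 \<le> j" "j < m"
begin

text \<open>The facts are listed in the order of the hypotheses of \<open>br_EF_step\<close> and
  \<open>br_EF_final\<close>. The first is passed through because it is the induction hypothesis of
  \<open>xx_ef\<close>.\<close>

lemma EF_hyps:
  assumes "qm (A.xx j * ef j - ef j * A.xx j) - qi (A.xx j * ef j - ef j * A.xx j) = eK (beta 1 j) - eK (lneg (beta 1 j))"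
  shows "qm (A.xx j * ef j - ef j * A.xx j) - qi (A.xx j * ef j - ef j * A.xx j) = eK (beta 1 j) - eK (lneg (beta 1 j))"
    "qm (eE (Suc j) * eF (Suc j) - eF (Suc j) * eE (Suc j)) - qi (eE (Suc j) * eF (Suc j) - eF (Suc j) * eE (Suc j))
      = eK (sroot m (Suc j)) - eK (lneg (sroot m (Suc j)))"
    "A.xx j * eF (Suc j) = eF (Suc j) * A.xx j" "eE (Suc j) * ef j = ef j * eE (Suc j)"
    "eK (beta 1 j) * eE (Suc j) = qi (eE (Suc j) * eK (beta 1 j))"
    "eK (lneg (beta 1 j)) * eE (Suc j) = qm (eE (Suc j) * eK (lneg (beta 1 j)))"
    "eK (sroot m (Suc j)) * A.xx j = qi (A.xx j * eK (sroot m (Suc j)))"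
    "eK (lneg (sroot m (Suc j))) * A.xx j = qm (A.xx j * eK (lneg (sroot m (Suc j))))"
proof -
  note ql = qlat_beta[of j m] qlat_sroot[of "Suc j" m] qlat_lneg[OF qlat_beta[of j m]] qlat_lneg[OF qlat_sroot[of "Suc j" m]]
  have i1: "ip m (beta 1 j) (sroot m (Suc j)) = -1" using j by (simp add: ip_sroot head_index_def beta_def)
  have i2: "ip m (sroot m (Suc j)) (beta 1 j) = -1" using j ip_beta[of j m] by (simp add: sroot_pos head_index_def)
  show "eK (beta 1 j) * eE (Suc j) = qi (eE (Suc j) * eK (beta 1 j))"
    "eK (lneg (beta 1 j)) * eE (Suc j) = qm (eE (Suc j) * eK (lneg (beta 1 j)))"
    using eK_E[OF ql(1), of "Suc j"] eK_E[OF ql(3), of "Suc j"] j i1 by (simp_all add: ip_lneg power_int_minus)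
  show "eK (sroot m (Suc j)) * A.xx j = qi (A.xx j * eK (sroot m (Suc j)))"
    "eK (lneg (sroot m (Suc j))) * A.xx j = qm (A.xx j * eK (lneg (sroot m (Suc j))))"
    using eK_xx[OF ql(2), of j] eK_xx[OF ql(4), of j] j i2 by (simp_all add: ip_lneg power_int_minus)
qed (use assms j eE_eF(2)[of "Suc j" "Suc j"] xx_F[of j "Suc j"] E_ef[of j "Suc j"] in auto)

end

lemma xx_ef: "1 \<le> j \<Longrightarrow> j \<le> m \<Longrightarrow>
  qm (A.xx j * ef j - ef j * A.xx j) - qi (A.xx j * ef j - ef j * A.xx j) = eK (beta 1 j) - eK (lneg (beta 1 j))"
proof (induction j rule: nat_induct_at_least[of 1])
  case base
  then show ?case using eE_eF(2)[of 1 1] xx1 ef_1 beta_self[of 1 m] by simp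
next
  case (Suc j)
  then have j: "1 \<le> j" "j < m" by auto
  note ql = qlat_beta[of j m] qlat_sroot[of "Suc j" m] qlat_lneg[OF qlat_beta[of j m]] qlat_lneg[OF qlat_sroot[of "Suc j" m]]
  have i1: "ip m (beta 1 j) (sroot m (Suc j)) = -1" using j by (simp add: ip_sroot head_index_def beta_def)
  have i2: "ip m (sroot m (Suc j)) (beta 1 j) = -1" using j ip_beta[of j m] by (simp add: sroot_pos head_index_def)
  have Lf: "eK (sroot m (Suc j)) * ef j = qm (ef j * eK (sroot m (Suc j)))"
    using eK_ef[OF ql(2), of j] j i2 by simp
  have KF: "eK (lneg (beta 1 j)) * eF (Suc j) = qi (eF (Suc j) * eK (lneg (beta 1 j)))"
    using eK_F[OF ql(3), of "Suc j"] j i1 by (simp add: ip_lneg power_int_minus)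
  have LK: "eK (sroot m (Suc j)) * eK (lneg (beta 1 j)) = eK (lneg (beta 1 j)) * eK (sroot m (Suc j))"
    "eK (lneg (sroot m (Suc j))) * eK (lneg (beta 1 j)) = eK (lneg (beta 1 j)) * eK (lneg (sroot m (Suc j)))"
    using eK_commute ql j by auto
  have K: "eK (beta 1 j) * eK (sroot m (Suc j)) = eK (beta 1 (Suc j))"
    using eK_add ql j beta_add by auto
  have "ladd (lneg (beta 1 j)) (lneg (sroot m (Suc j))) = lneg (beta 1 (Suc j))"
    using j by (auto simp: ladd_def lneg_def fun_eq_iff beta_def sroot_def)
  then have K': "eK (lneg (beta 1 j)) * eK (lneg (sroot m (Suc j))) = eK (lneg (beta 1 (Suc j)))"
    using eK_add ql j by auto
  have "qm (A.xx j * ef j - ef j * A.xx j) - qi (A.xx j * ef j - ef j * A.xx j) = eK (beta 1 j) - eK (lneg (beta 1 j))"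
    using Suc by simp
  from L.br_EF_step[OF EF_hyps[OF j this] Lf KF LK ef_Suc[OF j(1)]]
  show ?case unfolding K K' xxS[OF j] .
qed

text \<open>The Coxeter element s_1 ... s_m maps alpha_j to alpha_(j+1), and the braid operators
  follow it: of all the root vector computations, this is the one that uses the relations of the
  quotient.\<close>

lemma U_foldr_T_E:
  assumes "1 \<le> j" "j < m" shows "U (foldr (T m q) [1..<Suc m] (gen (E j))) = eE (Suc j)"
proof -
  have "L.br (L.br (A.xx j) (eE (Suc j))) (- (ef j * eK (beta 1 j))) = eE (Suc j)"
  proof (rule L.br_EF_final[OF EF_hyps[OF assms xx_ef]])
    show "eK (beta 1 j) * A.xx j = qm (qm (A.xx j * eK (beta 1 j)))"
      using eK_xx[OF qlat_beta, of j j] assms ip_beta[of j m "beta 1 j"] by (simp add: beta_apply scq_scq power2_eq_square)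
    show "eE (Suc j) * (eK (lneg (beta 1 j)) * eK (beta 1 j)) = eE (Suc j)"
      using eE_eK_inv[OF qlat_beta] assms by simp
  qed (use assms in auto)
  then show ?thesis
    using assms U_xr[of "Suc j"]
    by (simp add: foldr_T_E U_qcomm cls_minus cls_mult ef_def eK_def xxS del: upt_Suc One_nat_def)
qed

text \<open>In the free algebra T_0 ... T_(j-1) E_j is a bracket with last entry E_j. Applying T_1
  ... T_m turns this entry into E_(j+1), which is the recursion of y.\<close>

lemma U_root_vec_high: "1 \<le> j \<Longrightarrow> j \<le> m \<Longrightarrow> U (root_vec m q (m + j)) = A.yy j"
proof (induction j rule: nat_induct_at_least[of 1])
  case base
  then show ?case using root_vec_high[of 0] foldr_T_E0 m2 U_yr[of 1] by simp
next
  case (Suc j)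
  then have "foldr (T m q) [0..<j] (gen (E j)) = qcomm q (foldr (T m q) [0..<j - 1] (gen (E (j - 1)))) (gen (E j))"
    using foldr_T_nest[of "j - 1"] by simp
  then have "U (root_vec m q (m + Suc j)) = L.br (U (root_vec m q (m + j))) (eE (Suc j))"
    using root_vec_high[of j] root_vec_high[of "j - 1"] Suc U_foldr_T_E[of j]
    by (simp add: foldr_T_qcomm U_qcomm del: upt_Suc)
  also have "\<dots> = A.yy (Suc j)" using Suc by (cases j) auto
  finally show ?case .
qed

end

section \<open>The cocycle twist\<close>

text \<open>Only the pair (0, 1) contributes; the coefficient of alpha_0 in mu is mu 0, and that of
  alpha_1 in nu is nu 0 + nu 1.\<close>

lemma gamma_eq:
  assumes "0 < m" shows "gamma m q \<mu> \<nu> = q powi (\<mu> 0 * (\<nu> 0 + \<nu> 1))"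
proof -
  have "gamma m q \<mu> \<nu> = (\<Prod>i\<in>{0..m}. if i = 0 then (\<Prod>j\<in>{0..m}. if j = 1 then q powi (acoeff \<mu> 0 * acoeff \<nu> 1) else 1) else 1)"
    unfolding gamma_def by (intro prod.cong refl) (auto intro!: prod.cong simp del: prod.delta)
  also have "\<dots> = q powi (acoeff \<mu> 0 * acoeff \<nu> 1)"
    using assms by (simp add: prod.delta)
  finally show ?thesis by (simp add: acoeff_def)
qed

lemma wdeg_plus: "wdeg m (w + v) = ladd (wdeg m w) (wdeg m v)"
proof -
  have "foldr ladd (map f (xs @ ys)) lzero = ladd (foldr ladd (map f xs) lzero) (foldr ladd (map f ys) lzero)"
    for f :: "ugen \<Rightarrow> lat" and xs ys
    by (induction xs) (simp_all add: ladd_def lzero_def add.assoc)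
  then show ?thesis by (simp add: wdeg_def plus_word_def)
qed

lemma wdeg_0 [simp]: "wdeg m 0 = lzero" by (simp add: wdeg_def zero_word_def)

text \<open>For a character chi of the root lattice this is the torus action dual to the grading. It
  is introduced to express twisted multiplication by a fixed word.\<close>

definition rescale :: "('g \<Rightarrow> 'k::comm_ring_1) \<Rightarrow> ('g, 'k) freealg \<Rightarrow> ('g, 'k) freealg" where
  "rescale \<chi> = ext_free (\<lambda>g. sc (\<chi> g) * gen g)"

lemma gen_sc: "gen g * (sc c * y) = sc c * (gen g * y)" "gen g * sc c = sc c * gen g"
  for c :: "'k::comm_ring_1"
  by (rule sc_left_commute, rule sc_commute)

lemma sc_sc_commute: "sc a * (sc b * y) = sc b * (sc a * y)" "sc a * sc b = sc b * sc a" for a :: "'k::comm_ring_1"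
  by (rule sc_left_commute, rule sc_commute)

lemma rescale_single: "rescale \<chi> (Poly_Mapping.single w c) = sc (prod_list (map \<chi> (letters w))) * Poly_Mapping.single w c"
proof -
  have "prod_list (map (\<lambda>g. sc (\<chi> g) * gen g) xs) = sc (prod_list (map \<chi> xs)) * prod_list (map gen xs)" for xs
    by (induction xs) (simp_all add: sc_mult mult.assoc gen_sc)
  then show ?thesis
    unfolding rescale_def ext_free_ev eval_hom.ev_single[OF eval_hom_sc]
    by (simp add: single_word[of w c] sc_sc_commute)
qed

lemmas rescale_simps = ext_free_simps[of "\<lambda>g. sc (\<chi> g) * gen g" for \<chi>, folded rescale_def]

text \<open>The two assumptions on chi are what makes it compatible with degrees, so every
  homogeneous relation is merely scaled. The mixed E, F relation forces the product condition, since
  it compares E_i F_i with group-like elements of degree 0.\<close>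

lemma rescale_U_rels:
  assumes K: "\<And>\<mu>. \<chi> (K \<mu>) = 1" and EF: "\<And>i. \<chi> (E i) * \<chi> (F i) = 1" and s: "s \<in> U_rels m q"
  shows "\<exists>c. rescale \<chi> s = sc c * s"
proof -
  note [simp] = rescale_simps K gen_sc sc_sc_commute sc_mult mult.assoc right_diff_distrib qcomm_def
  have EF': "sc (\<chi> (E i)) * sc (\<chi> (F i)) = 1" "sc (\<chi> (E i)) * (sc (\<chi> (F i)) * y) = y" for i y
    using EF[of i] by (simp_all flip: sc_mult mult.assoc)
  from s consider
      "s = gen (K lzero) - 1"
    | \<mu> \<nu> where "s = gen (K \<mu>) * gen (K \<nu>) - gen (K (ladd \<mu> \<nu>))"
    | \<mu> i where "s = gen (K \<mu>) * gen (E i) - sc (q powi ip m \<mu> (sroot m i)) * gen (E i) * gen (K \<mu>)"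
    | \<mu> i where "s = gen (K \<mu>) * gen (F i) - sc (q powi (- ip m \<mu> (sroot m i))) * gen (F i) * gen (K \<mu>)"
    | i j where "s = gen (E i) * gen (E j) - gen (E j) * gen (E i)"
    | i j where "s = gen (F i) * gen (F j) - gen (F j) * gen (F i)"
    | i j where "s = gen (E i) * qcomm q (gen (E i)) (gen (E j)) - sc q * qcomm q (gen (E i)) (gen (E j)) * gen (E i)"
    | i j where "s = gen (F i) * qcomm q (gen (F i)) (gen (F j)) - sc q * qcomm q (gen (F i)) (gen (F j)) * gen (F i)"
    | i j where "s = gen (E i) * gen (F j) - gen (F j) * gen (E i)
        - (if i = j then sc (inverse (qhat q)) * (gen (K (sroot m i)) - gen (K (lneg (sroot m i)))) else 0)"
    unfolding U_rels_def by (elim UnE CollectE exE conjE) blast+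
  then show ?thesis
  proof cases
    case 1 then show ?thesis by (intro exI[of _ 1]) simp
  next
    case (2 \<mu> \<nu>) then show ?thesis by (intro exI[of _ 1]) simp
  next
    case (3 \<mu> i) then show ?thesis by (intro exI[of _ "\<chi> (E i)"]) simp
  next
    case (4 \<mu> i) then show ?thesis by (intro exI[of _ "\<chi> (F i)"]) simp
  next
    case (5 i j) then show ?thesis by (intro exI[of _ "\<chi> (E i) * \<chi> (E j)"]) simp
  next
    case (6 i j) then show ?thesis by (intro exI[of _ "\<chi> (F i) * \<chi> (F j)"]) simp
  next
    case (7 i j) then show ?thesis
      by (intro exI[of _ "\<chi> (E i) * \<chi> (E i) * \<chi> (E j)"]) (simp add: left_diff_distrib)
  next
    case (8 i j) then show ?thesis
      by (intro exI[of _ "\<chi> (F i) * \<chi> (F i) * \<chi> (F j)"]) (simp add: left_diff_distrib)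
  next
    case (9 i j)
    show ?thesis
    proof (cases "i = j")
      case True
      then show ?thesis using 9 by (intro exI[of _ 1]) (simp add: EF')
    next
      case False
      then show ?thesis using 9 by (intro exI[of _ "\<chi> (E i) * \<chi> (F j)"]) simp
    qed
  qed
qed

lemma rescale_U_ideal:
  assumes "\<And>\<mu>. \<chi> (K \<mu>) = 1" "\<And>i. \<chi> (E i) * \<chi> (F i) = 1" "a \<in> ideal_gen (U_rels m q)"
  shows "rescale \<chi> a \<in> ideal_gen (U_rels m q)"
  unfolding rescale_def
proof (rule ideal_hom[OF _ assms(3)])
  fix s assume "s \<in> U_rels m q"
  then show "ext_free (\<lambda>g. sc (\<chi> g) * gen g) s \<in> ideal_gen (U_rels m q)"
    using rescale_U_rels[of \<chi> s m q, OF assms(1,2)] unfolding rescale_def[symmetric]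
    by (metis ideal_gen.base ideal_left)
qed

lemma mult_word_sum:
  "x * y = word_sum (\<lambda>w c. word_sum (\<lambda>v d. Poly_Mapping.single (w + v) (c * d)) y) x" for x y :: "('g, 'k::ring_1) freealg"
proof (induction x rule: freealg_induct)
  case (single w c)
  show ?case
  proof (subst word_sum_single)
    show "word_sum (\<lambda>v d. Poly_Mapping.single (w + v) (0 * d)) y = 0" by (simp add: word_sum_def)
    show "Poly_Mapping.single w c * y = word_sum (\<lambda>v d. Poly_Mapping.single (w + v) (c * d)) y"
    proof (induction y rule: freealg_induct)
      case (add p r)
      show ?case unfolding distrib_left add
        by (rule word_sum_add[symmetric]) (simp_all add: distrib_left single_add)
    qed (simp_all add: mult_single word_sum_single)
  qed
next
  case (add p r)
  show ?case unfolding distrib_right add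
    by (rule word_sum_add[symmetric]) (simp_all add: distrib_right single_add word_sum_def sum.distrib)
qed simp

section \<open>Homogeneous elements\<close>

definition homogeneous :: "nat \<Rightarrow> lat \<Rightarrow> (ugen, 'k::zero) freealg \<Rightarrow> bool" where
  "homogeneous m \<mu> p \<longleftrightarrow> (\<forall>w\<in>Poly_Mapping.keys p. wdeg m w = \<mu>)"

lemma homogeneous_mult: "homogeneous m \<mu> a \<Longrightarrow> homogeneous m \<nu> b \<Longrightarrow> homogeneous m (ladd \<mu> \<nu>) (a * b)" for a b :: "(ugen, 'k::ring_1) freealg"
  using keys_mult[of a b] unfolding homogeneous_def by (fastforce simp: wdeg_plus)

lemma homogeneous_diff: "homogeneous m \<mu> a \<Longrightarrow> homogeneous m \<mu> b \<Longrightarrow> homogeneous m \<mu> (a - b)" for a b :: "(ugen, 'k::ring_1) freealg"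
  unfolding homogeneous_def by (auto simp: in_keys_iff lookup_minus)

lemma homogeneous_sc: "homogeneous m lzero (sc c)"
  unfolding homogeneous_def sc_def by (auto split: if_splits)

lemma ladd_lzero [simp]: "ladd lzero \<mu> = \<mu>" "ladd \<mu> lzero = \<mu>"
  by (simp_all add: ladd_def lzero_def)

lemma ladd_commute: "ladd \<mu> \<nu> = ladd \<nu> \<mu>" by (auto simp: ladd_def)

lemma homogeneous_gen: "homogeneous m (ugdeg m g) (gen g)"
  by (auto simp: homogeneous_def gen_def wdeg_def split: if_splits)

lemma homogeneous_qcomm:
  assumes "homogeneous m \<mu> a" "homogeneous m \<nu> b" shows "homogeneous m (ladd \<mu> \<nu>) (qcomm q a b)"
proof -
  have "homogeneous m (ladd \<mu> \<nu>) (sc (inverse q) * b * a)"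
    using homogeneous_mult[OF homogeneous_mult[OF homogeneous_sc assms(2)] assms(1), of "inverse q"]
    by (simp add: ladd_commute[of \<nu>])
  then show ?thesis unfolding qcomm_def by (intro homogeneous_diff homogeneous_mult[OF assms])
qed

context generic_q
begin

abbreviation tw :: "(ugen, 'k) freealg \<Rightarrow> (ugen, 'k) freealg \<Rightarrow> (ugen, 'k) freealg" where
  "tw \<equiv> twprod m q"

abbreviation \<gamma> :: "lat \<Rightarrow> lat \<Rightarrow> 'k" where "\<gamma> \<equiv> gamma m q"

lemma gam_eq: "\<gamma> \<mu> \<nu> = q powi (\<mu> 0 * (\<nu> 0 + \<nu> 1))"
  using m2 by (intro gamma_eq) simp

lemma gam_ladd: "\<gamma> (ladd \<mu> \<nu>) \<kappa> = \<gamma> \<mu> \<kappa> * \<gamma> \<nu> \<kappa>" "\<gamma> \<kappa> (ladd \<mu> \<nu>) = \<gamma> \<kappa> \<mu> * \<gamma> \<kappa> \<nu>"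
  unfolding gam_eq ladd_def by (simp_all add: algebra_simps power_int_add q0)

lemma gam_lzero [simp]: "\<gamma> lzero \<kappa> = 1" "\<gamma> \<kappa> lzero = 1"
  unfolding gam_eq lzero_def by simp_all

lemma gam_0: "\<gamma> \<mu> \<nu> \<noteq> 0" unfolding gam_eq using q0 by simp

section \<open>The twisted product on the free algebra\<close>

lemma tw_word_sum: "tw x y = word_sum (\<lambda>w c. word_sum (\<lambda>v d. Poly_Mapping.single (w + v) (\<gamma> (wdeg m w) (wdeg m v) * c * d)) y) x"
  by (simp add: twprod_def word_sum_def)

lemma tw_add_left: "tw (x + y) z = tw x z + tw y z"
  unfolding tw_word_sum
  by (rule word_sum_add) (simp_all add: algebra_simps single_add word_sum_def sum.distrib)

lemma tw_add_right: "tw z (x + y) = tw z x + tw z y"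
  unfolding tw_word_sum word_sum_add_fun[symmetric]
  by (rule word_sum_cong, rule word_sum_add) (simp_all add: algebra_simps single_add)

lemmas tw_zero [simp] = additive_minus(1)[of "\<lambda>x. tw x z" for z, OF tw_add_left]
  additive_minus(1)[of "\<lambda>x. tw z x" for z, OF tw_add_right]

lemma tw_single: "tw (Poly_Mapping.single w c) (Poly_Mapping.single v d)
    = Poly_Mapping.single (w + v) (\<gamma> (wdeg m w) (wdeg m v) * c * d)"
  unfolding tw_word_sum by (simp add: word_sum_single word_sum_def)

lemma tw_assoc: "tw (tw x y) z = tw x (tw y z)"
proof (induction x rule: freealg_induct)
  case (single w c)
  show ?case
  proof (induction y rule: freealg_induct)
    case (single v d)
    show ?case
      by (induction z rule: freealg_induct)
        (simp_all add: tw_add_right tw_single wdeg_plus gam_ladd add.assoc mult_ac)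
  qed (simp_all add: tw_add_left tw_add_right)
qed (simp_all add: tw_add_left)

lemma tw_sc_left: "tw (sc c * x) y = sc c * tw x y"
proof (induction x rule: freealg_induct)
  case (single w d)
  show ?case
    by (induction y rule: freealg_induct)
      (simp_all add: tw_add_right tw_single sc_single distrib_left mult_ac)
qed (simp_all add: tw_add_left distrib_left)

lemma tw_sc_right: "tw x (sc c * y) = sc c * tw x y"
proof (induction x rule: freealg_induct)
  case (single w d)
  show ?case
    by (induction y rule: freealg_induct)
      (simp_all add: tw_add_right tw_single sc_single distrib_left mult_ac)
qed (simp_all add: tw_add_left distrib_left)

lemma tw_1: "tw 1 x = x" "tw x 1 = x"
proof -
  have "tw 1 (Poly_Mapping.single w c) = Poly_Mapping.single w c"
    "tw (Poly_Mapping.single w c) 1 = Poly_Mapping.single w c" for w c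
    using tw_single[of 0 1 w c] tw_single[of w c 0 1] by simp_all
  then show "tw 1 x = x" "tw x 1 = x"
    by (induction x rule: freealg_induct) (simp_all add: tw_add_right tw_add_left)
qed

lemma tw_homogeneous:
  assumes "homogeneous m \<mu> x" "homogeneous m \<nu> y" shows "tw x y = sc (\<gamma> \<mu> \<nu>) * (x * y)"
proof -
  have "tw x y = word_sum (\<lambda>w c. sc (\<gamma> \<mu> \<nu>) * word_sum (\<lambda>v d. Poly_Mapping.single (w + v) (c * d)) y) x"
    unfolding tw_word_sum
    by (rule word_sum_cong) (use assms in \<open>auto simp: word_sum_def homogeneous_def sum_distrib_left sc_single mult.assoc intro!: sum.cong\<close>)
  also have "\<dots> = sc (\<gamma> \<mu> \<nu>) * (x * y)"
    unfolding mult_word_sum[of x y] by (simp add: word_sum_def sum_distrib_left)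
  finally show ?thesis .
qed

lemma gam_prod_list:
  "prod_list (map (\<lambda>g. \<gamma> \<mu> (ugdeg m g)) (letters v)) = \<gamma> \<mu> (wdeg m v)"
  "prod_list (map (\<lambda>g. \<gamma> (ugdeg m g) \<mu>) (letters v)) = \<gamma> (wdeg m v) \<mu>"
proof -
  have "prod_list (map (\<lambda>g. \<gamma> \<mu> (ugdeg m g)) xs) = \<gamma> \<mu> (foldr ladd (map (ugdeg m) xs) lzero)"
    "prod_list (map (\<lambda>g. \<gamma> (ugdeg m g) \<mu>) xs) = \<gamma> (foldr ladd (map (ugdeg m) xs) lzero) \<mu>" for xs
    by (induction xs) (simp_all add: gam_ladd)
  then show "prod_list (map (\<lambda>g. \<gamma> \<mu> (ugdeg m g)) (letters v)) = \<gamma> \<mu> (wdeg m v)"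
    "prod_list (map (\<lambda>g. \<gamma> (ugdeg m g) \<mu>) (letters v)) = \<gamma> (wdeg m v) \<mu>"
    by (simp_all add: wdeg_def)
qed

text \<open>As \<open>gamma\<close> is a bicharacter, twisting by a fixed left factor w is ordinary
  multiplication after the torus action belonging to gamma (deg w, -). Stability of the ideal under
  that action therefore lets the twisted product descend to the quotient.\<close>

lemma tw_single_left:
  "tw (Poly_Mapping.single w c) y = Poly_Mapping.single w c * rescale (\<lambda>g. \<gamma> (wdeg m w) (ugdeg m g)) y"
  by (induction y rule: freealg_induct)
    (simp_all add: tw_add_right tw_single rescale_single rescale_simps distrib_left gam_prod_list sc_left_commute
      mult_single sc_single mult_ac)

lemma tw_single_right:
  "tw x (Poly_Mapping.single v c) = rescale (\<lambda>g. \<gamma> (ugdeg m g) (wdeg m v)) x * Poly_Mapping.single v c"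
  by (induction x rule: freealg_induct)
    (simp_all add: tw_add_left tw_single rescale_single rescale_simps distrib_right gam_prod_list mult.assoc
      mult_single sc_single)

lemma gam_character:
  "\<gamma> \<mu> (ugdeg m (K \<nu>)) = 1" "\<gamma> (ugdeg m (K \<nu>)) \<mu> = 1"
  "\<gamma> \<mu> (ugdeg m (E i)) * \<gamma> \<mu> (ugdeg m (F i)) = 1" "\<gamma> (ugdeg m (E i)) \<mu> * \<gamma> (ugdeg m (F i)) \<mu> = 1"
proof -
  have "ladd (sroot m i) (lneg (sroot m i)) = lzero" by (auto simp: ladd_def lneg_def lzero_def)
  then show "\<gamma> \<mu> (ugdeg m (E i)) * \<gamma> \<mu> (ugdeg m (F i)) = 1" "\<gamma> (ugdeg m (E i)) \<mu> * \<gamma> (ugdeg m (F i)) \<mu> = 1"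
    by (simp_all flip: gam_ladd)
qed simp_all

lemma tw_ideal_right: "y \<in> U_ideal m q \<Longrightarrow> tw x y \<in> U_ideal m q"
  unfolding U_ideal_def
proof (induction x rule: freealg_induct)
  case (single w c)
  then show ?case unfolding tw_single_left
    by (intro ideal_left rescale_U_ideal) (simp_all only: gam_character)
qed (simp_all add: ideal_gen.zero tw_add_left ideal_gen.add)

lemma tw_ideal_left: "x \<in> U_ideal m q \<Longrightarrow> tw x y \<in> U_ideal m q"
  unfolding U_ideal_def
proof (induction y rule: freealg_induct)
  case (single w c)
  then show ?case unfolding tw_single_right
    by (intro ideal_right rescale_U_ideal) (simp_all only: gam_character)
qed (simp_all add: ideal_gen.zero tw_add_right ideal_gen.add)

end

section \<open>The isomorphism on representatives\<close>

definition beta_delta :: "nat \<Rightarrow> lat" where "beta_delta j = (\<lambda>k. if k = 0 then 1 else beta 1 j k)"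

lemma free_on_add: "free_on G a \<Longrightarrow> free_on G b \<Longrightarrow> free_on G (a + b)"
  using keys_add[of a b] unfolding free_on_def by blast

lemma free_on_diff: "free_on G a \<Longrightarrow> free_on G b \<Longrightarrow> free_on G (a - b)"
  unfolding free_on_def by (metis in_keys_iff lookup_minus right_minus_eq)

lemma free_on_single: "set (letters w) \<subseteq> G \<Longrightarrow> free_on G (Poly_Mapping.single w c)"
  unfolding free_on_def by (auto split: if_splits)

lemma free_on_0: "free_on G 0" by (simp add: free_on_def)

lemma free_on_sum: "(\<And>i. i \<in> A \<Longrightarrow> free_on G (f i)) \<Longrightarrow> free_on G (sum f A)"
  by (induction A rule: infinite_finite_induct) (auto intro: free_on_0 free_on_add)

lemma free_on_sc: "free_on G (sc c)" unfolding sc_def by (rule free_on_single) (simp add: zero_word_def)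

lemma free_on_gen: "g \<in> G \<Longrightarrow> free_on G (gen g)" unfolding gen_def by (rule free_on_single) simp

context generic_q
begin

lemma homogeneous_xr: "1 \<le> j \<Longrightarrow> j \<le> m \<Longrightarrow> homogeneous m (beta 1 j) (xr j)"
proof (induction j rule: xr.induct)
  case 2
  then show ?case using homogeneous_gen[of m "E 1"] beta_self[of 1 m] by simp
next
  case (3 j)
  then show ?case
    using homogeneous_qcomm[OF _ homogeneous_gen[of m "E (Suc (Suc j))"], of "beta 1 (Suc j)" "xr (Suc j)" q]
      beta_add[of "Suc j" m] by simp
qed simp

lemma homogeneous_yr: "1 \<le> j \<Longrightarrow> j \<le> m \<Longrightarrow> homogeneous m (beta_delta j) (yr j)"
proof (induction j rule: yr.induct)
  case 2
  have "ladd (beta 1 m) (ladd (sroot m 1) (sroot m 0)) = beta_delta 1"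
    using m2 by (auto simp: ladd_def beta_def sroot_def beta_delta_def fun_eq_iff)
  then show ?case
    using homogeneous_qcomm[OF homogeneous_xr[of m] homogeneous_qcomm[OF homogeneous_gen[of m "E 1"] homogeneous_gen[of m "E 0"]], of q q] m2 by simp
next
  case (3 j)
  have "ladd (beta_delta (Suc j)) (sroot m (Suc (Suc j))) = beta_delta (Suc (Suc j))"
    by (auto simp: ladd_def beta_def sroot_def beta_delta_def fun_eq_iff)
  then show ?case using 3
    homogeneous_qcomm[OF _ homogeneous_gen[of m "E (Suc (Suc j))"], of "beta_delta (Suc j)" "yr (Suc j)" q] by simp
qed simp

fun root_rep :: "ogen \<Rightarrow> (ugen, 'k) freealg" where "root_rep (X i j) = (if i = 1 then xr j else yr j)"
fun odeg :: "ogen \<Rightarrow> lat" where "odeg (X i j) = (if i = 1 then beta 1 j else beta_delta j)"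

lemma homogeneous_root_rep: "g \<in> ogens m \<Longrightarrow> homogeneous m (odeg g) (root_rep g)"
  using homogeneous_xr homogeneous_yr by (cases g) (auto simp: ogens_def)

fun twisted_word :: "ogen list \<Rightarrow> (ugen, 'k) freealg" where
  "twisted_word [] = 1"
| "twisted_word (g # gs) = tw (root_rep g) (twisted_word gs)"

text \<open>Each word goes to the twisted product of its root vectors, so that multiplicativity
  holds on representatives and only the relations remain to be checked.\<close>

definition \<Phi> :: "(ogen, 'k) freealg \<Rightarrow> (ugen, 'k) freealg" where
  "\<Phi> = word_sum (\<lambda>w c. sc c * twisted_word (letters w))"

lemma twisted_word_append: "twisted_word (xs @ ys) = tw (twisted_word xs) (twisted_word ys)"
  by (induction xs) (simp_all add: tw_1 tw_assoc)

lemma \<Phi>_add: "\<Phi> (a + b) = \<Phi> a + \<Phi> b"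
  unfolding \<Phi>_def by (rule word_sum_add) (simp_all add: sc_add distrib_right)

lemmas \<Phi>_minus = additive_minus[of \<Phi>, OF \<Phi>_add]

lemma \<Phi>_single: "\<Phi> (Poly_Mapping.single w c) = sc c * twisted_word (letters w)"
  unfolding \<Phi>_def by (simp add: word_sum_single)

lemma \<Phi>_mult: "\<Phi> (a * b) = tw (\<Phi> a) (\<Phi> b)"
proof (induction a rule: freealg_induct)
  case (single w c)
  show ?case
    by (induction b rule: freealg_induct)
      (simp_all add: \<Phi>_minus(1) \<Phi>_add distrib_left tw_add_right mult_single \<Phi>_single
        plus_word_def twisted_word_append tw_sc_left tw_sc_right sc_mult mult.assoc sc_sc_commute)
qed (simp_all add: \<Phi>_minus(1) \<Phi>_add distrib_right tw_add_left)

lemma \<Phi>_sc: "\<Phi> (sc c) = sc c" by (simp add: sc_def[of c] \<Phi>_single zero_word_def flip: sc_def)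

lemma \<Phi>_1: "\<Phi> 1 = 1" using \<Phi>_sc[of 1] by simp

lemma tw_sc: "tw (sc c) x = sc c * x" using tw_sc_left[of c 1 x] tw_1 by simp

lemma \<Phi>_sc_mult: "\<Phi> (sc c * a) = sc c * \<Phi> a" by (simp add: \<Phi>_mult \<Phi>_sc tw_sc)

lemma \<Phi>_gen: "\<Phi> (gen g) = root_rep g" by (simp add: gen_def \<Phi>_single tw_1)

lemma U_zero_iff: "a \<in> U_ideal m q \<longleftrightarrow> U a = 0"
  using cls_eq_iff[of "U_rels m q" a 0] by (simp add: cls_0 U_ideal_def)

text \<open>The first argument enters through its delta coordinate, which is 0 for x and 1 for y;
  the second through the sum of its coordinates 0 and 1, which is 1 for x and 2 for y.\<close>

lemma \<gamma>_values:
  "\<gamma> (beta 1 j) \<mu> = 1" "1 \<le> l \<Longrightarrow> \<gamma> (beta_delta j) (beta 1 l) = q" "1 \<le> l \<Longrightarrow> \<gamma> (beta_delta j) (beta_delta l) = q * q"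
  unfolding gam_eq by (auto simp: beta_def beta_delta_def power2_eq_square)

lemma tw_values:
  assumes "1 \<le> j" "j \<le> m" "1 \<le> l" "l \<le> m"
  shows "tw (xr j) (xr l) = xr j * xr l" "tw (xr j) (yr l) = xr j * yr l"
    "tw (yr j) (xr l) = sc q * (yr j * xr l)" "tw (yr j) (yr l) = sc q * (sc q * (yr j * yr l))"
  using assms
  by (simp_all only: tw_homogeneous[OF homogeneous_xr homogeneous_xr] tw_homogeneous[OF homogeneous_xr homogeneous_yr] tw_homogeneous[OF homogeneous_yr homogeneous_xr]
    tw_homogeneous[OF homogeneous_yr homogeneous_yr] \<gamma>_values sc_1 mult_1 sc_mult mult.assoc)

text \<open>In the image each product y x acquires a factor q: the coefficient q of the same-column
  relation becomes q^2, and the coefficient 1 of the relations between different columns becomes q,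
  as the chain pair requires. Products of two y acquire q^2 on both sides.\<close>

lemma \<Phi>_O_rels:
  assumes "s \<in> O_rels m q" shows "\<Phi> s \<in> U_ideal m q"
proof -
  note S = U_zero_iff \<Phi>_minus(3) \<Phi>_mult \<Phi>_sc tw_sc \<Phi>_gen tw_sc_left tw_values cls_diff cls_sc U_xr U_yr
  from assms consider
      i j l where "s = gen (X i j) * gen (X i l) - sc q * gen (X i l) * gen (X i j)" "i \<in> {1, 2}" "1 \<le> j" "j < l" "l \<le> m"
    | j where "s = gen (X 1 j) * gen (X 2 j) - sc q * gen (X 2 j) * gen (X 1 j)" "1 \<le> j" "j \<le> m"
    | j l where "s = gen (X 1 l) * gen (X 2 j) - gen (X 2 j) * gen (X 1 l)" "1 \<le> j" "j < l" "l \<le> m"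
    | j l where "s = gen (X 1 j) * gen (X 2 l) - gen (X 2 l) * gen (X 1 j) - sc (qhat q) * gen (X 1 l) * gen (X 2 j)"
        "1 \<le> j" "j < l" "l \<le> m"
    unfolding O_rels_def by (elim UnE CollectE exE conjE) blast+
  then show ?thesis
  proof cases
    case (1 i j l)
    have "U (xr j * xr l) = qm (U (xr l * xr j))" "U (yr j * yr l) = qm (U (yr l * yr j))"
      using 1 A.xx_quad[of j l] A.yy_quad[of j l] by (simp_all add: U_xr U_yr cls_mult)
    then show ?thesis using 1 by (auto simp: S)
  next
    case (2 j)
    have "U (xr j * yr j) = qm (qm (U (yr j * xr j)))"
      using 2 A.xy.diag[of j] by (simp add: U_xr U_yr cls_mult)
    then show ?thesis using 2 by (simp add: S)
  next
    case (3 j l)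
    have "U (xr l * yr j) = qm (U (yr j * xr l))"
      using 3 A.xy.lower[of j l] by (simp add: U_xr U_yr cls_mult)
    then show ?thesis using 3 by (simp add: S)
  next
    case (4 j l)
    have "U (xr j * yr l) - qm (U (yr l * xr j)) = scq (qhat q) (U (xr l * yr j))"
      using 4 A.xy.upper[of j l] by (simp add: U_xr U_yr cls_mult qhat_def scq_diff_left)
    then show ?thesis using 4 by (simp add: S)
  qed
qed

lemma \<Phi>_O_ideal: "a \<in> O_ideal m q \<Longrightarrow> \<Phi> a \<in> U_ideal m q"
  unfolding O_ideal_def
proof (induction rule: ideal_gen.induct)
  case zero
  then show ?case by (simp add: \<Phi>_minus(1) U_ideal_def ideal_gen.zero)
next
  case (base s)
  then show ?case by (rule \<Phi>_O_rels)
next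
  case (add a b)
  then show ?case by (simp add: \<Phi>_add U_ideal_def ideal_gen.add)
next
  case (mult a x y)
  then show ?case by (simp add: \<Phi>_mult tw_ideal_left tw_ideal_right)
qed

section \<open>Twisted against ordinary products, and the image\<close>

definition list_deg :: "ogen list \<Rightarrow> lat" where "list_deg gs = foldr ladd (map odeg gs) lzero"

lemma homogeneous_twisted_word: "set gs \<subseteq> ogens m \<Longrightarrow> homogeneous m (list_deg gs) (twisted_word gs)"
proof (induction gs)
  case Nil
  then show ?case using homogeneous_sc[of m 1] by (simp add: list_deg_def)
next
  case (Cons g gs)
  then have g: "homogeneous m (odeg g) (root_rep g)" and gs: "homogeneous m (list_deg gs) (twisted_word gs)" by (auto intro: homogeneous_root_rep)
  have "list_deg (g # gs) = ladd (odeg g) (list_deg gs)" by (simp add: list_deg_def)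
  then show ?case using tw_homogeneous[OF g gs] homogeneous_mult[OF homogeneous_sc homogeneous_mult[OF g gs]] by simp
qed

lemma twisted_word_prod:
  "set gs \<subseteq> ogens m \<Longrightarrow> \<exists>c. c \<noteq> 0 \<and> twisted_word gs = sc c * prod_list (map root_rep gs)"
proof (induction gs)
  case Nil
  then show ?case by (intro exI[of _ 1]) simp
next
  case (Cons g gs)
  then obtain c where c: "c \<noteq> 0" "twisted_word gs = sc c * prod_list (map root_rep gs)" by auto
  have "twisted_word (g # gs) = sc (\<gamma> (odeg g) (list_deg gs)) * (root_rep g * twisted_word gs)"
    using tw_homogeneous[OF homogeneous_root_rep homogeneous_twisted_word, of g gs] Cons by simp
  also have "\<dots> = sc (\<gamma> (odeg g) (list_deg gs) * c) * prod_list (map root_rep (g # gs))"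
    using c(2) by (simp add: sc_mult mult.assoc sc_left_commute[of "root_rep g"])
  finally show ?case using c(1) gam_0 by (intro exI conjI) auto
qed

text \<open>The subalgebra generated by the root vectors is closed under the untwisted product, so
  for surjectivity the image has to be as well. The cocycle is divided out for each pair of words,
  since a and b may mix degrees.\<close>

lemma \<Phi>_image_mult:
  assumes "free_on (ogens m) a" "free_on (ogens m) b"
  shows "\<exists>d. free_on (ogens m) d \<and> \<Phi> d = \<Phi> a * \<Phi> b"
proof -
  let ?f = "\<lambda>w v. Poly_Mapping.single (w + v)
    (inverse (\<gamma> (list_deg (letters w)) (list_deg (letters v))) * Poly_Mapping.lookup a w * Poly_Mapping.lookup b v)"
  let ?d = "\<Sum>w\<in>Poly_Mapping.keys a. \<Sum>v\<in>Poly_Mapping.keys b. ?f w v"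
  have \<Phi>_sum: "\<Phi> (sum g S) = (\<Sum>i\<in>S. \<Phi> (g i))" for g :: "'z \<Rightarrow> _" and S
    by (induction S rule: infinite_finite_induct) (simp_all add: \<Phi>_minus(1) \<Phi>_add)
  have f: "\<Phi> (?f w v) = sc (Poly_Mapping.lookup a w) * twisted_word (letters w) * (sc (Poly_Mapping.lookup b v) * twisted_word (letters v))"
    if "w \<in> Poly_Mapping.keys a" "v \<in> Poly_Mapping.keys b" for w v
  proof -
    have wv: "set (letters w) \<subseteq> ogens m" "set (letters v) \<subseteq> ogens m"
      using that assms by (auto simp: free_on_def)
    let ?g = "\<gamma> (list_deg (letters w)) (list_deg (letters v))"
    have "twisted_word (letters w @ letters v) = sc ?g * (twisted_word (letters w) * twisted_word (letters v))"
      unfolding twisted_word_append using tw_homogeneous[OF homogeneous_twisted_word homogeneous_twisted_word] wv by blast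
    moreover have "sc (inverse ?g) * (sc ?g * y) = y" for y :: "(ugen, 'k) freealg"
      using gam_0 by (simp flip: mult.assoc sc_mult)
    ultimately show ?thesis
      by (simp add: \<Phi>_single plus_word_def sc_mult mult.assoc sc_left_commute[of "twisted_word _"]
        sc_left_commute[of "sc (inverse _)"])
  qed
  have "\<Phi> ?d = \<Phi> a * \<Phi> b"
    unfolding \<Phi>_sum sum_product \<Phi>_def[THEN fun_cong, of a] \<Phi>_def[THEN fun_cong, of b] word_sum_def
    by (intro sum.cong refl) (simp add: f)
  moreover have "free_on (ogens m) ?d"
    using assms by (intro free_on_sum free_on_single) (auto simp: free_on_def plus_word_def)
  ultimately show ?thesis by blast
qed

lemma U_root_rep_root:
  assumes "g \<in> ogens m"
  obtains l where "1 \<le> l" "l \<le> 2 * m" "root_rep g - root_vec m q l \<in> U_ideal m q"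
proof -
  from assms obtain i j where g: "g = X i j" "i \<in> {1, 2}" "1 \<le> j" "j \<le> m" by (auto simp: ogens_def)
  show ?thesis
  proof (cases "i = 1")
    case True
    then show ?thesis using that[of j] g root_vec_low[of j] by (simp add: U_ideal_def ideal_gen.zero)
  next
    case False
    then show ?thesis using that[of "m + j"] g U_root_vec_high[of j] U_yr[of j]
      by (simp add: U_zero_iff cls_diff)
  qed
qed

lemma \<Phi>_in_DCKP:
  assumes "free_on (ogens m) a" shows "\<exists>d\<in>DCKP m q. \<Phi> a - d \<in> U_ideal m q"
proof -
  let ?G = "\<lambda>p. \<exists>d\<in>DCKP m q. p - d \<in> U_ideal m q"
  have G_sc: "?G (sc c)" for c
    by (rule bexI[OF _ DCKP.scalar[of c]]) (simp add: U_ideal_def ideal_gen.zero)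
  have G_mult: "?G (p * r)" if p: "?G p" and r: "?G r" for p r
  proof -
    from p r obtain d e where "d \<in> DCKP m q" "p - d \<in> U_ideal m q" "e \<in> DCKP m q" "r - e \<in> U_ideal m q" by auto
    then show ?thesis
      using mult_diff_ideal[of p d "U_rels m q" r e] DCKP.mult[of d m q e] unfolding U_ideal_def by blast
  qed
  have G_add: "?G (p + r)" if p: "?G p" and r: "?G r" for p r
  proof -
    from p r obtain d e where "d \<in> DCKP m q" "p - d \<in> U_ideal m q" "e \<in> DCKP m q" "r - e \<in> U_ideal m q" by auto
    moreover from this have "p + r - (d + e) \<in> U_ideal m q"
      unfolding U_ideal_def using ideal_gen.add[of "p - d" _ "r - e"] by (simp add: algebra_simps)
    ultimately show ?thesis using DCKP.add by blast
  qed
  have G_prod: "?G (prod_list (map root_rep gs))" if "set gs \<subseteq> ogens m" for gs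
    using that
  proof (induction gs)
    case (Cons g gs)
    then obtain l where "1 \<le> l" "l \<le> 2 * m" "root_rep g - root_vec m q l \<in> U_ideal m q"
      using U_root_rep_root[of g] by auto
    then have "?G (root_rep g)" using DCKP.root by blast
    then show ?case using G_mult[of "root_rep g"] Cons by simp
  qed (use G_sc[of 1] in simp)
  have G_word: "?G (sc (Poly_Mapping.lookup a w) * twisted_word (letters w))" if "w \<in> Poly_Mapping.keys a" for w
  proof -
    have w: "set (letters w) \<subseteq> ogens m" using that assms by (auto simp: free_on_def)
    then obtain c where "twisted_word (letters w) = sc c * prod_list (map root_rep (letters w))" using twisted_word_prod by blast
    then show ?thesis using G_mult G_sc G_prod[OF w] by simp
  qed
  have "?G (\<Sum>w\<in>A. sc (Poly_Mapping.lookup a w) * twisted_word (letters w))" if "finite A" "A \<subseteq> Poly_Mapping.keys a" for A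
    using that by (induction A rule: finite_induct) (use G_add G_word G_sc[of 0] in auto)
  from this[of "Poly_Mapping.keys a"] show ?thesis by (simp add: \<Phi>_def word_sum_def)
qed

lemma DCKP_in_\<Phi>:
  "d \<in> DCKP m q \<Longrightarrow> \<exists>a. free_on (ogens m) a \<and> \<Phi> a - d \<in> U_ideal m q"
proof (induction rule: DCKP.induct)
  case (scalar c)
  show ?case by (rule exI[of _ "sc c"]) (simp add: free_on_sc \<Phi>_sc U_ideal_def ideal_gen.zero)
next
  case (root l)
  show ?case
  proof (cases "l \<le> m")
    case True
    then show ?thesis using root root_vec_low[of l]
      by (intro exI[of _ "gen (X 1 l)"]) (auto simp: \<Phi>_gen U_ideal_def ideal_gen.zero ogens_def intro!: free_on_gen)
  next
    case False
    then have "1 \<le> l - m" "l - m \<le> m" "m + (l - m) = l" using root by auto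
    then show ?thesis using U_root_vec_high[of "l - m"] U_yr[of "l - m"]
      by (intro exI[of _ "gen (X 2 (l - m))"]) (auto simp: \<Phi>_gen U_zero_iff cls_diff ogens_def intro!: free_on_gen)
  qed
next
  case (add d e)
  then obtain a b where ab: "free_on (ogens m) a" "\<Phi> a - d \<in> U_ideal m q" "free_on (ogens m) b" "\<Phi> b - e \<in> U_ideal m q"
    by auto
  then have "\<Phi> (a + b) - (d + e) \<in> U_ideal m q"
    unfolding U_ideal_def \<Phi>_add using ideal_gen.add[of "\<Phi> a - d" _ "\<Phi> b - e"] by (simp add: algebra_simps)
  then show ?case using free_on_add[OF ab(1,3)] by blast
next
  case (mult d e)
  then obtain a b where ab: "free_on (ogens m) a" "\<Phi> a - d \<in> U_ideal m q" "free_on (ogens m) b" "\<Phi> b - e \<in> U_ideal m q"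
    by auto
  then obtain c where "free_on (ogens m) c" "\<Phi> c = \<Phi> a * \<Phi> b" using \<Phi>_image_mult by blast
  then show ?case using mult_diff_ideal[of "\<Phi> a" d "U_rels m q" "\<Phi> b" e] ab unfolding U_ideal_def by auto
qed

end

section \<open>A representation by two q-oscillators\<close>

typedef (overloaded) ('b, 'k::field) linop = "{f :: ('b \<Rightarrow> 'k) \<Rightarrow> ('b \<Rightarrow> 'k).
    (\<forall>x y. f (\<lambda>p. x p + y p) = (\<lambda>p. f x p + f y p)) \<and> (\<forall>c x. f (\<lambda>p. c * x p) = (\<lambda>p. c * f x p))}"
  by (rule exI[of _ id]) simp

setup_lifting type_definition_linop

instantiation linop :: (type, field) ring_1
begin

lift_definition zero_linop :: "('a, 'b) linop" is "\<lambda>x p. 0" by simp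
lift_definition one_linop :: "('a, 'b) linop" is "\<lambda>x. x" by simp
lift_definition plus_linop :: "('a, 'b) linop \<Rightarrow> ('a, 'b) linop \<Rightarrow> ('a, 'b) linop" is "\<lambda>f g x p. f x p + g x p"
  by (simp add: algebra_simps)
lift_definition minus_linop :: "('a, 'b) linop \<Rightarrow> ('a, 'b) linop \<Rightarrow> ('a, 'b) linop" is "\<lambda>f g x p. f x p - g x p"
  by (simp add: algebra_simps)
lift_definition uminus_linop :: "('a, 'b) linop \<Rightarrow> ('a, 'b) linop" is "\<lambda>f x p. - f x p"
  by (simp add: algebra_simps)
lift_definition times_linop :: "('a, 'b) linop \<Rightarrow> ('a, 'b) linop \<Rightarrow> ('a, 'b) linop" is "\<lambda>f g x. f (g x)"
  by simp

instance
proof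
  show "(0 :: ('a, 'b) linop) \<noteq> 1"
    by transfer (metis zero_neq_one)
qed (transfer; simp add: algebra_simps fun_eq_iff)+

end

lift_definition linop_apply :: "('b, 'k::field) linop \<Rightarrow> ('b \<Rightarrow> 'k) \<Rightarrow> 'b \<Rightarrow> 'k" is "\<lambda>f. f" .

section \<open>Weighted shifts\<close>

lift_definition W :: "('b::ab_group_add \<Rightarrow> 'k::field) \<Rightarrow> 'b \<Rightarrow> ('b, 'k) linop" is
  "\<lambda>\<phi> t f p. \<phi> p * f (p + t)"
  by (simp add: algebra_simps)

lemma linop_apply_simps: "linop_apply 0 f p = 0" "linop_apply 1 f = f" "linop_apply (a + b) f p = linop_apply a f p + linop_apply b f p"
  "linop_apply (a - b) f p = linop_apply a f p - linop_apply b f p" "linop_apply (- a) f p = - linop_apply a f p"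
  "linop_apply (a * b) f = linop_apply a (linop_apply b f)" "linop_apply (W \<phi> t) f p = \<phi> p * f (p + t)"
  by (transfer, simp)+

lemma W_mult: "W \<phi> s * W \<psi> t = W (\<lambda>p. \<phi> p * \<psi> (p + s)) (s + t)"
  by transfer (simp add: add.assoc mult.assoc)
lemma W_add: "W \<phi> s + W \<psi> s = W (\<lambda>p. \<phi> p + \<psi> p) s" by transfer (simp add: algebra_simps)
lemma W_diff: "W \<phi> s - W \<psi> s = W (\<lambda>p. \<phi> p - \<psi> p) s" by transfer (simp add: algebra_simps)
lemma W_1: "1 = W (\<lambda>_. 1) 0" by transfer simp
lemma W_0: "W (\<lambda>_. 0) t = 0" by transfer simp
lemma W_cong: "(\<And>p. \<phi> p = \<psi> p) \<Longrightarrow> s = t \<Longrightarrow> W \<phi> s = W \<psi> t" by (metis ext)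

lemma W_cong_pair:
  fixes \<phi> \<psi> :: "'a::ab_group_add \<times> 'b::ab_group_add \<Rightarrow> 'k::field"
  shows "(\<And>n p. \<phi> (n, p) = \<psi> (n, p)) \<Longrightarrow> s = t \<Longrightarrow> W \<phi> s = W \<psi> t"
  by (rule W_cong) auto

definition \<sigma> :: "'k::field \<Rightarrow> ('b::ab_group_add, 'k) linop" where "\<sigma> c = W (\<lambda>_. c) 0"

lemma \<sigma>_W: "\<sigma> c * W \<phi> t = W (\<lambda>p. c * \<phi> p) t" by (simp add: \<sigma>_def W_mult)

lemma \<sigma>_simps: "\<sigma> (a + b) = \<sigma> a + \<sigma> b" "\<sigma> (a * b) = \<sigma> a * \<sigma> b" "\<sigma> 1 = 1" "\<sigma> 0 = 0" "\<sigma> (a - b) = \<sigma> a - \<sigma> b"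
  by (simp_all add: \<sigma>_def W_add W_diff W_mult W_1 W_0)

lemma \<sigma>_comm: "x * \<sigma> c = \<sigma> c * x" unfolding \<sigma>_def by transfer auto

lemma scalar_op_\<sigma>: "scalar_op (\<lambda>x. \<sigma> c * x)"
  unfolding scalar_op_def by (metis distrib_left mult.assoc \<sigma>_comm)

lemma \<sigma>_cancel:
  assumes "c \<noteq> 0" "\<sigma> c * x = 0" shows "x = 0"
proof -
  have "\<sigma> (inverse c) * (\<sigma> c * x) = \<sigma> 1 * x" using assms(1) by (simp add: \<sigma>_simps(2)[symmetric] flip: mult.assoc)
  then show ?thesis using assms(2) by (simp add: \<sigma>_simps)
qed

lemma ip_add: "ip m \<mu> (\<nu> + \<nu>') = ip m \<mu> \<nu> + ip m \<mu> \<nu>'"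
  by (simp add: ip_def distrib_left sum.distrib del: sum.cl_ivl_Suc)

lemma ip_minus: "ip m \<mu> (- \<nu>) = - ip m \<mu> \<nu>"
  by (simp add: ip_def sum_negf del: sum.cl_ivl_Suc)

lemma ip_diff: "ip m \<mu> (\<nu> - \<nu>') = ip m \<mu> \<nu> - ip m \<mu> \<nu>'"
  using ip_add[of m \<mu> "\<nu> - \<nu>'" \<nu>'] by simp

lemma ip_0: "ip m \<mu> 0 = 0" by (simp add: ip_def)

lemma ip_sym: "ip m \<mu> \<nu> = ip m \<nu> \<mu>" by (simp add: ip_def mult.commute)

type_synonym bilat = "lat \<times> lat"

context generic_q
begin

abbreviation lm :: "(bilat, 'k) linop \<Rightarrow> (bilat, 'k) linop" where "lm x \<equiv> \<sigma> q * x"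
abbreviation li :: "(bilat, 'k) linop \<Rightarrow> (bilat, 'k) linop" where "li x \<equiv> \<sigma> (inverse q) * x"

lemma laurent_linop: "laurent_alg lm li"
proof
  have *: "\<sigma> a * (\<sigma> b * x) = \<sigma> (a * b) * x" for a b :: 'k and x :: "(bilat, 'k) linop"
    by (simp add: \<sigma>_simps mult.assoc)
  show "lm (li x) = x" "li (lm x) = x" for x
    by (simp_all only: *) (simp_all add: q0 \<sigma>_simps)
  show "x = 0" if "lm x + li x = 0" for x
    using \<sigma>_cancel[OF q2_0, of x] that by (simp add: \<sigma>_simps distrib_right)
  show "x = 0" if "lm (lm x) + x + li (li x) = 0" for x
    using \<sigma>_cancel[OF q3_0, of x] that by (simp only: *) (simp add: \<sigma>_simps distrib_right)
  show "x = 0" if "lm x - li x = 0" for x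
    using \<sigma>_cancel[OF qhat0, of x] that by (simp add: \<sigma>_simps left_diff_distrib)
qed (rule scalar_op_\<sigma>)+

sublocale R: laurent_alg lm li by (rule laurent_linop)

section \<open>Identities of q-integers\<close>

definition qn :: "int \<Rightarrow> 'k" where "qn x = (q powi x - q powi (- x)) / (q - inverse q)"

lemma qn_3: "qn (a + 2) + qn a = (q + inverse q) * qn (a + 1)"
proof -
  have "q powi (a + 2) - q powi (- (a + 2)) + (q powi a - q powi (- a))
      = (q + inverse q) * (q powi (a + 1) - q powi (- (a + 1)))"
    using q0 by (simp add: power_int_add power_int_diff power_int_minus field_simps power2_eq_square)
  then show ?thesis unfolding qn_def by (simp only: add_divide_distrib[symmetric] times_divide_eq_right)
qed

lemma qn_step: "qn (a + 1) - inverse q * qn a = q powi a"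
proof -
  have "q powi (a + 1) - q powi (- (a + 1)) - inverse q * (q powi a - q powi (- a)) = q powi a * (q - inverse q)"
    using q0 by (simp add: power_int_add power_int_diff power_int_minus field_simps)
  then have "qn (a + 1) - inverse q * qn a = q powi a * (q - inverse q) / (q - inverse q)"
    unfolding qn_def by (simp only: diff_divide_distrib[symmetric] times_divide_eq_right)
  then show ?thesis using qhat0 by simp
qed

lemma qn_step': "qn a - inverse q * qn (a + 1) = - (q powi (- a - 1))"
proof -
  have "q powi a - q powi (- a) - inverse q * (q powi (a + 1) - q powi (- (a + 1))) = - (q powi (- a - 1)) * (q - inverse q)"
    using q0 by (simp add: power_int_add power_int_diff power_int_minus field_simps)
  then have "qn a - inverse q * qn (a + 1) = - (q powi (- a - 1)) * (q - inverse q) / (q - inverse q)"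
    unfolding qn_def by (simp only: diff_divide_distrib[symmetric] times_divide_eq_right)
  then show ?thesis using qhat0 by simp
qed

lemma qn_comm: "qn (s + 1) * qn t - qn (t + 1) * qn s = qn (t - s)"
proof -
  let ?f = "\<lambda>x. q powi x - q powi (- x)"
  have "?f (s + 1) * ?f t - ?f (t + 1) * ?f s = ?f (t - s) * (q - inverse q)"
    using q0 by (simp add: power_int_add power_int_diff power_int_minus field_simps)
  then have "qn (s + 1) * qn t - qn (t + 1) * qn s = ?f (t - s) * (q - inverse q) / ((q - inverse q) * (q - inverse q))"
    unfolding qn_def by (simp only: diff_divide_distrib[symmetric] times_divide_times_eq)
  then show ?thesis using qhat0 by (simp add: qn_def)
qed

lemma qn_K: "qn a * q powi (- b) + q powi a * qn b = inverse (q - inverse q) * (q powi (a + b) - q powi (- a - b))"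
proof -
  have "(q powi a - q powi (- a)) * q powi (- b) + q powi a * (q powi b - q powi (- b)) = q powi (a + b) - q powi (- a - b)"
    using q0 by (simp add: power_int_add power_int_diff power_int_minus field_simps)
  from arg_cong[OF this, of "\<lambda>t. inverse (q - inverse q) * t"] show ?thesis
    unfolding qn_def divide_inverse by (simp only: distrib_left mult_ac)
qed

lemma qn_0: assumes "0 < x" shows "qn x \<noteq> 0"
proof
  assume "qn x = 0"
  then have "q powi x = q powi (- x)" using qhat0 by (simp add: qn_def)
  then have "q powi x * q powi x = q powi x * q powi (- x)" by simp
  also have "\<dots> = q powi (x + - x)" by (rule power_int_add[symmetric]) (use q0 in simp)
  finally have "q powi x * q powi x = 1" by simp
  then have "q powi (x + x) = 1" using power_int_add[of q x x] q0 by metis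
  then have "q ^ nat (x + x) = 1" using assms by (simp add: power_int_def)
  then show False using q_power[of "nat (x + x)"] assms by simp
qed

lemma serre_W:
  assumes "\<And>p. \<phi> p * \<phi> (p + s) * \<psi> (p + s + s) + \<psi> p * \<phi> (p + t) * \<phi> (p + t + s)
     = (q + inverse q) * (\<phi> p * \<psi> (p + s) * \<phi> (p + s + t))"
  shows "R.serre (W \<phi> s) (W \<psi> t)"
  unfolding R.serre_def W_mult \<sigma>_W
  using assms by (simp add: add_ac W_add mult.assoc distrib_right)

text \<open>The numbers u and v record how each of two neighbouring shifts changes the coordinate
  read by the other: exactly one of them lowers it by 1. Two q-integers are then common to all three
  terms, and what remains is \<open>qn_3\<close>.\<close>

lemma serre_qn:
  assumes "(u, v) = (-1, 0) \<or> (u, v) = (0, -1 :: int)"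
  shows "qn (a + 1) * qn (a + 2) * qn (b + 1 + 2 * u) + qn (b + 1) * qn (a + 1 + v) * qn (a + 2 + v)
    = (q + inverse q) * (qn (a + 1) * qn (b + 1 + u) * qn (a + 2 + v))"
  using assms
proof
  assume "(u, v) = (-1, 0)"
  then show ?thesis using arg_cong[OF qn_3[of "b - 1"], of "\<lambda>t. qn (a + 1) * qn (a + 2) * t"]
    by (simp add: algebra_simps)
next
  assume "(u, v) = (0, -1)"
  then show ?thesis using arg_cong[OF qn_3[of a], of "\<lambda>t. qn (a + 1) * qn (b + 1) * t"]
    by (simp add: algebra_simps)
qed

definition osc1 :: "(lat \<Rightarrow> 'k) \<Rightarrow> nat \<Rightarrow> lat \<Rightarrow> (bilat, 'k) linop" where
  "osc1 c x s = W (\<lambda>(n, p). qn (n x + 1) * c p) (s, 0)"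

definition osc2 :: "(lat \<Rightarrow> 'k) \<Rightarrow> nat \<Rightarrow> lat \<Rightarrow> (bilat, 'k) linop" where
  "osc2 c x s = W (\<lambda>(n, p). qn (p x + 1) * c n) (0, s)"

lemma osc_serre:
  assumes "s x = 1" "t y = 1" "(s y, t x) = (-1, 0) \<or> (s y, t x) = (0, -1)"
  shows "R.serre (osc1 c x s) (osc1 d y t)" "R.serre (osc2 c x s) (osc2 d y t)"
proof -
  have *: "qn (a x + 1) * C * (qn (a x + s x + 1) * C) * (qn (a y + s y + s y + 1) * D)
      + qn (a y + 1) * D * (qn (a x + t x + 1) * C) * (qn (a x + t x + s x + 1) * C)
    = (q + inverse q) * (qn (a x + 1) * C * (qn (a y + s y + 1) * D) * (qn (a x + s x + t x + 1) * C))"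
    for a :: lat and C D
  proof -
    have e: "a x + s x + 1 = a x + 2" "a y + s y + s y + 1 = a y + 1 + 2 * s y" "a x + t x + 1 = a x + 1 + t x"
      "a x + t x + s x + 1 = a x + 2 + t x" "a y + s y + 1 = a y + 1 + s y" "a x + s x + t x + 1 = a x + 2 + t x"
      using assms by auto
    show ?thesis unfolding e using arg_cong[OF serre_qn[OF assms(3), of "a x" "a y"], of "\<lambda>t. t * (C * C * D)"]
      by (simp only: distrib_right) (simp only: mult_ac)
  qed
  show "R.serre (osc1 c x s) (osc1 d y t)" unfolding osc1_def
    by (rule serre_W) (use * in \<open>auto simp: case_prod_beta\<close>)
  show "R.serre (osc2 c x s) (osc2 d y t)" unfolding osc2_def
    by (rule serre_W) (use * in \<open>auto simp: case_prod_beta\<close>)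
qed

lemma osc_commute:
  assumes "s y = 0" "t x = 0"
  shows "osc1 c x s * osc1 d y t = osc1 d y t * osc1 c x s" "osc2 c x s * osc2 d y t = osc2 d y t * osc2 c x s"
  unfolding osc1_def osc2_def W_mult using assms by (auto intro!: W_cong simp: add.commute)

text \<open>In a q-oscillator E_i moves one quantum from coordinate i + 1 to
  \<open>head_index m i\<close> with amplitude [n_(i+1)], and F_i moves one back. On coefficient
  functions the amplitude is read at the source of the move, hence the added 1. The operators A1, A2
  are E \<otimes> 1, K \<otimes> E, and B1, B2 are F \<otimes> K^-1, 1 \<otimes> F; coordinate 0
  counts delta.\<close>

definition A1 :: "nat \<Rightarrow> (bilat, 'k) linop" where "A1 i = osc1 (\<lambda>_. 1) (Suc i) (- sroot m i)"
definition A2 :: "nat \<Rightarrow> (bilat, 'k) linop" where "A2 i = osc2 (\<lambda>n. q powi ip m (sroot m i) n) (Suc i) (- sroot m i)"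
definition B1 :: "nat \<Rightarrow> (bilat, 'k) linop" where "B1 i = osc1 (\<lambda>p. q powi (- ip m (sroot m i) p)) (head_index m i) (sroot m i)"
definition B2 :: "nat \<Rightarrow> (bilat, 'k) linop" where "B2 i = osc2 (\<lambda>_. 1) (head_index m i) (sroot m i)"
definition KK :: "lat \<Rightarrow> (bilat, 'k) linop" where "KK \<mu> = W (\<lambda>(n, p). q powi (ip m \<mu> n + ip m \<mu> p)) 0"

lemma A2_A1: "A2 i * A1 j = \<sigma> (q powi ip m (sroot m i) (sroot m j)) * (A1 j * A2 i)"
  unfolding A1_def A2_def osc1_def osc2_def W_mult \<sigma>_W
  by (rule W_cong) (auto simp: ip_add ip_diff ip_minus power_int_add power_int_diff q0 field_simps)

lemma B1_B2: "B1 i * B2 j = \<sigma> (q powi ip m (sroot m i) (sroot m j)) * (B2 j * B1 i)"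
  unfolding B1_def B2_def osc1_def osc2_def W_mult \<sigma>_W
  by (rule W_cong) (auto simp: ip_add ip_diff ip_minus power_int_add power_int_diff power_int_minus q0 field_simps)

lemma A1_B2: "A1 i * B2 j = B2 j * A1 i"
  unfolding A1_def B2_def osc1_def osc2_def W_mult by (rule W_cong) auto

lemma A2_B1: "A2 i * B1 j = B1 j * A2 i"
  unfolding A2_def B1_def osc1_def osc2_def W_mult
  by (rule W_cong) (auto simp: ip_add ip_diff ip_minus ip_sym[of m "sroot m j" "sroot m i"] power_int_add power_int_diff power_int_minus q0 field_simps)

lemma sroot_at: "i \<le> m \<Longrightarrow> j \<le> m \<Longrightarrow> sroot m i (Suc j) = (if i = j then -1 else if head_index m i = Suc j then 1 else 0)"
  "i \<le> m \<Longrightarrow> j \<le> m \<Longrightarrow> sroot m i (head_index m j) = (if i = j then 1 else if head_index m j = Suc i then -1 else 0)"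
  using m2 by (auto simp: sroot_pos head_index_def)

lemma AB_same:
  assumes "i \<le> m"
  shows "A1 i * B1 i - B1 i * A1 i = W (\<lambda>(n, p). qn (ip m (sroot m i) n) * q powi (- ip m (sroot m i) p)) 0"
    "A2 i * B2 i - B2 i * A2 i = W (\<lambda>(n, p). q powi (ip m (sroot m i) n) * qn (ip m (sroot m i) p)) 0"
proof -
  have ip: "ip m (sroot m i) n = n (head_index m i) - n (Suc i)" for n
    using ip_sroot[of i m n] assms m2 by (simp add: ip_sym[of m "sroot m i"])
  have *: "qn (n (head_index m i)) * qn (1 + n (Suc i)) - qn (1 + n (head_index m i)) * qn (n (Suc i)) = qn (ip m (sroot m i) n)" for n :: lat
    using qn_comm[of "n (Suc i)" "n (head_index m i)"] unfolding ip by (simp add: algebra_simps)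
  show "A1 i * B1 i - B1 i * A1 i = W (\<lambda>(n, p). qn (ip m (sroot m i) n) * q powi (- ip m (sroot m i) p)) 0"
    unfolding A1_def B1_def osc1_def W_mult *[symmetric]
    by (simp add: W_diff) (rule W_cong, auto simp: sroot_at assms algebra_simps zero_prod_def)
  show "A2 i * B2 i - B2 i * A2 i = W (\<lambda>(n, p). q powi (ip m (sroot m i) n) * qn (ip m (sroot m i) p)) 0"
    unfolding A2_def B2_def osc2_def W_mult *[symmetric]
    by (simp add: W_diff) (rule W_cong, auto simp: sroot_at assms algebra_simps zero_prod_def)
qed

lemma AB_diff:
  assumes "i \<le> m" "j \<le> m" "i \<noteq> j"
  shows "A1 i * B1 j = B1 j * A1 i" "A2 i * B2 j = B2 j * A2 i"
proof -
  have "(head_index m j = Suc i \<and> sroot m j (Suc i) = 1 \<and> sroot m i (head_index m j) = -1)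
     \<or> (sroot m j (Suc i) = 0 \<and> sroot m i (head_index m j) = 0)"
    using assms by (auto simp: sroot_at)
  then show "A1 i * B1 j = B1 j * A1 i" "A2 i * B2 j = B2 j * A2 i"
    unfolding A1_def B1_def A2_def B2_def osc1_def osc2_def W_mult
    by (auto intro!: W_cong)
qed

text \<open>The summands of F are ordered with \<open>B2\<close> first because
  \<open>serre_coproduct\<close> wants the second summand to pick up q^2 when it passes the
  first.\<close>

fun rep_gen :: "ugen \<Rightarrow> (bilat, 'k) linop" where
  "rep_gen (E i) = A1 i + A2 i"
| "rep_gen (F i) = B2 i + B1 i"
| "rep_gen (K \<mu>) = KK \<mu>"

lemma eval_rep_gen: "eval_hom \<sigma> rep_gen"
  by unfold_locales (simp_all add: \<sigma>_simps, rule \<sigma>_comm)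

sublocale rho: eval_hom \<sigma> rep_gen by (rule eval_rep_gen)

abbreviation \<rho> :: "(ugen, 'k) freealg \<Rightarrow> (bilat, 'k) linop" where "\<rho> \<equiv> ev \<sigma> rep_gen"

section \<open>Verification of the defining relations\<close>

lemma serre_rep_gen:
  assumes "i \<le> m" "j \<le> m" "ip m (sroot m i) (sroot m j) = -1"
  shows "R.serre (rep_gen (E i)) (rep_gen (E j))" "R.serre (rep_gen (F i)) (rep_gen (F j))"
proof -
  have adj: "i \<noteq> j" "head_index m i = Suc j \<or> head_index m j = Suc i" "\<not> (head_index m i = Suc j \<and> head_index m j = Suc i)"
    using assms m2 by (auto simp: ip_sroot_sroot head_index_def split: if_splits)
  have ii: "ip m (sroot m i) (sroot m i) = 2" using assms m2 by (simp add: ip_sroot_sroot)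
  have ji: "ip m (sroot m j) (sroot m i) = -1" using assms by (simp add: ip_sym)
  have "q powi 2 = q * q" by (simp add: power2_eq_square)
  then have sq: "\<sigma> (q powi 2) * x = lm (lm x)" for x by (simp only: \<sigma>_simps(2) mult.assoc)
  show "R.serre (rep_gen (E i)) (rep_gen (E j))" unfolding rep_gen.simps
  proof (rule R.serre_coproduct)
    show "R.serre (A1 i) (A1 j)" "R.serre (A2 i) (A2 j)" unfolding A1_def A2_def
      by (rule osc_serre; use assms adj in \<open>auto simp: sroot_at\<close>)+
  qed (simp_all only: A2_A1 ii ji assms(3) sq, simp_all add: power_int_minus)
  show "R.serre (rep_gen (F i)) (rep_gen (F j))" unfolding rep_gen.simps
  proof (rule R.serre_coproduct)
    show "R.serre (B2 i) (B2 j)" "R.serre (B1 i) (B1 j)" unfolding B1_def B2_def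
      by (rule osc_serre; use assms adj in \<open>auto simp: sroot_at\<close>)+
  qed (simp_all only: B1_B2 ii ji assms(3) sq, simp_all add: power_int_minus)
qed

lemma commute_rep_gen:
  assumes "i \<le> m" "j \<le> m" "ip m (sroot m i) (sroot m j) \<in> {0, 2}"
  shows "rep_gen (E i) * rep_gen (E j) = rep_gen (E j) * rep_gen (E i)" "rep_gen (F i) * rep_gen (F j) = rep_gen (F j) * rep_gen (F i)"
proof (atomize(full), cases "i = j", simp)
  case False
  then have ip: "ip m (sroot m i) (sroot m j) = 0" "ip m (sroot m j) (sroot m i) = 0"
    using assms m2 by (auto simp: ip_sroot_sroot split: if_splits)
  have nadj: "\<not> (head_index m i = Suc j \<or> head_index m j = Suc i)" using ip(1) False assms m2
    by (simp add: ip_sroot_sroot split: if_splits)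
  have "A1 i * A1 j = A1 j * A1 i" "A2 i * A2 j = A2 j * A2 i" "B1 i * B1 j = B1 j * B1 i" "B2 i * B2 j = B2 j * B2 i"
    unfolding A1_def A2_def B1_def B2_def
    by (rule osc_commute; use assms nadj False in \<open>auto simp: sroot_at\<close>)+
  moreover have "A2 i * A1 j = A1 j * A2 i" "A2 j * A1 i = A1 i * A2 j" "B1 i * B2 j = B2 j * B1 i" "B1 j * B2 i = B2 i * B1 j"
    using ip by (simp_all add: A2_A1 B1_B2 \<sigma>_simps)
  ultimately show "rep_gen (E i) * rep_gen (E j) = rep_gen (E j) * rep_gen (E i) \<and> rep_gen (F i) * rep_gen (F j) = rep_gen (F j) * rep_gen (F i)"
    by (simp add: distrib_left distrib_right add_ac)
qed

lemma KK_E: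
  "KK \<mu> * rep_gen (E i) = \<sigma> (q powi ip m \<mu> (sroot m i)) * rep_gen (E i) * KK \<mu>"
  "KK \<mu> * rep_gen (F i) = \<sigma> (q powi (- ip m \<mu> (sroot m i))) * rep_gen (F i) * KK \<mu>"
proof -
  note d = KK_def A1_def A2_def B1_def B2_def osc1_def osc2_def W_mult \<sigma>_W mult.assoc
  have "KK \<mu> * A1 i = \<sigma> (q powi ip m \<mu> (sroot m i)) * (A1 i * KK \<mu>)"
    "KK \<mu> * A2 i = \<sigma> (q powi ip m \<mu> (sroot m i)) * (A2 i * KK \<mu>)"
    "KK \<mu> * B1 i = \<sigma> (q powi (- ip m \<mu> (sroot m i))) * (B1 i * KK \<mu>)"
    "KK \<mu> * B2 i = \<sigma> (q powi (- ip m \<mu> (sroot m i))) * (B2 i * KK \<mu>)"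
    unfolding d by (rule W_cong, (auto simp: ip_add ip_diff ip_minus ip_0 power_int_add power_int_diff power_int_minus q0 field_simps)[2])+
  then show "KK \<mu> * rep_gen (E i) = \<sigma> (q powi ip m \<mu> (sroot m i)) * rep_gen (E i) * KK \<mu>"
    "KK \<mu> * rep_gen (F i) = \<sigma> (q powi (- ip m \<mu> (sroot m i))) * rep_gen (F i) * KK \<mu>"
    by (simp_all add: distrib_left distrib_right mult.assoc)
qed

lemma EF_rep_gen:
  assumes "i \<le> m" "j \<le> m"
  shows "rep_gen (E i) * rep_gen (F j) - rep_gen (F j) * rep_gen (E i)
    = (if i = j then \<sigma> (inverse (qhat q)) * (KK (sroot m i) - KK (lneg (sroot m i))) else 0)"
proof -
  have "rep_gen (E i) * rep_gen (F j) - rep_gen (F j) * rep_gen (E i)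
    = (A1 i * B1 j - B1 j * A1 i) + (A2 i * B2 j - B2 j * A2 i)"
    by (simp add: distrib_left distrib_right A1_B2 A2_B1)
  also have "\<dots> = (if i = j then \<sigma> (inverse (qhat q)) * (KK (sroot m i) - KK (lneg (sroot m i))) else 0)"
  proof (cases "i = j")
    case True
    have "(A1 i * B1 i - B1 i * A1 i) + (A2 i * B2 i - B2 i * A2 i) = \<sigma> (inverse (qhat q)) * (KK (sroot m i) - KK (lneg (sroot m i)))"
      unfolding AB_same[OF assms(1)] KK_def W_diff W_add \<sigma>_W
      by (rule W_cong) (auto simp: qhat_def ip_lneg qn_K)
    then show ?thesis using True by simp
  next
    case False
    then show ?thesis using AB_diff[OF assms] by simp
  qed
  finally show ?thesis .
qed

lemma \<rho>_U_rels:
  assumes "s \<in> U_rels m q" shows "\<rho> s = 0"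
proof -
  note S = rho.ev_minus rho.ev_mult rho.ev_sc rho.ev_gen rho.ev_1 rep_gen.simps(3)
  have qc: "\<rho> (qcomm q a b) = R.br (\<rho> a) (\<rho> b)" for a b
    by (simp add: qcomm_def R.br_def S mult.assoc)
  from assms consider
      "s = gen (K lzero) - 1"
    | \<mu> \<nu> where "s = gen (K \<mu>) * gen (K \<nu>) - gen (K (ladd \<mu> \<nu>))"
    | \<mu> i where "s = gen (K \<mu>) * gen (E i) - sc (q powi ip m \<mu> (sroot m i)) * gen (E i) * gen (K \<mu>)"
    | \<mu> i where "s = gen (K \<mu>) * gen (F i) - sc (q powi (- ip m \<mu> (sroot m i))) * gen (F i) * gen (K \<mu>)"
    | i j where "s = gen (E i) * gen (E j) - gen (E j) * gen (E i)" "i \<le> m" "j \<le> m" "ip m (sroot m i) (sroot m j) \<in> {0, 2}"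
    | i j where "s = gen (F i) * gen (F j) - gen (F j) * gen (F i)" "i \<le> m" "j \<le> m" "ip m (sroot m i) (sroot m j) \<in> {0, 2}"
    | i j where "s = gen (E i) * qcomm q (gen (E i)) (gen (E j)) - sc q * qcomm q (gen (E i)) (gen (E j)) * gen (E i)"
        "i \<le> m" "j \<le> m" "ip m (sroot m i) (sroot m j) = -1"
    | i j where "s = gen (F i) * qcomm q (gen (F i)) (gen (F j)) - sc q * qcomm q (gen (F i)) (gen (F j)) * gen (F i)"
        "i \<le> m" "j \<le> m" "ip m (sroot m i) (sroot m j) = -1"
    | i j where "s = gen (E i) * gen (F j) - gen (F j) * gen (E i)
        - (if i = j then sc (inverse (qhat q)) * (gen (K (sroot m i)) - gen (K (lneg (sroot m i)))) else 0)" "i \<le> m" "j \<le> m"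
    unfolding U_rels_def by (elim UnE CollectE exE conjE) blast+
  then show ?thesis
  proof cases
    case 1
    have "KK lzero = 1" unfolding KK_def W_1 by (rule W_cong) (auto simp: ip_def lzero_def)
    then show ?thesis using 1 by (simp add: S)
  next
    case (2 \<mu> \<nu>)
    have ip: "ip m (ladd \<mu> \<nu>) n = ip m \<mu> n + ip m \<nu> n" for n
      by (simp add: ip_def ladd_def distrib_right sum.distrib del: sum.cl_ivl_Suc)
    have "KK \<mu> * KK \<nu> = KK (ladd \<mu> \<nu>)" unfolding KK_def W_mult
      by (rule W_cong) (auto simp: ip q0 power_int_add mult_ac)
    then show ?thesis using 2 by (simp add: S)
  next
    case (3 \<mu> i)
    then show ?thesis using KK_E(1)[of \<mu> i] by (simp add: S)
  next
    case (4 \<mu> i)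
    then show ?thesis using KK_E(2)[of \<mu> i] by (simp add: S)
  next
    case (5 i j)
    then show ?thesis using commute_rep_gen(1)[of i j] by (simp add: S)
  next
    case (6 i j)
    then show ?thesis using commute_rep_gen(2)[of i j] by (simp add: S)
  next
    case (7 i j)
    then show ?thesis using serre_rep_gen(1)[of i j] unfolding R.serre_iff_left by (simp add: S qc mult.assoc)
  next
    case (8 i j)
    then show ?thesis using serre_rep_gen(2)[of i j] unfolding R.serre_iff_left by (simp add: S qc mult.assoc)
  next
    case (9 i j)
    then show ?thesis using EF_rep_gen[of i j] by (simp add: S split: if_splits)
  qed
qed

lemma \<rho>_U_ideal: "a \<in> U_ideal m q \<Longrightarrow> \<rho> a = 0"
  unfolding U_ideal_def by (rule rho.ev_ideal) (rule \<rho>_U_rels)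

end

section \<open>Leading terms of the root vectors\<close>

context generic_q
begin

lemma beta_delta_apply: "beta_delta j k = (if k = 0 then 1 else beta 1 j k)" by (simp add: beta_delta_def)

text \<open>In the first factor E_i counts 1 for 2 <= i <= m, E_1 counts - m and E_0 counts m + 2;
  the second factor counts 0. So the first-factor part of x_j has weight j - m - 1 < 0 and is
  dominated by the second factor, whereas delta adds m + 1 and lifts that of y_j to j > 0.\<close>

definition coord_weight :: lat where "coord_weight k = (if k = 1 then 0 else int m + 2 - int k)"

text \<open>The filtration weight of a shift: it is negated because creation operators shift the argument
  of a function by the negative of their degree.\<close>
definition lam :: "bilat \<Rightarrow> int" where
  "lam t = - ((int m + 1) * fst t 0 + ip m coord_weight (fst t))"

lemma lam_add: "lam (s + t) = lam s + lam t"
  by (simp add: lam_def ip_add algebra_simps)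

lemma lam_0: "lam 0 = 0" by (simp add: lam_def ip_0)

lemma lam_values:
  "lam (0, t) = 0"
  "2 \<le> i \<Longrightarrow> i \<le> m \<Longrightarrow> lam (- sroot m i, 0) = 1"
  "lam (- sroot m 0, 0) = int m + 2"
  "lam (- sroot m 1, 0) = - int m"
  "1 \<le> j \<Longrightarrow> j \<le> m \<Longrightarrow> lam (- beta 1 j, 0) = int j - int m - 1"
  "1 \<le> j \<Longrightarrow> j \<le> m \<Longrightarrow> lam (- beta_delta j, 0) = int j"
proof -
  show "lam (0, t) = 0" by (simp add: lam_def ip_0)
  show "2 \<le> i \<Longrightarrow> i \<le> m \<Longrightarrow> lam (- sroot m i, 0) = 1"
    "lam (- sroot m 0, 0) = int m + 2" "lam (- sroot m 1, 0) = - int m"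
    using m2 by (simp_all add: lam_def ip_minus ip_sroot sroot_0 head_index_def coord_weight_def)
  show "1 \<le> j \<Longrightarrow> j \<le> m \<Longrightarrow> lam (- beta 1 j, 0) = int j - int m - 1"
    using ip_beta'[of j m coord_weight] by (simp add: lam_def ip_minus coord_weight_def beta_apply)
  have "ip m coord_weight (beta_delta j) = ip m coord_weight (beta 1 j)" by (auto simp: ip_def beta_delta_def intro!: sum.cong)
  then show "1 \<le> j \<Longrightarrow> j \<le> m \<Longrightarrow> lam (- beta_delta j, 0) = int j"
    using ip_beta'[of j m coord_weight] by (simp add: lam_def ip_minus coord_weight_def beta_delta_apply)
qed

text \<open>By linearity: R f at p depends only on the values of f at points of weight at most
  \<open>lam p + c\<close>. This bounds an operator without choosing an expansion into
  shifts.\<close>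

definition Fil :: "int \<Rightarrow> (bilat, 'k) linop set" where
  "Fil c = {R. \<forall>f p. (\<forall>p'. lam p' \<le> lam p + c \<longrightarrow> f p' = 0) \<longrightarrow> linop_apply R f p = 0}"

lemma Fil_W: "lam t \<le> c \<Longrightarrow> W \<phi> t \<in> Fil c"
  unfolding Fil_def mem_Collect_eq linop_apply_simps
  by (metis (no_types) add_left_mono lam_add mult_zero_right)

lemma Fil_add: "a \<in> Fil c \<Longrightarrow> b \<in> Fil c \<Longrightarrow> a + b \<in> Fil c"
  by (simp add: Fil_def linop_apply_simps)

lemma Fil_diff: "a \<in> Fil c \<Longrightarrow> b \<in> Fil c \<Longrightarrow> a - b \<in> Fil c"
  by (simp add: Fil_def linop_apply_simps)

lemma Fil_mono: "a \<in> Fil c \<Longrightarrow> c \<le> d \<Longrightarrow> a \<in> Fil d"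
  unfolding Fil_def by fastforce

lemma Fil_mult: "a \<in> Fil c \<Longrightarrow> b \<in> Fil d \<Longrightarrow> a * b \<in> Fil (c + d)"
  unfolding Fil_def by (simp add: linop_apply_simps)

lemma Fil_\<sigma>: "a \<in> Fil c \<Longrightarrow> \<sigma> s * a \<in> Fil c"
proof -
  have "\<sigma> s \<in> Fil 0" unfolding \<sigma>_def by (rule Fil_W) (simp add: lam_0)
  then show "a \<in> Fil c \<Longrightarrow> \<sigma> s * a \<in> Fil c" using Fil_mult[of "\<sigma> s" 0 a c] by simp
qed

lemma Fil_br: "a \<in> Fil c \<Longrightarrow> b \<in> Fil d \<Longrightarrow> c + d \<le> e \<Longrightarrow> R.br a b \<in> Fil e"
  unfolding R.br_def
  by (intro Fil_diff Fil_\<sigma>) (auto intro: Fil_mono[OF Fil_mult] simp: add.commute)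

lemma Fil_A1: "lam (- sroot m i, 0) \<le> c \<Longrightarrow> A1 i \<in> Fil c"
  unfolding A1_def osc1_def by (rule Fil_W)

lemma Fil_A2: "0 \<le> c \<Longrightarrow> A2 i \<in> Fil c"
  unfolding A2_def osc2_def by (rule Fil_W) (simp add: lam_values)

text \<open>The amplitude of x_j in a single oscillator. Each further bracket turns a factor [a + 1]
  into [a + 1] - q^-1 [a] = q^a, which is where the power of q comes from.\<close>

definition xr_coeff :: "nat \<Rightarrow> lat \<Rightarrow> 'k" where
  "xr_coeff j n = q powi (\<Sum>k=2..j. n k) * qn (n (Suc j) + 1)"

definition x1 :: "nat \<Rightarrow> (bilat, 'k) linop" where "x1 j = W (\<lambda>(n, p). xr_coeff j n) (- beta 1 j, 0)"
definition x2 :: "nat \<Rightarrow> (bilat, 'k) linop" where "x2 j = W (\<lambda>(n, p). q powi ip m (beta 1 j) n * xr_coeff j p) (0, - beta 1 j)"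
definition yr_coeff :: "lat \<Rightarrow> 'k" where "yr_coeff n = - (q powi ((\<Sum>k=2..m+1. n k) - n 1))"
definition y1 :: "nat \<Rightarrow> (bilat, 'k) linop" where "y1 j = W (\<lambda>(n, p). yr_coeff n * xr_coeff j n) (- beta_delta j, 0)"

lemma br_add: "R.br (a + b) c = R.br a c + R.br b c" "R.br a (b + c) = R.br a b + R.br a c"
  unfolding R.br_def by (simp_all add: algebra_simps)

lemma br_W: "R.br (W \<phi> s) (W \<psi> t) = W (\<lambda>p. \<phi> p * \<psi> (p + s) - inverse q * (\<psi> p * \<phi> (p + t))) (s + t)"
  unfolding R.br_def W_mult \<sigma>_W by (simp add: add.commute[of t s] W_diff)

lemma xr_coeff_Suc: "1 \<le> j \<Longrightarrow> xr_coeff (Suc j) n = q powi (\<Sum>k=2..j. n k) * q powi (n (Suc j)) * qn (n (Suc (Suc j)) + 1)"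
  using q0 by (simp add: xr_coeff_def power_int_add)

lemma xr_coeff_shift:
  assumes "1 \<le> j" "j < m"
  shows "xr_coeff j (n - sroot m (Suc j)) = q powi (\<Sum>k=2..j. n k) * qn (n (Suc j))"
proof -
  have "(\<Sum>k=2..j. (n - sroot m (Suc j)) k) = (\<Sum>k=2..j. n k)"
    by (rule sum.cong) (auto simp: sroot_def)
  then show ?thesis by (simp add: xr_coeff_def sroot_def)
qed

lemma xr_coeff_br:
  assumes "1 \<le> j" "j < m"
  shows "xr_coeff j n * qn (n (Suc (Suc j)) + 1) - inverse q * (qn (n (Suc (Suc j)) + 1) * xr_coeff j (n - sroot m (Suc j))) = xr_coeff (Suc j) n"
proof -
  have "xr_coeff j n * qn (n (Suc (Suc j)) + 1) - inverse q * (qn (n (Suc (Suc j)) + 1) * xr_coeff j (n - sroot m (Suc j)))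
    = q powi (\<Sum>k=2..j. n k) * qn (n (Suc (Suc j)) + 1) * (qn (n (Suc j) + 1) - inverse q * qn (n (Suc j)))"
    unfolding xr_coeff_shift[OF assms] by (simp add: xr_coeff_def algebra_simps)
  also have "\<dots> = xr_coeff (Suc j) n" unfolding qn_step xr_coeff_Suc[OF assms(1)] by (simp add: mult_ac)
  finally show ?thesis .
qed

lemma beta_Suc': "1 \<le> j \<Longrightarrow> - beta 1 j - sroot m (Suc j) = - beta 1 (Suc j)"
  by (auto simp: beta_def sroot_def fun_eq_iff)

lemma beta_delta_Suc': "1 \<le> j \<Longrightarrow> - beta_delta j - sroot m (Suc j) = - beta_delta (Suc j)"
  by (auto simp: beta_def sroot_def beta_delta_def fun_eq_iff)

lemma x1_br: assumes "1 \<le> j" "j < m" shows "R.br (x1 j) (A1 (Suc j)) = x1 (Suc j)"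
  unfolding x1_def A1_def osc1_def br_W
proof (rule W_cong_pair, goal_cases)
  case (1 n p)
  show ?case using xr_coeff_br[OF assms, of n] assms by (simp add: beta_apply)
qed (use assms beta_Suc' in simp)

lemma x2_br: assumes "1 \<le> j" "j < m" shows "R.br (x2 j) (A2 (Suc j)) = x2 (Suc j)"
  unfolding x2_def A2_def osc2_def br_W
proof (rule W_cong_pair, goal_cases)
  case (1 n p)
  have ip: "ip m (beta 1 (Suc j)) n = ip m (beta 1 j) n + ip m (sroot m (Suc j)) n"
    using ip_beta_Suc[OF assms, of n] by (simp add: ip_sym[of m n])
  show ?case
    unfolding ip prod.case xr_coeff_br[OF assms, of p, symmetric]
    using assms q0 by (simp add: beta_apply power_int_add algebra_simps)
qed (use assms beta_Suc' in simp)

lemma ip_sroot_beta: "1 \<le> j \<Longrightarrow> j < m \<Longrightarrow> ip m (beta 1 j) (sroot m (Suc j)) = -1"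
  by (simp add: ip_sroot head_index_def beta_def)

text \<open>This removes the terms of x_j in which E_1 acts in the second factor but a later
  generator in the first. Their weight would be positive, above that of the intended leading
  term.\<close>

lemma x2_br0: assumes "1 \<le> j" "j < m" shows "R.br (x2 j) (A1 (Suc j)) = 0"
proof -
  have "R.br (x2 j) (A1 (Suc j)) = W (\<lambda>_. 0) ((0, - beta 1 j) + (- sroot m (Suc j), 0))"
    unfolding x2_def A1_def osc1_def br_W
    by (rule W_cong) (use assms q0 ip_sroot_beta[OF assms] in \<open>auto simp: ip_diff power_int_add\<close>)
  then show ?thesis by (simp add: W_0)
qed

lemma y1_br: assumes "1 \<le> j" "j < m" shows "R.br (y1 j) (A1 (Suc j)) = y1 (Suc j)"
  unfolding y1_def A1_def osc1_def br_W
proof (rule W_cong_pair, goal_cases)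
  case (1 n p)
  have g: "yr_coeff (n - sroot m (Suc j)) = yr_coeff n"
  proof -
    have "(\<Sum>k=2..m+1. (n - sroot m (Suc j)) k) = (\<Sum>k=2..m+1. n k) - (\<Sum>k=2..m+1. sroot m (Suc j) k)"
      by (simp add: sum_subtractf)
    also have "(\<Sum>k=2..m+1. sroot m (Suc j) k) = (\<Sum>k=1..m+1. sroot m (Suc j) k)"
      using assms by (intro sum.mono_neutral_left) (auto simp: sroot_def)
    also have "\<dots> = 0" using assms by (intro sroot_sum) auto
    finally have "(\<Sum>k=2..m+1. (n - sroot m (Suc j)) k) = (\<Sum>k=2..m+1. n k)" by (simp only: diff_0_right)
    moreover have "(n - sroot m (Suc j)) 1 = n 1" using assms by (simp add: sroot_def)
    ultimately show ?thesis unfolding yr_coeff_def by (simp only:)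
  qed
  show ?case unfolding prod.case xr_coeff_br[OF assms, of n, symmetric]
    using assms by (simp add: beta_apply beta_delta_apply g algebra_simps)
qed (use assms beta_delta_Suc' in simp)

lemma x1_1: "x1 1 = A1 1" "x2 1 = A2 1"
  using beta_self[of 1 m] by (simp_all add: x1_def x2_def A1_def A2_def osc1_def osc2_def xr_coeff_def mult.commute)

lemma Fil_x1: "1 \<le> j \<Longrightarrow> j \<le> m \<Longrightarrow> int j - int m - 1 \<le> c \<Longrightarrow> x1 j \<in> Fil c"
  unfolding x1_def by (rule Fil_W) (simp only: lam_values)

lemma Fil_x2: "0 \<le> c \<Longrightarrow> x2 j \<in> Fil c"
  unfolding x2_def by (rule Fil_W) (simp only: lam_values)

lemma Fil_y1: "1 \<le> j \<Longrightarrow> j \<le> m \<Longrightarrow> int j \<le> c \<Longrightarrow> y1 j \<in> Fil c"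
  unfolding y1_def by (rule Fil_W) (simp only: lam_values)

lemma \<rho>_qcomm: "\<rho> (qcomm q a b) = R.br (\<rho> a) (\<rho> b)"
  by (simp add: qcomm_def R.br_def rho.ev_minus rho.ev_mult rho.ev_sc mult.assoc)

lemma \<rho>_E: "\<rho> (gen (E i)) = A1 i + A2 i" by (simp add: rho.ev_gen)

text \<open>The summand \<open>x1 j\<close> lies below \<open>x2 j\<close> but is kept, because it
  supplies the leading term of y_1. In the remaining terms E_1 acts in the first factor and some
  later generator in the second, which costs at least 1 against the weight of
  \<open>x1 j\<close>.\<close>

lemma \<rho>_xr: "1 \<le> j \<Longrightarrow> j \<le> m \<Longrightarrow> \<rho> (xr j) - (x2 j + x1 j) \<in> Fil (int j - int m - 2)"
proof (induction j rule: nat_induct_at_least[of 1])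
  case base
  have "\<rho> (xr 1) - (x2 1 + x1 1) = W (\<lambda>_. 0) (0, 0)"
    unfolding x1_1 by (simp add: \<rho>_E W_0)
  moreover have "W (\<lambda>_. 0 :: 'k) (0, 0) \<in> Fil c" for c unfolding W_0 Fil_def by (simp add: linop_apply_simps)
  ultimately show ?case by metis
next
  case (Suc j)
  then have j: "1 \<le> j" "j < m" by auto
  define R where "R = \<rho> (xr j) - (x2 j + x1 j)"
  have R: "R \<in> Fil (int j - int m - 2)" using Suc R_def by simp
  have "xr (Suc j) = qcomm q (xr j) (gen (E (Suc j)))" using j by (cases j) auto
  then have "\<rho> (xr (Suc j)) = R.br (x2 j + x1 j + R) (A1 (Suc j) + A2 (Suc j))"
    by (simp add: \<rho>_qcomm \<rho>_E R_def)
  also have "\<dots> - (x2 (Suc j) + x1 (Suc j)) = R.br (x1 j) (A2 (Suc j)) + R.br R (A1 (Suc j) + A2 (Suc j))"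
    unfolding br_add x1_br[OF j] x2_br[OF j] x2_br0[OF j] by simp
  also have "\<dots> \<in> Fil (int (Suc j) - int m - 2)"
  proof (rule Fil_add)
    show "R.br (x1 j) (A2 (Suc j)) \<in> Fil (int (Suc j) - int m - 2)"
      by (rule Fil_br[OF Fil_x1[OF _ _ order_refl] Fil_A2[OF order_refl]]) (use j in auto)
    show "R.br R (A1 (Suc j) + A2 (Suc j)) \<in> Fil (int (Suc j) - int m - 2)"
      by (rule Fil_br[OF R Fil_add[OF Fil_A1[of _ 1] Fil_A2[of 1]]]) (use j lam_values(2)[of "Suc j"] in auto)
  qed
  finally show ?case .
qed

definition w1 :: "(bilat, 'k) linop" where
  "w1 = W (\<lambda>(n, p). - (q powi (- n 1 - 1)) * qn (n 2 + 1)) (- (sroot m 1 + sroot m 0), 0)"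

lemma w1_br: "R.br (A1 1) (A1 0) = w1" "R.br (A2 1) (A1 0) = 0"
proof -
  show "R.br (A1 1) (A1 0) = w1"
    unfolding A1_def osc1_def br_W w1_def
  proof (rule W_cong_pair, goal_cases)
    case (1 n p)
    have "qn (n 2 + 1) * qn (n 1) - inverse q * (qn (n 1 + 1) * qn (n 2 + 1))
      = (qn (n 1) - inverse q * qn (n 1 + 1)) * qn (n 2 + 1)" by (simp add: algebra_simps)
    then show ?case
      unfolding qn_step' using m2 by (simp add: sroot_def numeral_2_eq_2)
  qed simp
  have ip: "ip m (sroot m 1) (sroot m 0) = -1" using m2 by (simp add: ip_sroot_sroot head_index_def)
  have "R.br (A2 1) (A1 0) = \<sigma> (q powi (-1)) * (A1 0 * A2 1) - li (A1 0 * A2 1)"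
    unfolding R.br_def by (simp only: A2_A1 ip)
  then show "R.br (A2 1) (A1 0) = 0" by (simp add: power_int_minus)
qed

lemma Fil_w1: "2 \<le> c \<Longrightarrow> w1 \<in> Fil c"
proof -
  have "lam (- (sroot m 1 + sroot m 0), 0) = lam ((- sroot m 1, 0) + (- sroot m 0, 0))" by simp
  also have "\<dots> = 2" unfolding lam_add lam_values by simp
  finally show "2 \<le> c \<Longrightarrow> w1 \<in> Fil c" unfolding w1_def by (intro Fil_W) simp
qed

text \<open>The group-like factor that \<open>x2 m\<close> has in the first tensor factor passes the
  shift by alpha_1 + alpha_0 with a factor q, because the pairing with \<open>beta 1 m\<close> is
  -1; this cancels the q^-1 of the bracket.\<close>

lemma x2_w1: "R.br (x2 m) w1 = 0"
proof -
  have ip: "ip m (beta 1 m) (sroot m 1 + sroot m 0) = -1"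
    using m2 by (simp add: ip_add ip_sroot head_index_def beta_def)
  have "R.br (x2 m) w1 = W (\<lambda>_. 0) ((0, - beta 1 m) + (- (sroot m 1 + sroot m 0), 0))"
    unfolding x2_def w1_def br_W
  proof (rule W_cong_pair, goal_cases)
    case (1 n p)
    have "q powi ip m (beta 1 m) (n + - (sroot m 1 + sroot m 0)) = q * q powi ip m (beta 1 m) n"
      unfolding ip_add[of _ _ n] ip_minus ip using q0 by (simp add: power_int_add)
    then show ?case using q0 by (simp only: add_Pair prod.case) simp
  qed simp
  then show ?thesis by (simp add: W_0)
qed

lemma x1_w1: "R.br (x1 m) w1 = y1 1"
  unfolding x1_def w1_def y1_def br_W
proof (rule W_cong_pair, goal_cases)
  case (1 n p)
  let ?d = "sroot m 1 + sroot m 0"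
  have "{2..m} = insert 2 {3..m}" using m2 by auto
  moreover have "(\<Sum>k=3..m. (n + - ?d) k) = (\<Sum>k=3..m. n k)"
    by (rule sum.cong) (auto simp: sroot_def)
  ultimately have S: "(\<Sum>k=2..m. (n + - ?d) k) = (\<Sum>k=2..m. n k) + 1"
    using m2 by (simp add: sroot_def)
  have f: "xr_coeff m (n + - ?d) = q powi (\<Sum>k=2..m. n k) * q * qn (n (Suc m))"
    unfolding xr_coeff_def S using m2 q0 by (simp add: sroot_def power_int_add)
  have b: "(n + - beta 1 m) 1 = n 1 - 1" "(n + - beta 1 m) 2 = n 2" using m2 by (simp_all add: beta_def)
  have g: "yr_coeff n = - (q powi (\<Sum>k=2..m. n k) * q powi (n (Suc m)) * q powi (- n 1))"
    using m2 q0 by (simp add: yr_coeff_def power_int_add power_int_diff power_int_minus field_simps)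
  have "xr_coeff m n * (- (q powi (- (n 1 - 1) - 1)) * qn (n 2 + 1))
     - inverse q * (- (q powi (- n 1 - 1)) * qn (n 2 + 1) * (q powi (\<Sum>k=2..m. n k) * q * qn (n (Suc m))))
    = - (q powi (\<Sum>k=2..m. n k) * q powi (- n 1) * qn (n 2 + 1)) * (qn (n (Suc m) + 1) - inverse q * qn (n (Suc m)))"
    using q0 by (simp add: xr_coeff_def power_int_diff power_int_minus algebra_simps)
  also have "\<dots> = yr_coeff n * xr_coeff 1 n" unfolding qn_step g by (simp add: xr_coeff_def numeral_2_eq_2)
  finally show ?case by (simp only: add_Pair prod.case f b)
next
  case 2
  have "beta 1 m + (sroot m 1 + sroot m 0) = beta_delta 1"
    using m2 by (auto simp: beta_def sroot_def beta_delta_def fun_eq_iff)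
  then show ?case
    by (metis (no_types, opaque_lifting) add_Pair add.right_neutral minus_add_distrib)
qed

text \<open>At j = 1 the part x2 of x_m drops out against \<open>w1\<close>, so the leading term is
  [x1 m, w1] of weight -1 + 2 = 1. The rest of x_m has weight at most -2 and contributes at most
  0.\<close>

lemma \<rho>_yr: "1 \<le> j \<Longrightarrow> j \<le> m \<Longrightarrow> \<rho> (yr j) - y1 j \<in> Fil (int j - 1)"
proof (induction j rule: nat_induct_at_least[of 1])
  case base
  define R where "R = \<rho> (xr m) - (x2 m + x1 m)"
  have R: "R \<in> Fil (-2)" using \<rho>_xr[of m] m2 R_def by simp
  \<comment> \<open>The part of [E_1, E_0] in which E_0 acts in the second factor; together with x_m
    it stays at weight 0.\<close>
  define V where "V = R.br (A1 1 + A2 1) (A2 0)"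
  have V: "V \<in> Fil 0" unfolding V_def
    by (rule Fil_br[OF Fil_add[OF Fil_A1[of _ 0] Fil_A2[of 0]] Fil_A2[of 0]]) (use lam_values(4) in auto)
  have X: "\<rho> (xr m) = x2 m + x1 m + R" by (simp add: R_def)
  have XF: "\<rho> (xr m) \<in> Fil 0" unfolding X
    by (intro Fil_add Fil_x2 Fil_x1 Fil_mono[OF R]) (use m2 in auto)
  have "\<rho> (yr 1) = R.br (\<rho> (xr m)) (R.br (A1 1 + A2 1) (A1 0 + A2 0))"
    by (simp add: \<rho>_qcomm \<rho>_E)
  also have "R.br (A1 1 + A2 1) (A1 0 + A2 0) = w1 + V"
    unfolding br_add(2) V_def by (simp only: br_add(1) w1_br add_0_right)
  also have "R.br (\<rho> (xr m)) (w1 + V) = y1 1 + (R.br R w1 + R.br (\<rho> (xr m)) V)"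
    unfolding br_add(2) by (simp add: X br_add(1) x2_w1 x1_w1)
  also have "\<dots> - y1 1 = R.br R w1 + R.br (\<rho> (xr m)) V" by simp
  also have "\<dots> \<in> Fil (int 1 - 1)"
    by (intro Fil_add Fil_br[OF R Fil_w1[of 2]] Fil_br[OF XF V]) auto
  finally show ?case .
next
  case (Suc j)
  then have j: "1 \<le> j" "j < m" by auto
  define R where "R = \<rho> (yr j) - y1 j"
  have R: "R \<in> Fil (int j - 1)" using Suc R_def by simp
  have "yr (Suc j) = qcomm q (yr j) (gen (E (Suc j)))" using j by (cases j) auto
  then have "\<rho> (yr (Suc j)) = R.br (y1 j + R) (A1 (Suc j) + A2 (Suc j))"
    by (simp add: \<rho>_qcomm \<rho>_E R_def)
  also have "\<dots> - y1 (Suc j) = R.br (y1 j) (A2 (Suc j)) + R.br R (A1 (Suc j) + A2 (Suc j))"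
    unfolding br_add y1_br[OF j] by simp
  also have "\<dots> \<in> Fil (int (Suc j) - 1)"
  proof (rule Fil_add)
    show "R.br (y1 j) (A2 (Suc j)) \<in> Fil (int (Suc j) - 1)"
      by (rule Fil_br[OF Fil_y1[OF _ _ order_refl] Fil_A2[OF order_refl]]) (use j in auto)
    show "R.br R (A1 (Suc j) + A2 (Suc j)) \<in> Fil (int (Suc j) - 1)"
      by (rule Fil_br[OF R Fil_add[OF Fil_A1[of _ 1] Fil_A2[of 1]]]) (use j lam_values(2)[of "Suc j"] in auto)
  qed
  finally show ?case .
qed

lemma \<rho>_xr': "1 \<le> j \<Longrightarrow> j \<le> m \<Longrightarrow> \<rho> (xr j) - x2 j \<in> Fil (-1)"
  using Fil_add[OF Fil_mono[OF \<rho>_xr[of j], of "-1"] Fil_x1[of j "-1"]] by simp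

end

section \<open>Normal words and injectivity\<close>

context generic_q
begin

text \<open>At such points every q-integer in the leading coefficients has a positive argument and
  so does not vanish. Coordinates 0 and 1 enter those coefficients only through exponents and stay
  free.\<close>

definition admissible :: "bilat \<Rightarrow> bool" where
  "admissible t \<longleftrightarrow> (\<forall>k\<ge>2. 0 \<le> fst t k \<and> 0 \<le> snd t k)"

text \<open>The shift itself must be admissible because in a product the second coefficient is
  evaluated at the shifted point.\<close>

definition lead :: "bilat \<Rightarrow> (bilat, 'k) linop \<Rightarrow> bool" where
  "lead t R \<longleftrightarrow> admissible t \<and> (\<exists>\<phi>. (\<forall>p. admissible p \<longrightarrow> \<phi> p \<noteq> 0) \<and> R - W \<phi> t \<in> Fil (lam t - 1))"

lemma admissible_add: "admissible s \<Longrightarrow> admissible t \<Longrightarrow> admissible (s + t)"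
  by (auto simp: admissible_def)

lemma zero_Fil: "0 \<in> Fil c" by (simp add: Fil_def linop_apply_simps)

lemma lead_mult:
  assumes "lead s R" "lead t S" shows "lead (s + t) (R * S)"
proof -
  from assms obtain \<phi> \<psi> where \<phi>: "\<And>p. admissible p \<Longrightarrow> \<phi> p \<noteq> 0" "R - W \<phi> s \<in> Fil (lam s - 1)"
    and \<psi>: "\<And>p. admissible p \<Longrightarrow> \<psi> p \<noteq> 0" "S - W \<psi> t \<in> Fil (lam t - 1)" and st: "admissible s" "admissible t"
    unfolding lead_def by blast
  have S: "S \<in> Fil (lam t)"
    using Fil_add[OF Fil_mono[OF \<psi>(2)] Fil_W[of t "lam t" \<psi>]] by simp
  have "R * S - W (\<lambda>p. \<phi> p * \<psi> (p + s)) (s + t) = W \<phi> s * (S - W \<psi> t) + (R - W \<phi> s) * S"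
    unfolding W_mult[symmetric] by (simp add: algebra_simps)
  also have "\<dots> \<in> Fil (lam (s + t) - 1)"
    using Fil_add[OF Fil_mult[OF Fil_W[of s "lam s" \<phi>] \<psi>(2)], of "(R - W \<phi> s) * S"] Fil_mult[OF \<phi>(2) S]
    by (simp add: lam_add algebra_simps)
  finally have "R * S - W (\<lambda>p. \<phi> p * \<psi> (p + s)) (s + t) \<in> Fil (lam (s + t) - 1)" .
  moreover have "\<phi> p * \<psi> (p + s) \<noteq> 0" if "admissible p" for p
    using \<phi>(1) \<psi>(1) admissible_add[OF that st(1)] that by simp
  ultimately show ?thesis unfolding lead_def
    by (intro conjI admissible_add st exI[of _ "\<lambda>p. \<phi> p * \<psi> (p + s)"] allI impI)
qed

lemma lead_1: "lead 0 1"
proof -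
  have "1 - W (\<lambda>_. 1) 0 \<in> Fil (lam 0 - 1)" unfolding W_1[symmetric] diff_self by (rule zero_Fil)
  moreover have "admissible 0" by (simp add: admissible_def)
  moreover have "\<forall>p :: bilat. admissible p \<longrightarrow> (1 :: 'k) \<noteq> 0" by simp
  ultimately show ?thesis unfolding lead_def by (intro conjI exI[of _ "\<lambda>_. 1"])
qed

lemma xr_coeff_0: "1 \<le> j \<Longrightarrow> 0 \<le> n (Suc j) \<Longrightarrow> xr_coeff j n \<noteq> 0"
  using q0 qn_0[of "n (Suc j) + 1"] by (simp add: xr_coeff_def)

lemma lead_xr: assumes "1 \<le> j" "j \<le> m" shows "lead (0, - beta 1 j) (\<rho> (xr j))"
proof -
  have "\<rho> (xr j) - W (\<lambda>(n, p). q powi ip m (beta 1 j) n * xr_coeff j p) (0, - beta 1 j) \<in> Fil (lam (0, - beta 1 j) - 1)"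
    using \<rho>_xr'[OF assms] by (simp only: x2_def lam_values) simp
  moreover have "case p of (n, p) \<Rightarrow> q powi ip m (beta 1 j) n * xr_coeff j p \<noteq> 0" if "admissible p" for p
    using that assms q0 xr_coeff_0[of j "snd p"] by (cases p) (auto simp: admissible_def)
  ultimately show ?thesis unfolding lead_def
    by (intro conjI exI[of _ "\<lambda>(n, p). q powi ip m (beta 1 j) n * xr_coeff j p"])
      (auto simp: admissible_def beta_def case_prod_beta)
qed

lemma lead_yr: assumes "1 \<le> j" "j \<le> m" shows "lead (- beta_delta j, 0) (\<rho> (yr j))"
proof -
  have "\<rho> (yr j) - W (\<lambda>(n, p). yr_coeff n * xr_coeff j n) (- beta_delta j, 0) \<in> Fil (lam (- beta_delta j, 0) - 1)"
    using \<rho>_yr[OF assms] by (simp only: y1_def lam_values(6)[OF assms])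
  moreover have "case p of (n, p) \<Rightarrow> yr_coeff n * xr_coeff j n \<noteq> 0" if "admissible p" for p
    using that assms q0 xr_coeff_0[of j "fst p"] by (cases p) (auto simp: admissible_def yr_coeff_def)
  ultimately show ?thesis unfolding lead_def
    by (intro conjI exI[of _ "\<lambda>(n, p). yr_coeff n * xr_coeff j n"])
      (auto simp: admissible_def beta_delta_def beta_def case_prod_beta)
qed

fun lead_shift :: "ogen \<Rightarrow> bilat" where "lead_shift (X i j) = (if i = 1 then (0, - beta 1 j) else (- beta_delta j, 0))"

lemma lead_word: "set gs \<subseteq> ogens m \<Longrightarrow> lead (sum_list (map lead_shift gs)) (prod_list (map (\<lambda>g. \<rho> (root_rep g)) gs))"
proof (induction gs)
  case (Cons g gs)
  then have "lead (lead_shift g) (\<rho> (root_rep g))"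
    by (cases g) (auto simp: ogens_def lead_xr[simplified] lead_yr[simplified])
  then show ?case using Cons lead_mult by simp
qed (simp add: lead_1)

text \<open>Among the indices with nonzero coefficient take v with shift of maximal weight, apply
  the sum to the indicator function of the point \<open>t v\<close> and evaluate at 0. Lower terms
  see only points of smaller weight, and by injectivity of t no other index reaches that
  point.\<close>

lemma lead_independent:
  assumes fin: "finite S" and inj: "inj_on t S" and l: "\<And>w. w \<in> S \<Longrightarrow> lead (t w) (R w)"
    and z: "(\<Sum>w\<in>S. \<sigma> (c w) * R w) = 0" and w: "w \<in> S"
  shows "c w = 0"
proof (rule ccontr)
  assume cw: "c w \<noteq> 0"
  define S' where "S' = {w\<in>S. c w \<noteq> 0}"
  have S': "finite S'" "S' \<noteq> {}" using fin w cw by (auto simp: S'_def)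
  define M where "M = Max ((lam \<circ> t) ` S')"
  have "M \<in> (lam \<circ> t) ` S'" unfolding M_def using S' by (intro Max_in) auto
  then obtain v where v: "v \<in> S'" "lam (t v) = M" by auto
  have max: "lam (t w) \<le> lam (t v)" if "w \<in> S'" for w
    unfolding v(2) M_def using S' that by (intro Max_ge) auto
  define f :: "bilat \<Rightarrow> 'k" where "f p = (if p = t v then 1 else 0)" for p
  have linop_apply_sum: "linop_apply (sum h T) f p = (\<Sum>w\<in>T. linop_apply (h w) f p)" for h :: "'b \<Rightarrow> (bilat, 'k) linop" and T p
    by (induction T rule: infinite_finite_induct) (simp_all add: linop_apply_simps)
  have val: "\<exists>\<phi>. \<phi> \<noteq> 0 \<and> linop_apply (R w) f 0 = (if w = v then \<phi> else 0)" if "w \<in> S'" for w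
  proof -
    have wS: "w \<in> S" "v \<in> S" using that v(1) by (auto simp: S'_def)
    from l[OF wS(1)] obtain \<phi> where \<phi>: "\<And>p. admissible p \<Longrightarrow> \<phi> p \<noteq> 0" "R w - W \<phi> (t w) \<in> Fil (lam (t w) - 1)"
      unfolding lead_def by blast
    have "f p' = 0" if "lam p' \<le> lam 0 + (lam (t w) - 1)" for p'
      using that max[OF \<open>w \<in> S'\<close>] by (auto simp: f_def lam_0)
    then have "linop_apply (R w - W \<phi> (t w)) f 0 = 0" using \<phi>(2) unfolding Fil_def by blast
    then have "linop_apply (R w) f 0 = \<phi> 0 * f (t w)" by (simp add: linop_apply_simps)
    moreover have "f (t w) = (if w = v then 1 else 0)"
      using inj_onD[OF inj _ wS] by (auto simp: f_def)
    moreover have "\<phi> 0 \<noteq> 0" by (rule \<phi>(1)) (simp add: admissible_def)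
    ultimately show ?thesis by (intro exI[of _ "\<phi> 0"]) auto
  qed
  then obtain \<phi> where \<phi>: "\<And>w. w \<in> S' \<Longrightarrow> \<phi> w \<noteq> 0 \<and> linop_apply (R w) f 0 = (if w = v then \<phi> w else 0)"
    by metis
  have "0 = linop_apply (\<Sum>w\<in>S. \<sigma> (c w) * R w) f 0" unfolding z by (simp add: linop_apply_simps)
  also have "\<dots> = (\<Sum>w\<in>S. c w * linop_apply (R w) f 0)"
    unfolding linop_apply_sum by (simp add: linop_apply_simps \<sigma>_def)
  also have "\<dots> = (\<Sum>w\<in>S'. c w * linop_apply (R w) f 0)"
    using fin by (intro sum.mono_neutral_right) (auto simp: S'_def)
  also have "\<dots> = (\<Sum>w\<in>S'. if w = v then c v * \<phi> v else 0)"
    by (rule sum.cong) (use \<phi> in auto)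
  also have "\<dots> = c v * \<phi> v" using S' v(1) by simp
  finally show False using v(1) \<phi>[of v] by (simp add: S'_def)
qed

section \<open>Normal words and their independence\<close>

definition nword :: "nat list \<Rightarrow> nat list \<Rightarrow> ogen list" where
  "nword u v = map (X 1) u @ map (X 2) v"

definition normal_words :: "ogen word set" where
  "normal_words = {Wd (nword u v) | u v. set u \<subseteq> {1..m} \<and> set v \<subseteq> {1..m} \<and> sorted u \<and> sorted v}"

text \<open>The shift thus records the multiplicity of every letter, those of row 1 in the second
  factor and those of row 2 in the first; a sorted word can be recovered from it.\<close>

lemma lead_shift_nword:
  assumes "1 \<le> j"
  shows "snd (sum_list (map lead_shift (nword u v))) (Suc j) = int (count_list u j)"
    "fst (sum_list (map lead_shift (nword u v))) (Suc j) = int (count_list v j)"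
proof -
  have "snd (sum_list (map lead_shift (map (X 1) u))) (Suc j) = int (count_list u j)"
    "fst (sum_list (map lead_shift (map (X 1) u))) (Suc j) = 0"
    using assms by (induction u) (auto simp: beta_apply)
  moreover have "snd (sum_list (map lead_shift (map (X 2) v))) (Suc j) = 0"
    "fst (sum_list (map lead_shift (map (X 2) v))) (Suc j) = int (count_list v j)"
    using assms by (induction v) (auto simp: beta_apply beta_delta_apply)
  ultimately show "snd (sum_list (map lead_shift (nword u v))) (Suc j) = int (count_list u j)"
    "fst (sum_list (map lead_shift (nword u v))) (Suc j) = int (count_list v j)"
    by (simp_all add: nword_def)
qed

lemma sorted_eq_of_count:
  assumes "sorted u" "sorted u'" "set u \<subseteq> {1..m}" "set u' \<subseteq> {1..m}"
    "\<And>j. 1 \<le> j \<Longrightarrow> count_list u j = count_list u' j"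
  shows "u = u'"
proof -
  have "count_list u j = count_list u' j" for j
  proof (cases "1 \<le> j")
    case False
    then have "j \<notin> set u" "j \<notin> set u'" using assms(3,4) by auto
    then show ?thesis by simp
  qed (use assms(5) in simp)
  then have "mset u = mset u'" by (intro multiset_eqI) (simp add: count_mset)
  then show ?thesis using assms(1,2) by (metis properties_for_sort sorted_sort_id)
qed

lemma inj_lead_shift: "inj_on (\<lambda>w. sum_list (map lead_shift (letters w))) normal_words"
proof (rule inj_onI)
  fix w w' assume w: "w \<in> normal_words" "w' \<in> normal_words"
    and e: "sum_list (map lead_shift (letters w)) = sum_list (map lead_shift (letters w'))"
  from w obtain u v u' v' where uv: "w = Wd (nword u v)" "w' = Wd (nword u' v')"
    "set u \<subseteq> {1..m}" "set v \<subseteq> {1..m}" "sorted u" "sorted v"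
    "set u' \<subseteq> {1..m}" "set v' \<subseteq> {1..m}" "sorted u'" "sorted v'"
    unfolding normal_words_def by blast
  have "count_list u j = count_list u' j" "count_list v j = count_list v' j" if "1 \<le> j" for j
    using e lead_shift_nword[OF that, of u v] lead_shift_nword[OF that, of u' v'] uv(1,2) by auto
  then have "u = u'" "v = v'" using uv by (auto intro!: sorted_eq_of_count)
  then show "w = w'" using uv by simp
qed

lemma normal_ogens: "w \<in> normal_words \<Longrightarrow> set (letters w) \<subseteq> ogens m"
  unfolding normal_words_def nword_def ogens_def by fastforce

lemma normal_independent:
  assumes keys: "Poly_Mapping.keys p \<subseteq> normal_words" and \<Phi>: "\<Phi> p \<in> U_ideal m q"
  shows "p = 0"
proof -
  have "\<forall>w\<in>Poly_Mapping.keys p. \<exists>c. c \<noteq> 0 \<and> twisted_word (letters w) = sc c * prod_list (map root_rep (letters w))"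
    using keys normal_ogens twisted_word_prod by blast
  then obtain \<kappa> where \<kappa>: "\<And>w. w \<in> Poly_Mapping.keys p \<Longrightarrow> \<kappa> w \<noteq> 0"
    "\<And>w. w \<in> Poly_Mapping.keys p \<Longrightarrow> twisted_word (letters w) = sc (\<kappa> w) * prod_list (map root_rep (letters w))"
    by metis
  have prod: "\<rho> (prod_list xs) = prod_list (map \<rho> xs)" for xs
    by (induction xs) (simp_all add: rho.ev_1 rho.ev_mult)
  have sum: "\<rho> (sum g S) = (\<Sum>i\<in>S. \<rho> (g i))" for g :: "ogen word \<Rightarrow> _" and S
    by (induction S rule: infinite_finite_induct) (simp_all add: rho.ev_minus(1) rho.ev_add)
  have "0 = \<rho> (\<Phi> p)" using \<rho>_U_ideal[OF \<Phi>] by simp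
  also have "\<dots> = (\<Sum>w\<in>Poly_Mapping.keys p. \<sigma> (Poly_Mapping.lookup p w * \<kappa> w) * prod_list (map (\<lambda>g. \<rho> (root_rep g)) (letters w)))"
    unfolding \<Phi>_def word_sum_def sum
    by (rule sum.cong) (simp_all add: \<kappa>(2) rho.ev_mult rho.ev_sc prod \<sigma>_simps(2) mult.assoc comp_def)
  finally have *: "Poly_Mapping.lookup p w * \<kappa> w = 0" if "w \<in> Poly_Mapping.keys p" for w
    by (intro lead_independent[of "Poly_Mapping.keys p" "\<lambda>w. sum_list (map lead_shift (letters w))"
        "\<lambda>w. prod_list (map (\<lambda>g. \<rho> (root_rep g)) (letters w))"])
      (use that keys in \<open>auto intro!: lead_word inj_on_subset[OF inj_lead_shift] dest: normal_ogens\<close>)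
  have "Poly_Mapping.keys p = {}"
  proof (rule equals0I)
    fix w assume "w \<in> Poly_Mapping.keys p"
    then show False using *[of w] \<kappa>(1)[of w] by (simp add: in_keys_iff)
  qed
  then show "p = 0" by (simp only: keys_eq_empty)
qed

section \<open>Normal words span the algebra of quantum matrices\<close>

abbreviation Oq :: "(ogen, 'k) freealg \<Rightarrow> (ogen, 'k) quot" where "Oq \<equiv> cls (O_rels m q)"

definition oX :: "nat \<Rightarrow> nat \<Rightarrow> (ogen, 'k) quot" where "oX i j = Oq (gen (X i j))"

definition oW :: "ogen list \<Rightarrow> (ogen, 'k) quot" where "oW gs = Oq (Poly_Mapping.single (Wd gs) 1)"

lemma oW_Cons: "oW (X i j # gs) = oX i j * oW gs"
  by (simp add: oW_def oX_def gen_def mult_single plus_word_def flip: cls_mult)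

lemma oX_relations:
  "i \<in> {1, 2} \<Longrightarrow> 1 \<le> j \<Longrightarrow> j < l \<Longrightarrow> l \<le> m \<Longrightarrow> oX i l * oX i j = scq (inverse q) (oX i j * oX i l)"
  "1 \<le> j \<Longrightarrow> j \<le> m \<Longrightarrow> oX 2 j * oX 1 j = scq (inverse q) (oX 1 j * oX 2 j)"
  "1 \<le> j \<Longrightarrow> j < l \<Longrightarrow> l \<le> m \<Longrightarrow> oX 2 j * oX 1 l = oX 1 l * oX 2 j"
  "1 \<le> j \<Longrightarrow> j < l \<Longrightarrow> l \<le> m \<Longrightarrow> oX 2 l * oX 1 j = oX 1 j * oX 2 l - scq (qhat q) (oX 1 l * oX 2 j)"
proof -
  have inv: "y = scq (inverse q) x" if "x = scq q y" for x y :: "(ogen, 'k) quot"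
    using that q0 by (simp add: scq_scq scq_1)
  have rel: "Oq s = 0" if "s \<in> O_rels m q" for s
    using cls_rel[of s 0 "O_rels m q"] that by (simp add: cls_0)
  have z: "a = b" if "a - b = 0" for a b :: "(ogen, 'k) quot" using that by simp
  show "oX i l * oX i j = scq (inverse q) (oX i j * oX i l)" if "i \<in> {1, 2}" "1 \<le> j" "j < l" "l \<le> m"
  proof (rule inv, rule z)
    have "gen (X i j) * gen (X i l) - sc q * gen (X i l) * gen (X i j) \<in> O_rels m q"
      unfolding O_rels_def using that by blast
    from rel[OF this] show "oX i j * oX i l - scq q (oX i l * oX i j) = 0"
      by (simp add: oX_def cls_simps mult.assoc)
  qed
  show "oX 2 j * oX 1 j = scq (inverse q) (oX 1 j * oX 2 j)" if "1 \<le> j" "j \<le> m"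
  proof (rule inv, rule z)
    have "gen (X 1 j) * gen (X 2 j) - sc q * gen (X 2 j) * gen (X 1 j) \<in> O_rels m q"
      unfolding O_rels_def using that by blast
    from rel[OF this] show "oX 1 j * oX 2 j - scq q (oX 2 j * oX 1 j) = 0"
      by (simp add: oX_def cls_simps mult.assoc)
  qed
  show "oX 2 j * oX 1 l = oX 1 l * oX 2 j" if "1 \<le> j" "j < l" "l \<le> m"
  proof (rule sym, rule z)
    have "gen (X 1 l) * gen (X 2 j) - gen (X 2 j) * gen (X 1 l) \<in> O_rels m q"
      unfolding O_rels_def using that by blast
    from rel[OF this] show "oX 1 l * oX 2 j - oX 2 j * oX 1 l = 0"
      by (simp add: oX_def cls_simps)
  qed
  show "oX 2 l * oX 1 j = oX 1 j * oX 2 l - scq (qhat q) (oX 1 l * oX 2 j)" if "1 \<le> j" "j < l" "l \<le> m"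
  proof -
    have "gen (X 1 j) * gen (X 2 l) - gen (X 2 l) * gen (X 1 j) - sc (qhat q) * gen (X 1 l) * gen (X 2 j) \<in> O_rels m q"
      unfolding O_rels_def using that by blast
    from rel[OF this] have "oX 1 j * oX 2 l - oX 2 l * oX 1 j - scq (qhat q) (oX 1 l * oX 2 j) = 0"
      by (simp add: oX_def cls_simps mult.assoc)
    then show ?thesis by (simp add: algebra_simps)
  qed
qed

definition span_of :: "ogen word set \<Rightarrow> (ogen, 'k) quot set" where
  "span_of S = {Oq p | p. Poly_Mapping.keys p \<subseteq> S}"

lemma span_of_add: "a \<in> span_of S \<Longrightarrow> b \<in> span_of S \<Longrightarrow> a + b \<in> span_of S"
  unfolding span_of_def using keys_add by (fastforce simp flip: cls_add)

lemma span_of_scq: "a \<in> span_of S \<Longrightarrow> scq c a \<in> span_of S"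
proof -
  have "Poly_Mapping.keys (sc c * p) \<subseteq> Poly_Mapping.keys p" for p :: "(ogen, 'k) freealg"
    using keys_mult[of "sc c" p] by (auto simp: sc_def split: if_splits)
  then show "a \<in> span_of S \<Longrightarrow> scq c a \<in> span_of S"
    unfolding span_of_def by (fastforce simp flip: cls_sc)
qed

lemma span_of_diff: "a \<in> span_of S \<Longrightarrow> b \<in> span_of S \<Longrightarrow> a - b \<in> span_of S"
  unfolding span_of_def mem_Collect_eq by (metis (no_types, lifting) cls_diff keys_diff order_trans sup.boundedI Un_least)

lemma span_of_0: "0 \<in> span_of S"
  unfolding span_of_def mem_Collect_eq by (rule exI[of _ 0]) (simp add: cls_0)

lemma span_of_word: "Wd gs \<in> S \<Longrightarrow> oW gs \<in> span_of S"
  unfolding span_of_def oW_def by auto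

text \<open>The left factor x makes one induction serve twice: for multiplication by a generator
  and, with x the class of the empty word, for passing from one spanning set to another.\<close>

lemma span_of_induct:
  assumes z: "a \<in> span_of S" and W: "\<And>gs. Wd gs \<in> S \<Longrightarrow> x * oW gs \<in> span_of S'" shows "x * a \<in> span_of S'"
proof -
  from z obtain p where p: "a = Oq p" "Poly_Mapping.keys p \<subseteq> S" by (auto simp: span_of_def)
  have "x * Oq (\<Sum>w\<in>A. Poly_Mapping.single w (Poly_Mapping.lookup p w)) \<in> span_of S'" if "finite A" "A \<subseteq> S" for A
    using that
  proof (induction A rule: finite_induct)
    case (insert w A)
    obtain gs where w: "w = Wd gs" by (cases w) auto
    have "Oq (Poly_Mapping.single w c) = scq c (oW gs)" for c
      unfolding w oW_def by (simp add: sc_single flip: cls_sc)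
    then have "x * Oq (Poly_Mapping.single w c) \<in> span_of S'" for c
      using W[of gs] insert w by (simp add: scalar_op_simps(6)[OF scalar_op_scq] span_of_scq)
    then show ?case using insert by (simp add: cls_add distrib_left span_of_add)
  qed (simp add: cls_0 span_of_0)
  moreover have "p = (\<Sum>w\<in>Poly_Mapping.keys p. Poly_Mapping.single w (Poly_Mapping.lookup p w))"
    by (rule poly_mapping_eqI) (simp add: lookup_sum lookup_single when_def in_keys_iff)
  ultimately show ?thesis using p by (metis finite_keys)
qed

definition split_words :: "ogen word set" where
  "split_words = {Wd (nword u v) | u v. set u \<subseteq> {1..m} \<and> set v \<subseteq> {1..m}}"

lemma split_wordsI: "set u \<subseteq> {1..m} \<Longrightarrow> set v \<subseteq> {1..m} \<Longrightarrow> Wd (nword u v) \<in> split_words"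
  unfolding split_words_def by blast

lemma split_wordsE:
  assumes "Wd gs \<in> split_words"
  obtains u v where "gs = nword u v" "set u \<subseteq> {1..m}" "set v \<subseteq> {1..m}"
  using assms unfolding split_words_def by blast

lemma nword_Cons: "X 1 j # nword u v = nword (j # u) v" "X 2 l # nword [] v = nword [] (l # v)"
  by (simp_all add: nword_def)

lemma split_X1: "1 \<le> j \<Longrightarrow> j \<le> m \<Longrightarrow> a \<in> span_of split_words \<Longrightarrow> oX 1 j * a \<in> span_of split_words"
proof (erule span_of_induct)
  fix gs assume j: "1 \<le> j" "j \<le> m" and gs: "Wd gs \<in> split_words"
  from gs obtain u v where uv: "gs = nword u v" "set u \<subseteq> {1..m}" "set v \<subseteq> {1..m}" by (rule split_wordsE)
  then have "Wd (X 1 j # gs) \<in> split_words"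
    unfolding uv nword_Cons using j by (intro split_wordsI) auto
  then show "oX 1 j * oW gs \<in> span_of split_words" unfolding oW_Cons[symmetric] by (rule span_of_word)
qed

text \<open>Moving X_2l past X_1j may produce a correction X_1l X_2j, but each term begins with one
  letter of row 1 and has one letter of row 2 left to move through the shorter word. The index of
  that letter can change, so l is arbitrary in the induction.\<close>

lemma split_X2_word:
  "set u \<subseteq> {1..m} \<Longrightarrow> set v \<subseteq> {1..m} \<Longrightarrow> 1 \<le> l \<Longrightarrow> l \<le> m \<Longrightarrow> oX 2 l * oW (nword u v) \<in> span_of split_words"
proof (induction u arbitrary: l)
  case Nil
  then have "Wd (X 2 l # nword [] v) \<in> split_words"
    unfolding nword_Cons by (intro split_wordsI) auto
  then show ?case unfolding oW_Cons[symmetric] by (rule span_of_word)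
next
  case (Cons j u)
  then have j: "1 \<le> j" "j \<le> m" by auto
  let ?w = "oW (nword u v)"
  have IH: "oX 1 i * (oX 2 k * ?w) \<in> span_of split_words" if "1 \<le> i" "i \<le> m" "1 \<le> k" "k \<le> m" for i k
    by (rule split_X1) (use that Cons in auto)
  have w: "oX 2 l * oW (nword (j # u) v) = oX 2 l * oX 1 j * ?w"
    by (simp add: nword_def oW_Cons mult.assoc)
  consider "l = j" | "l < j" | "j < l" by linarith
  then show ?case
  proof cases
    case 1
    then show ?thesis unfolding w using j oX_relations(2)[of j] IH[of j j]
      by (simp add: mult.assoc scalar_op_simps(5)[OF scalar_op_scq] span_of_scq)
  next
    case 2
    then show ?thesis unfolding w using j Cons.prems oX_relations(3)[of l j] IH[of j l]
      by (simp add: mult.assoc)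
  next
    case 3
    then show ?thesis unfolding w using j Cons.prems oX_relations(4)[of j l] IH[of j l] IH[of l j]
      by (simp add: mult.assoc left_diff_distrib scalar_op_simps(5)[OF scalar_op_scq] span_of_scq span_of_diff)
  qed
qed

lemma split_X: "g \<in> ogens m \<Longrightarrow> a \<in> span_of split_words \<Longrightarrow> Oq (gen g) * a \<in> span_of split_words"
proof -
  assume g: "g \<in> ogens m" and a: "a \<in> span_of split_words"
  then obtain i j where ij: "g = X i j" "i = 1 \<or> i = 2" "1 \<le> j" "j \<le> m" by (auto simp: ogens_def)
  have "oX 2 j * a \<in> span_of split_words"
    using ij by (intro span_of_induct[OF a]) (auto elim!: split_wordsE intro!: split_X2_word)
  then show ?thesis using split_X1[OF _ _ a, of j] ij by (auto simp: oX_def)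
qed

lemma word_in_split: "set gs \<subseteq> ogens m \<Longrightarrow> oW gs \<in> span_of split_words"
proof (induction gs)
  case Nil
  have "Wd [] \<in> split_words" unfolding split_words_def nword_def by auto
  then show ?case by (rule span_of_word)
next
  case (Cons g gs)
  obtain i j where "g = X i j" by (cases g)
  then show ?case using split_X[of g "oW gs"] Cons by (simp add: oW_Cons oX_def)
qed

text \<open>The scalar is chosen before the tail \<open>gs\<close>, so that reordering the row 1
  block is independent of what stands behind it.\<close>

lemma oX_insort:
  "i \<in> {1, 2} \<Longrightarrow> 1 \<le> x \<Longrightarrow> x \<le> m \<Longrightarrow> set us \<subseteq> {1..m} \<Longrightarrow>
    \<exists>c. \<forall>gs. oX i x * oW (map (X i) us @ gs) = scq c (oW (map (X i) (insort x us) @ gs))"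
proof (induction us)
  case Nil
  then show ?case by (intro exI[of _ 1]) (simp add: oW_Cons scq_1)
next
  case (Cons y us)
  show ?case
  proof (cases "x \<le> y")
    case True
    then show ?thesis by (intro exI[of _ 1]) (simp add: oW_Cons scq_1)
  next
    case False
    from Cons obtain c where c: "\<And>gs. oX i x * oW (map (X i) us @ gs) = scq c (oW (map (X i) (insort x us) @ gs))"
      by auto
    have "oX i x * oX i y = scq (inverse q) (oX i y * oX i x)"
      using oX_relations(1)[of i y x] Cons False by auto
    then have "oX i x * oW (map (X i) (y # us) @ gs) = scq (inverse q * c) (oW (map (X i) (insort x (y # us)) @ gs))" for gs
      using False c[of gs]
      by (simp add: oW_Cons scalar_op_simps(5,6)[OF scalar_op_scq] mult.assoc scq_scq flip: mult.assoc[of "oX i x"])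
    then show ?thesis by blast
  qed
qed

lemma oW_sort:
  "i \<in> {1, 2} \<Longrightarrow> set us \<subseteq> {1..m} \<Longrightarrow> \<exists>c. \<forall>gs. oW (map (X i) us @ gs) = scq c (oW (map (X i) (sort us) @ gs))"
proof (induction us)
  case Nil
  show ?case by (intro exI[of _ 1]) (simp add: scq_1)
next
  case (Cons x us)
  then obtain c where c: "\<And>gs. oW (map (X i) us @ gs) = scq c (oW (map (X i) (sort us) @ gs))" by auto
  obtain d where d: "\<And>gs. oX i x * oW (map (X i) (sort us) @ gs) = scq d (oW (map (X i) (insort x (sort us)) @ gs))"
    using oX_insort[of i x "sort us"] Cons by auto
  have "oW (map (X i) (x # us) @ gs) = scq (c * d) (oW (map (X i) (sort (x # us)) @ gs))" for gs
    by (simp add: oW_Cons c d scalar_op_simps(6)[OF scalar_op_scq] scq_scq)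
  then show ?case by blast
qed

lemma oW_append: "oW (gs @ hs) = oW gs * oW hs"
  by (simp add: oW_def mult_single plus_word_def flip: cls_mult)

lemma split_in_normal: "Wd gs \<in> split_words \<Longrightarrow> oW gs \<in> span_of normal_words"
proof -
  assume "Wd gs \<in> split_words"
  then obtain u v where uv: "gs = nword u v" "set u \<subseteq> {1..m}" "set v \<subseteq> {1..m}" by (rule split_wordsE)
  obtain c where c: "\<And>gs. oW (map (X 1) u @ gs) = scq c (oW (map (X 1) (sort u) @ gs))"
    using oW_sort[of 1 u] uv by auto
  obtain d where d: "oW (map (X 2) v) = scq d (oW (map (X 2) (sort v)))"
    using oW_sort[of 2 v] uv by (metis append_Nil2 insertCI)
  have "oW gs = scq c (scq d (oW (nword (sort u) (sort v))))"
    unfolding uv nword_def c by (simp add: oW_append d scalar_op_simps(6)[OF scalar_op_scq])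
  moreover have "Wd (nword (sort u) (sort v)) \<in> normal_words"
    unfolding normal_words_def using uv(2,3)
    by (intro CollectI exI[of _ "sort u"] exI[of _ "sort v"] conjI) auto
  ultimately show ?thesis by (simp add: span_of_scq span_of_word)
qed

lemma normal_form:
  assumes "free_on (ogens m) a"
  shows "\<exists>p. Poly_Mapping.keys p \<subseteq> normal_words \<and> a - p \<in> O_ideal m q"
proof -
  let ?one = "oW []"
  \<comment> \<open>The class of the empty word is a unit on the factor belonging to these
    relations, not on the packed product ring.\<close>
  have one: "?one * x = x" if "x \<in> span_of S" for x S
    using that by (auto simp: oW_def span_of_def zero_word_def[symmetric] simp flip: cls_mult)
  have 0: "Oq a \<in> span_of {w. set (letters w) \<subseteq> ogens m}" using assms by (auto simp: span_of_def free_on_def)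
  from 0 have "?one * Oq a \<in> span_of split_words"
    by (rule span_of_induct) (metis mem_Collect_eq letters.simps one word_in_split)
  then have 1: "Oq a \<in> span_of split_words" by (simp only: one[OF 0])
  from 1 have "?one * Oq a \<in> span_of normal_words"
    by (rule span_of_induct) (metis one split_in_normal)
  then have "Oq a \<in> span_of normal_words" using one[OF 1] by simp
  then show ?thesis by (auto simp: span_of_def cls_eq_iff O_ideal_def)
qed

lemma \<Phi>_inj:
  assumes a: "free_on (ogens m) a" and \<Phi>: "\<Phi> a \<in> U_ideal m q"
  shows "a \<in> O_ideal m q"
proof -
  obtain p where p: "Poly_Mapping.keys p \<subseteq> normal_words" "a - p \<in> O_ideal m q"
    using normal_form[OF a] by blast
  have "\<Phi> p = \<Phi> a - \<Phi> (a - p)" by (simp add: \<Phi>_minus(3))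
  also have "\<dots> \<in> U_ideal m q" using \<Phi> \<Phi>_O_ideal[OF p(2)] unfolding U_ideal_def by (rule ideal_diff)
  finally have "p = 0" by (rule normal_independent[OF p(1)])
  then show ?thesis using p(2) by simp
qed

lemma \<Phi>_iso: "iso_Oq_twisted_DCKP m q \<Phi>"
proof -
  have z: "0 \<in> U_ideal m q" unfolding U_ideal_def by (rule ideal_gen.zero)
  show ?thesis unfolding iso_Oq_twisted_DCKP_def Let_def
  proof (intro conjI allI impI ballI)
    fix a b :: "(ogen, 'k) freealg" assume ab: "free_on (ogens m) a" "free_on (ogens m) b"
    show "\<Phi> a - \<Phi> b \<in> U_ideal m q" if "a - b \<in> O_ideal m q"
      using \<Phi>_O_ideal[OF that] by (simp add: \<Phi>_minus(3))
    show "a - b \<in> O_ideal m q" if "\<Phi> a - \<Phi> b \<in> U_ideal m q"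
      using \<Phi>_inj[OF free_on_diff[OF ab]] that by (simp add: \<Phi>_minus(3))
    show "\<Phi> (sc c * a + b) - (sc c * \<Phi> a + \<Phi> b) \<in> U_ideal m q" for c
      by (simp only: \<Phi>_add \<Phi>_sc_mult diff_self z)
  qed (simp_all add: z \<Phi>_mult \<Phi>_1 \<Phi>_in_DCKP DCKP_in_\<Phi>)
qed

end

theorem theorem6p4:
  fixes q :: "'k::field_char_0" and m :: nat
  assumes "alg_closed TYPE('k)"
    and "q \<noteq> 0"
    and "transcendental_over_Q q"
    and "m > 1"
  shows "\<exists>\<Phi>. iso_Oq_twisted_DCKP m q \<Phi>"
proof -
  interpret generic_q q m
    using assms transcendental_power_neq_1 by unfold_locales auto
  show ?thesis using \<Phi>_iso by blast
qed

end
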